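(* Let $\beta$ be an admissible and compatible weight on an at most countable additive subgroup $\Xi$ of $\mathbb{R}/\mathbb{Z}$. Let $\mathcal{R}=\mathcal{W}_{\alpha_1,\alpha_2}(\mathcal{A})$ with $\alpha_1,\alpha_2\ge0$, $\alpha_1+\alpha_2=1$, and $\mathcal{A}=APW(\mathbb{Z},\Xi,\beta)$. If $A_1,\dots,A_r\in\mathcal{R}$ and $A=e^{A_1}\cdots e^{A_r}$, then $$\lim_{n_2-n_1\to\infty}\left(\frac{\det(P_{n_1,n_2}AP_{n_1,n_2})}{G^{n_2-n_1}}-\Theta_{A,1}(\tau_{n_1})\,\Theta_{A,2}(\tau_{n_2})\right)=0,$$ where $G=\exp(M(a))$ and $a=D(A_1+\cdots+A_r)$.
   Context: The limit $\lim_{n_2-n_1\to\infty}\sigma_{n_1,n_2}=0$ means: for each $\epsilon>0$ there is $k\in\mathbb{N}$ such that $|\sigma_{n_1,n_2}|<\epsilon$ whenever $n_1,n_2\in\mathbb{Z}$ and $n_2-n_1>k$. $\mathbb{Z}^+=\{0,1,2,\dots\}$, $\mathbb{T}=\{t\in\mathbb{C}:|t|=1\}$. For $\xi\in\mathbb{R}/\mathbb{Z}$, $e_\xi\in l^\infty(\mathbb{Z})$ is $e_\xi(k)=e^{2\pi ik\xi}$ and $\|\xi\|_{\mathbb{R}/\mathbb{Z}}=\inf\{|\xi-n|:n\in\mathbb{Z}\}$. $\mathrm{Hom}(\Xi,\mathbb{T})$ is the set of group homomorphisms $\Xi\to\mathbb{T}$; for $n\in\mathbb{Z}$, $\tau_n\in\mathrm{Hom}(\Xi,\mathbb{T})$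 is $\tau_n(\xi)=e^{2\pi in\xi}$. Weights: $\beta:\Xi\to\mathbb{R}^+$ is admissible if $1\le\beta(\xi_1+\xi_2)\le\beta(\xi_1)\beta(\xi_2)$ for all $\xi_1,\xi_2\in\Xi$; it is compatible if $\inf_{\xi\in\Xi,\xi\ne0}\beta(\xi)\|\xi\|_{\mathbb{R}/\mathbb{Z}}>0$ (the infimum over the empty set being $+\infty$). $APW(\mathbb{Z},\Xi,\beta)$ is the set of all $a\in l^\infty(\mathbb{Z})$ of the form $a=\sum_{\xi\in\Xi}a_\xi e_\xi$ with norm $\|a\|_{\Xi,\beta}=\sum_{\xi\in\Xi}\beta(\xi)|a_\xi|<\infty$. For $A=(a_{j,k})\in\mathcal{L}(l^2(\mathbb{Z}))$, the $k$-th diagonal is $D_k(A)=(a_{j,j-k})_{j\in\mathbb{Z}}$, and $D(A)=D_0(A)$. $\mathcal{W}_{\alpha_1,\alpha_2}(\mathcal{A})$ is the set of $A\in\mathcal{L}(l^2(\mathbb{Z}))$ with $D_k(A)\in\mathcal{A}$ for all $k$ and $\|A\|=\sum_{k\in\mathbb{Z}}\alpha(k)\|D_k(A)\|_{\mathcal{A}}<\infty$, where $\alpha(k)=(1+k)^{\alpha_1}$ for $k\ge0$ and $\alpha(k)=(1+|k|)^{\alpha_2}$ for $k<0$; it is a unital Banach algebra. With $U_n:(x_k)\mapsto(x_{k-n})$ and $bI$ the multiplication operator $(x_k)\mapsto(b(k)x_k)$, each such $A$ equals $\sum_{n}\sum_{\xi\in\Xi}a^{(n)}_\xi(e_\xi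 I)U_n$ with $D_n(A)=\sum_\xi a^{(n)}_\xi e_\xi$. For $\tau\in\mathrm{Hom}(\Xi,\mathbb{T})$ let $\mathcal{U}^\tau:\mathcal{R}\to\mathcal{R}$, $\sum_n\sum_\xi a^{(n)}_\xi(e_\xi I)U_n\mapsto\sum_n\sum_\xi a^{(n)}_\xi\tau(\xi)(e_\xi I)U_n$. $T(A)=PAP$ is the compression of $A$ to $l^2(\mathbb{Z}^+)$ ($P$ the orthogonal projection of $l^2(\mathbb{Z})$ onto $l^2(\mathbb{Z}^+)$). For $A=e^{A_1}\cdots e^{A_r}$ with $A_i\in\mathcal{R}$ and $a=\sum_{\xi\in\Xi}a_\xi e_\xi=D(A_1+\cdots+A_r)$ put $$\Theta_{A,1}(\tau)=\exp\Big(\sum_{\xi\in\Xi,\xi\ne0}a_\xi\frac{\tau(\xi)}{1-e^{2\pi i\xi}}\Big)\det\big(T(\mathcal{U}^\tau A)e^{-T(\mathcal{U}^\tau A_r)}\cdots e^{-T(\mathcal{U}^\tau A_1)}\big),$$ $$\Theta_{A,2}(\tau)=\exp\Big(\sum_{\xi\in\Xi,\xi\ne0}a_\xi\frac{-\tau(\xi)}{1-e^{2\pi i\xi}}\Big)\det\big(e^{T(\mathcal{U}^\tau A_1)}\cdots e^{T(\mathcal{U}^\tau A_r)}T(\mathcal{U}^\tau A^{-1})\big),$$ where the determinants are operator (Fredholm) determinants of operators of the form identity plus trace class on $l^2(\mathbb{Z}^+)$ (these are well defined). $M(a)=\lim_{n\to\infty}\frac1n\sum_{k=0}^{n-1}a(k)$.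 For integers $n_1<n_2$, $P_{n_1,n_2}$ is the projection on $l^2(\mathbb{Z})$ keeping the coordinates $x_k$ with $n_1\le k<n_2$; $P_{n_1,n_2}AP_{n_1,n_2}$ is identified with a matrix of order $n_2-n_1$. *)

theory Defs
  imports
    "HOL-Analysis.Analysis"
    "Jordan_Normal_Form.Determinant"
begin

hide_const (open) Determinants.det

section \<open>The group of real numbers modulo the integers\<close>

quotient_type real_mod_int = real / "\<lambda>x y :: real. x - y \<in> \<int>"
proof (rule equivpI)
  show "reflp (\<lambda>x y :: real. x - y \<in> \<int>)"
    by (simp add: reflp_def)
  show "symp (\<lambda>x y :: real. x - y \<in> \<int>)"
    by (metis (no_types, lifting) Ints_minus minus_diff_eq sympI)
  show "transp (\<lambda>x y :: real. x - y \<in> \<int>)"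
  proof (rule transpI)
    fix x y z :: real
    assume "x - y \<in> \<int>" "y - z \<in> \<int>"
    then have "(x - y) + (y - z) \<in> \<int>" by (rule Ints_add)
    then show "x - z \<in> \<int>" by simp
  qed
qed

instantiation real_mod_int :: ab_group_add
begin

lift_definition zero_real_mod_int :: real_mod_int is "0 :: real" .

lift_definition plus_real_mod_int :: "real_mod_int \<Rightarrow> real_mod_int \<Rightarrow> real_mod_int" is "(+)"
  by (simp add: add_diff_add)

lift_definition uminus_real_mod_int :: "real_mod_int \<Rightarrow> real_mod_int" is uminus
  by (metis Ints_minus minus_diff_minus)

lift_definition minus_real_mod_int :: "real_mod_int \<Rightarrow> real_mod_int \<Rightarrow> real_mod_int" is "(-)"
proof -
  fix x y x' y' :: real
  assume "x - y \<in> \<int>" "x' - y' \<in> \<int>"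
  then have "(x - y) - (x' - y') \<in> \<int>" by (rule Ints_diff)
  then show "(x - x') - (y - y') \<in> \<int>" by (simp add: algebra_simps)
qed

instance
  by standard (transfer; simp)+

end

lift_definition circle_norm :: "real_mod_int \<Rightarrow> real" is "\<lambda>x. INF n::int. \<bar>x - of_int n\<bar>"
proof -
  fix x y :: real
  assume "x - y \<in> \<int>"
  then obtain m :: int where m: "x - y = of_int m" by (auto elim: Ints_cases)
  have "range (\<lambda>n::int. \<bar>x - of_int n\<bar>) = range (\<lambda>n::int. \<bar>y - of_int n\<bar>)"
  proof (intro equalityI subsetI)
    fix t assume "t \<in> range (\<lambda>n::int. \<bar>x - of_int n\<bar>)"
    then obtain n :: int where "t = \<bar>x - of_int n\<bar>" by auto
    with m have "t = \<bar>y - of_int (n - m)\<bar>" by (simp add: algebra_simps)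
    then show "t \<in> range (\<lambda>n::int. \<bar>y - of_int n\<bar>)" by blast
  next
    fix t assume "t \<in> range (\<lambda>n::int. \<bar>y - of_int n\<bar>)"
    then obtain n :: int where "t = \<bar>y - of_int n\<bar>" by auto
    with m have "t = \<bar>x - of_int (n + m)\<bar>" by (simp add: algebra_simps)
    then show "t \<in> range (\<lambda>n::int. \<bar>x - of_int n\<bar>)" by blast
  qed
  then show "(INF n::int. \<bar>x - of_int n\<bar>) = (INF n::int. \<bar>y - of_int n\<bar>)" by simp
qed

lift_definition echar :: "real_mod_int \<Rightarrow> int \<Rightarrow> complex"
  is "\<lambda>x k. exp (2 * of_real pi * \<i> * of_int k * of_real x)"
proof
  fix x y :: real and k :: int
  assume "x - y \<in> \<int>"
  then obtain m :: int where m: "x - y = of_int m" by (auto elim: Ints_cases)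
  then have "x = y + of_int m" by simp
  then have *: "2 * of_real pi * \<i> * of_int k * of_real x
      = 2 * of_real pi * \<i> * of_int k * of_real y + \<i> * (of_int (k * m) * (of_real pi * 2))"
    by (simp add: algebra_simps)
  show "exp (2 * of_real pi * \<i> * of_int k * of_real x)
      = exp (2 * of_real pi * \<i> * of_int k * of_real y)"
    unfolding * exp_add using exp_integer_2pi[of "of_int (k * m)"]
    by (simp add: algebra_simps)
qed

definition add_subgroup :: "'a::ab_group_add set \<Rightarrow> bool" where
  "add_subgroup H \<longleftrightarrow> 0 \<in> H \<and> (\<forall>x\<in>H. \<forall>y\<in>H. x + y \<in> H) \<and> (\<forall>x\<in>H. - x \<in> H)"

definition admissible :: "real_mod_int set \<Rightarrow> (real_mod_int \<Rightarrow> real) \<Rightarrow> bool" where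
  "admissible \<Xi> \<beta> \<longleftrightarrow>
    (\<forall>\<xi>\<in>\<Xi>. 0 < \<beta> \<xi>) \<and>
    (\<forall>\<xi>\<^sub>1\<in>\<Xi>. \<forall>\<xi>\<^sub>2\<in>\<Xi>. 1 \<le> \<beta> (\<xi>\<^sub>1 + \<xi>\<^sub>2) \<and> \<beta> (\<xi>\<^sub>1 + \<xi>\<^sub>2) \<le> \<beta> \<xi>\<^sub>1 * \<beta> \<xi>\<^sub>2)"

text \<open>The infimum is taken in the extended reals, so that it is \<open>\<infinity>\<close> when \<open>\<Xi> = {0}\<close>.\<close>

definition compatible :: "real_mod_int set \<Rightarrow> (real_mod_int \<Rightarrow> real) \<Rightarrow> bool" where
  "compatible \<Xi> \<beta> \<longleftrightarrow> (INF \<xi>\<in>\<Xi> - {0}. ereal (\<beta> \<xi> * circle_norm \<xi>)) > 0"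


section \<open>Almost periodic sequences with weighted absolutely summable coefficients\<close>

definition APW :: "real_mod_int set \<Rightarrow> (real_mod_int \<Rightarrow> real) \<Rightarrow> (int \<Rightarrow> complex) set" where
  "APW \<Xi> \<beta> = {a. \<exists>c. (\<lambda>\<xi>. \<beta> \<xi> * cmod (c \<xi>)) summable_on \<Xi> \<and>
                     (\<forall>k. ((\<lambda>\<xi>. c \<xi> * echar \<xi> k) has_sum a k) \<Xi>)}"

text \<open>The coefficients \<open>a\<^sub>\<xi>\<close> of \<open>a = (\<Sum>\<xi>\<in>\<Xi>. a\<^sub>\<xi> e\<^sub>\<xi>)\<close>, extended by zero outside \<open>\<Xi>\<close>; they are unique
  (see \<open>ap_coeff_eqI\<close> below), so the definite description is meaningful for every \<open>a\<close> in APW.\<close>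

definition ap_coeff :: "real_mod_int set \<Rightarrow> (int \<Rightarrow> complex) \<Rightarrow> real_mod_int \<Rightarrow> complex" where
  "ap_coeff \<Xi> a = (THE c. (\<forall>\<xi>. \<xi> \<notin> \<Xi> \<longrightarrow> c \<xi> = 0) \<and> (\<lambda>\<xi>. cmod (c \<xi>)) summable_on \<Xi> \<and>
                         (\<forall>k. ((\<lambda>\<xi>. c \<xi> * echar \<xi> k) has_sum a k) \<Xi>))"

lemma echar_add: "echar (x + y) k = echar x k * echar y k"
  by transfer (simp add: exp_add[symmetric] algebra_simps)

lemma echar_uminus: "echar (- x) k = inverse (echar x k)"
  by transfer (simp add: exp_minus[symmetric])

lemma echar_0: "echar 0 k = 1"
  by transfer simp

lemma norm_echar: "cmod (echar x k) = 1"
  by transfer (simp add: norm_exp_eq_Re)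

lemma echar_of_nat: "echar x (int k) = echar x 1 ^ k"
  by transfer (simp add: exp_of_nat_mult[symmetric] algebra_simps)

lemma echar_1_eq_1_iff: "echar x 1 = 1 \<longleftrightarrow> x = 0"
proof transfer
  fix x :: real
  have "exp (2 * of_real pi * \<i> * of_int 1 * of_real x) = 1 \<longleftrightarrow> (\<exists>n::int. 2 * pi * x = of_int (2 * n) * pi)"
    by (subst exp_eq_1) (simp add: algebra_simps)
  also have "\<dots> \<longleftrightarrow> (\<exists>n::int. x = of_int n)"
    by (intro ex_cong1) auto
  also have "\<dots> \<longleftrightarrow> x - 0 \<in> \<int>"
    by (auto simp: Ints_def)
  finally show "exp (2 * of_real pi * \<i> * of_int 1 * of_real x) = 1 \<longleftrightarrow> x - 0 \<in> \<int>" .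
qed

lemma echar_mean:
  "(\<lambda>n. (\<Sum>k<n. echar x (int k)) / of_nat n) \<longlonglongrightarrow> (if x = 0 then 1 else 0)"
proof (cases "x = 0")
  case True
  have "\<forall>\<^sub>F n in sequentially. 1 = (\<Sum>k<n. echar x (int k)) / of_nat n"
    using eventually_gt_at_top[of 0] by eventually_elim (simp add: True echar_0)
  then show ?thesis using True by (simp add: tendsto_cong[symmetric] Lim_transform_eventually[OF tendsto_const])
next
  case False
  define z where "z = echar x 1"
  have z: "z \<noteq> 1" "cmod z = 1" using False by (auto simp: z_def echar_1_eq_1_iff norm_echar)
  have "(\<lambda>n. (\<Sum>k<n. echar x (int k)) / of_nat n) \<longlonglongrightarrow> 0"
  proof (rule Lim_null_comparison)
    show "(\<lambda>n. 2 / cmod (1 - z) * (1 / of_nat n)) \<longlonglongrightarrow> (0 :: real)"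
      by (intro tendsto_mult_right_zero lim_1_over_n)
    show "\<forall>\<^sub>F n in sequentially. cmod ((\<Sum>k<n. echar x (int k)) / of_nat n) \<le> 2 / cmod (1 - z) * (1 / of_nat n)"
    proof (intro always_eventually allI)
      fix n :: nat
      have "cmod (1 - z ^ n) \<le> 2"
        using norm_triangle_ineq4[of 1 "z ^ n"] z by (simp add: norm_power)
      then have "cmod (\<Sum>k<n. z ^ k) \<le> 2 / cmod (1 - z)"
        using z by (simp add: sum_gp_strict norm_divide divide_right_mono)
      then show "cmod ((\<Sum>k<n. echar x (int k)) / of_nat n) \<le> 2 / cmod (1 - z) * (1 / of_nat n)"
        unfolding echar_of_nat[of x] z_def[symmetric]
          using divide_right_mono[of _ _ "real n"] by (fastforce simp: norm_divide)
    qed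
  qed
  then show ?thesis using False by simp
qed

lemma ap_series_eq_0:
  assumes s: "(\<lambda>\<xi>. cmod (d \<xi>)) summable_on \<Xi>"
    and z: "\<And>k. ((\<lambda>\<xi>. d \<xi> * echar \<xi> k) has_sum 0) \<Xi>"
    and \<eta>: "\<eta> \<in> \<Xi>"
  shows "d \<eta> = 0"
proof -
  have "cmod (d \<eta>) \<le> e" if e: "e > 0" for e
  proof -
    obtain F0 where F0: "finite F0" "F0 \<subseteq> \<Xi>" "dist (\<Sum>\<xi>\<in>F0. cmod (d \<xi>)) (\<Sum>\<^sub>\<infinity>\<xi>\<in>\<Xi>. cmod (d \<xi>)) \<le> e"
      using infsum_finite_approximation[OF s e] by blast
    define F where "F = insert \<eta> F0"
    have F: "finite F" "F \<subseteq> \<Xi>" "\<eta> \<in> F" using F0 \<eta> by (auto simp: F_def)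
    have sF: "(\<lambda>\<xi>. cmod (d \<xi>)) summable_on \<Xi> - F"
      by (rule summable_on_subset_banach[OF s]) auto
    have "(\<Sum>\<^sub>\<infinity>\<xi>\<in>\<Xi>. cmod (d \<xi>)) = (\<Sum>\<^sub>\<infinity>\<xi>\<in>F \<union> (\<Xi> - F). cmod (d \<xi>))"
      using F(2) by (simp add: Un_absorb1)
    also have "\<dots> = (\<Sum>\<xi>\<in>F. cmod (d \<xi>)) + (\<Sum>\<^sub>\<infinity>\<xi>\<in>\<Xi> - F. cmod (d \<xi>))"
      using F(1) sF by (subst infsum_Un_disjoint) auto
    finally have eq: "(\<Sum>\<^sub>\<infinity>\<xi>\<in>\<Xi>. cmod (d \<xi>)) = \<dots>" .
    have "(\<Sum>\<xi>\<in>F0. cmod (d \<xi>)) \<le> (\<Sum>\<xi>\<in>F. cmod (d \<xi>))"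
      using F by (intro sum_mono2) (auto simp: F_def)
    with eq F0(3) have tail: "(\<Sum>\<^sub>\<infinity>\<xi>\<in>\<Xi> - F. cmod (d \<xi>)) \<le> e"
      by (simp add: dist_real_def)
    define m where "m n x = (\<Sum>k<n. echar x (int k)) / of_nat n" for n :: nat and x
    have m1: "cmod (m n x) \<le> 1" for n x
    proof -
      have "cmod (\<Sum>k<n. echar x (int k)) \<le> of_nat n"
        using norm_sum[of "\<lambda>k. echar x (int k)" "{..<n}"] by (simp add: norm_echar)
      then show ?thesis by (cases "n = 0") (simp_all add: m_def norm_divide divide_le_eq_1)
    qed
    have bound: "cmod (\<Sum>\<xi>\<in>F. d \<xi> * m n (\<xi> - \<eta>)) \<le> e" for n
    proof -
      have "((\<lambda>\<xi>. echar (- \<eta>) (int k) * (d \<xi> * echar \<xi> (int k))) has_sum 0) \<Xi>" for k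
        using has_sum_cmult_right[OF z[of "int k"]] by fastforce
      then have "((\<lambda>\<xi>. d \<xi> * echar (\<xi> - \<eta>) (int k)) has_sum 0) \<Xi>" for k
        using echar_add[of _ "- \<eta>" "int k"] by (simp add: mult_ac)
      then have "((\<lambda>\<xi>. \<Sum>k<n. d \<xi> * echar (\<xi> - \<eta>) (int k)) has_sum (\<Sum>k<n. 0)) \<Xi>"
        by (induction n) (simp, use has_sum_add in fastforce)
      then have "((\<lambda>\<xi>. (\<Sum>k<n. d \<xi> * echar (\<xi> - \<eta>) (int k)) * inverse (of_nat n)) has_sum 0 * inverse (of_nat n)) \<Xi>"
        by (intro has_sum_cmult_left) simp
      then have h: "((\<lambda>\<xi>. d \<xi> * m n (\<xi> - \<eta>)) has_sum 0) \<Xi>"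
        by (simp add: m_def sum_distrib_left divide_inverse mult_ac)
      have "cmod (d \<xi> * m n (\<xi> - \<eta>)) \<le> cmod (d \<xi>)" for \<xi>
        using m1 by (simp add: norm_mult mult_left_le)
      note le = this
      have sn: "(\<lambda>\<xi>. cmod (d \<xi> * m n (\<xi> - \<eta>))) summable_on \<Xi> - F"
        by (rule Infinite_Sum.abs_summable_on_comparison_test[of d]) (use sF le in auto)
      then have sc: "(\<lambda>\<xi>. d \<xi> * m n (\<xi> - \<eta>)) summable_on \<Xi> - F"
        by (rule abs_summable_summable)
      have "0 = (\<Sum>\<^sub>\<infinity>\<xi>\<in>F \<union> (\<Xi> - F). d \<xi> * m n (\<xi> - \<eta>))"
        using infsumI[OF h] F(2) by (simp add: Un_absorb1)
      also have "\<dots> = (\<Sum>\<xi>\<in>F. d \<xi> * m n (\<xi> - \<eta>)) + (\<Sum>\<^sub>\<infinity>\<xi>\<in>\<Xi> - F. d \<xi> * m n (\<xi> - \<eta>))"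
        using F(1) sc by (subst infsum_Un_disjoint) auto
      finally have "cmod (\<Sum>\<xi>\<in>F. d \<xi> * m n (\<xi> - \<eta>)) = cmod (\<Sum>\<^sub>\<infinity>\<xi>\<in>\<Xi> - F. d \<xi> * m n (\<xi> - \<eta>))"
        by (metis add_eq_0_iff norm_minus_cancel)
      also have "\<dots> \<le> (\<Sum>\<^sub>\<infinity>\<xi>\<in>\<Xi> - F. cmod (d \<xi> * m n (\<xi> - \<eta>)))"
        by (rule norm_infsum_bound[OF sn])
      also have "\<dots> \<le> (\<Sum>\<^sub>\<infinity>\<xi>\<in>\<Xi> - F. cmod (d \<xi>))"
        by (rule infsum_mono[OF sn sF]) (rule le)
      finally show ?thesis using tail by simp
    qed
    have "(\<lambda>n. \<Sum>\<xi>\<in>F. d \<xi> * m n (\<xi> - \<eta>)) \<longlonglongrightarrow> (\<Sum>\<xi>\<in>F. d \<xi> * (if \<xi> - \<eta> = 0 then 1 else 0))"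
      unfolding m_def by (intro tendsto_intros echar_mean)
    also have "(\<Sum>\<xi>\<in>F. d \<xi> * (if \<xi> - \<eta> = 0 then 1 else 0)) = (\<Sum>\<xi>\<in>F. if \<xi> = \<eta> then d \<xi> else 0)"
      by (intro sum.cong) auto
    also have "\<dots> = d \<eta>" using F by simp
    finally have "(\<lambda>n. cmod (\<Sum>\<xi>\<in>F. d \<xi> * m n (\<xi> - \<eta>))) \<longlonglongrightarrow> cmod (d \<eta>)"
      by (rule tendsto_norm)
    then show ?thesis
      by (rule tendsto_upperbound) (simp_all add: bound always_eventually)
  qed
  then have "cmod (d \<eta>) \<le> 0" by (metis dense_ge)
  then show ?thesis by simp
qed

lemma ap_coeff_eqI:
  assumes supp: "\<And>\<xi>. \<xi> \<notin> \<Xi> \<Longrightarrow> c \<xi> = 0"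
    and s: "(\<lambda>\<xi>. cmod (c \<xi>)) summable_on \<Xi>"
    and a: "\<And>k. ((\<lambda>\<xi>. c \<xi> * echar \<xi> k) has_sum a k) \<Xi>"
  shows "ap_coeff \<Xi> a = c"
  unfolding ap_coeff_def
proof (rule the_equality)
  show "(\<forall>\<xi>. \<xi> \<notin> \<Xi> \<longrightarrow> c \<xi> = 0) \<and> (\<lambda>\<xi>. cmod (c \<xi>)) summable_on \<Xi> \<and>
      (\<forall>k. ((\<lambda>\<xi>. c \<xi> * echar \<xi> k) has_sum a k) \<Xi>)"
    using assms by blast
next
  fix c'
  assume c': "(\<forall>\<xi>. \<xi> \<notin> \<Xi> \<longrightarrow> c' \<xi> = 0) \<and> (\<lambda>\<xi>. cmod (c' \<xi>)) summable_on \<Xi> \<and>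
      (\<forall>k. ((\<lambda>\<xi>. c' \<xi> * echar \<xi> k) has_sum a k) \<Xi>)"
  show "c' = c"
  proof
    fix \<eta>
    show "c' \<eta> = c \<eta>"
    proof (cases "\<eta> \<in> \<Xi>")
      case True
      have "(\<lambda>\<xi>. cmod (of_real (cmod (c' \<xi>) + cmod (c \<xi>)))) summable_on \<Xi>"
        using summable_on_add[of "\<lambda>\<xi>. cmod (c' \<xi>)" \<Xi> "\<lambda>\<xi>. cmod (c \<xi>)"] c' s
        unfolding norm_of_real by simp
      then have "(\<lambda>\<xi>. cmod (c' \<xi> - c \<xi>)) summable_on \<Xi>"
        by (rule Infinite_Sum.abs_summable_on_comparison_test) (unfold norm_of_real, simp add: norm_triangle_ineq4)
      moreover have "((\<lambda>\<xi>. (c' \<xi> - c \<xi>) * echar \<xi> k) has_sum 0) \<Xi>" for k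
        using has_sum_add[OF c'[THEN conjunct2, THEN conjunct2, rule_format, of k] has_sum_uminusI[OF a[of k]]]
        by (simp add: algebra_simps)
      ultimately show ?thesis using ap_series_eq_0[of "\<lambda>\<xi>. c' \<xi> - c \<xi>" \<Xi> \<eta>] True by simp
    qed (use c' supp in simp)
  qed
qed

definition APW_norm :: "real_mod_int set \<Rightarrow> (real_mod_int \<Rightarrow> real) \<Rightarrow> (int \<Rightarrow> complex) \<Rightarrow> real" where
  "APW_norm \<Xi> \<beta> a = (\<Sum>\<^sub>\<infinity>\<xi>\<in>\<Xi>. \<beta> \<xi> * cmod (ap_coeff \<Xi> a \<xi>))"

definition ap_mean :: "(int \<Rightarrow> complex) \<Rightarrow> complex" where
  "ap_mean a = lim (\<lambda>n::nat. (\<Sum>k<n. a (int k)) / of_nat n)"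


section \<open>The Hilbert space of square-summable families\<close>

typedef 'i ell2 = "{x :: 'i \<Rightarrow> complex. (\<lambda>i. (cmod (x i))\<^sup>2) summable_on UNIV}"
  morphisms coord ell2
  by (rule exI[of _ "\<lambda>_. 0"]) simp

setup_lifting type_definition_ell2

lemma ell2_memI:
  assumes "\<And>F. finite F \<Longrightarrow> L2_set (\<lambda>i. cmod (x i)) F \<le> B"
  shows "(\<lambda>i. (cmod (x i))\<^sup>2) summable_on UNIV"
    and "sqrt (\<Sum>\<^sub>\<infinity>i. (cmod (x i))\<^sup>2) \<le> B"
proof -
  have B: "B \<ge> 0" using assms[of "{}"] by simp
  have le: "(\<Sum>i\<in>F. (cmod (x i))\<^sup>2) \<le> B\<^sup>2" if "finite F" for F
    using assms[OF that] by (simp add: L2_set_def sqrt_le_D)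
  show s: "(\<lambda>i. (cmod (x i))\<^sup>2) summable_on UNIV"
    by (rule nonneg_bdd_above_summable_on) (auto intro!: bdd_aboveI[of _ "B\<^sup>2"] le)
  have "(\<Sum>\<^sub>\<infinity>i. (cmod (x i))\<^sup>2) \<le> B\<^sup>2"
    by (rule infsum_le_finite_sums[OF s]) (rule le)
  then show "sqrt (\<Sum>\<^sub>\<infinity>i. (cmod (x i))\<^sup>2) \<le> B"
    using B real_le_lsqrt by (simp add: infsum_nonneg)
qed

lemma ell2_memD:
  assumes "(\<lambda>i. (cmod (x i))\<^sup>2) summable_on UNIV"
  shows "L2_set (\<lambda>i. cmod (x i)) F \<le> sqrt (\<Sum>\<^sub>\<infinity>i. (cmod (x i))\<^sup>2)"
proof (cases "finite F")
  case True
  then show ?thesis unfolding L2_set_def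
    by (intro real_sqrt_le_mono finite_sum_le_infsum assms) auto
qed (simp add: infsum_nonneg)

lemma L2_set_cmod_add:
  "L2_set (\<lambda>i. cmod (x i + y i)) F \<le> L2_set (\<lambda>i. cmod (x i)) F + L2_set (\<lambda>i. cmod (y i)) F"
  by (rule order_trans[OF L2_set_mono L2_set_triangle_ineq]) (auto intro: norm_triangle_ineq)

lemma L2_set_cmod_mult:
  "L2_set (\<lambda>i. cmod (c * x i)) F = cmod c * L2_set (\<lambda>i. cmod (x i)) F"
  by (simp add: norm_mult L2_set_right_distrib)

lemma ell2_mem_add:
  assumes "(\<lambda>i. (cmod (x i))\<^sup>2) summable_on UNIV" "(\<lambda>i. (cmod (y i))\<^sup>2) summable_on UNIV"
  shows "(\<lambda>i. (cmod (x i + y i))\<^sup>2) summable_on UNIV"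
    and "sqrt (\<Sum>\<^sub>\<infinity>i. (cmod (x i + y i))\<^sup>2)
           \<le> sqrt (\<Sum>\<^sub>\<infinity>i. (cmod (x i))\<^sup>2) + sqrt (\<Sum>\<^sub>\<infinity>i. (cmod (y i))\<^sup>2)"
proof -
  have *: "L2_set (\<lambda>i. cmod (x i + y i)) F
      \<le> sqrt (\<Sum>\<^sub>\<infinity>i. (cmod (x i))\<^sup>2) + sqrt (\<Sum>\<^sub>\<infinity>i. (cmod (y i))\<^sup>2)" for F
    by (rule order_trans[OF L2_set_cmod_add add_mono[OF ell2_memD ell2_memD]]) (use assms in auto)
  show "(\<lambda>i. (cmod (x i + y i))\<^sup>2) summable_on UNIV" by (rule ell2_memI(1)[OF *])
  show "sqrt (\<Sum>\<^sub>\<infinity>i. (cmod (x i + y i))\<^sup>2)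
           \<le> sqrt (\<Sum>\<^sub>\<infinity>i. (cmod (x i))\<^sup>2) + sqrt (\<Sum>\<^sub>\<infinity>i. (cmod (y i))\<^sup>2)"
    by (rule ell2_memI(2)[OF *])
qed

lemma ell2_mem_mult:
  assumes "(\<lambda>i. (cmod (x i))\<^sup>2) summable_on UNIV"
  shows "(\<lambda>i. (cmod (c * x i))\<^sup>2) summable_on UNIV"
  using assms by (simp add: norm_mult power_mult_distrib summable_on_cmult_right)

instantiation ell2 :: (type) real_normed_vector
begin

lift_definition zero_ell2 :: "'a ell2" is "\<lambda>_. 0" by simp

lift_definition plus_ell2 :: "'a ell2 \<Rightarrow> 'a ell2 \<Rightarrow> 'a ell2" is "\<lambda>x y i. x i + y i"
  by (rule ell2_mem_add(1))

lift_definition uminus_ell2 :: "'a ell2 \<Rightarrow> 'a ell2" is "\<lambda>x i. - x i" by simp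

lift_definition minus_ell2 :: "'a ell2 \<Rightarrow> 'a ell2 \<Rightarrow> 'a ell2" is "\<lambda>x y i. x i - y i"
  using ell2_mem_add(1)[where y = "\<lambda>i. - y i" for y] by simp

lift_definition scaleR_ell2 :: "real \<Rightarrow> 'a ell2 \<Rightarrow> 'a ell2" is "\<lambda>r x i. of_real r * x i"
  by (rule ell2_mem_mult)

lift_definition norm_ell2 :: "'a ell2 \<Rightarrow> real" is "\<lambda>x. sqrt (\<Sum>\<^sub>\<infinity>i. (cmod (x i))\<^sup>2)" .

definition dist_ell2 :: "'a ell2 \<Rightarrow> 'a ell2 \<Rightarrow> real" where
  "dist_ell2 x y = norm (x - y)"

definition uniformity_ell2 :: "('a ell2 \<times> 'a ell2) filter" where
  "uniformity_ell2 = (INF e\<in>{0 <..}. principal {(x, y). dist x y < e})"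

definition open_ell2 :: "'a ell2 set \<Rightarrow> bool" where
  "open_ell2 S = (\<forall>x\<in>S. \<forall>\<^sub>F (x', y) in uniformity. x' = x \<longrightarrow> y \<in> S)"

definition sgn_ell2 :: "'a ell2 \<Rightarrow> 'a ell2" where
  "sgn_ell2 x = inverse (norm x) *\<^sub>R x"

instance
proof
  fix x y z :: "'a ell2" and r s :: real
  show "x + y + z = x + (y + z)" "x + y = y + x" "0 + x = x" "- x + x = 0" "x - y = x + - y"
    by (transfer, auto)+
  show "r *\<^sub>R (x + y) = r *\<^sub>R x + r *\<^sub>R y" "(r + s) *\<^sub>R x = r *\<^sub>R x + s *\<^sub>R x"
    "r *\<^sub>R s *\<^sub>R x = (r * s) *\<^sub>R x" "1 *\<^sub>R x = x"
    by (transfer, auto simp: algebra_simps)+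
  show "dist x y = norm (x - y)" by (rule dist_ell2_def)
  show "sgn x = inverse (norm x) *\<^sub>R x" by (rule sgn_ell2_def)
  show "(uniformity :: ('a ell2 \<times> 'a ell2) filter) = (INF e\<in>{0 <..}. principal {(x, y). dist x y < e})"
    by (rule uniformity_ell2_def)
  show "open U = (\<forall>x\<in>U. \<forall>\<^sub>F (x', y) in uniformity. x' = x \<longrightarrow> y \<in> U)" for U :: "'a ell2 set"
    by (rule open_ell2_def)
  show "norm (x + y) \<le> norm x + norm y"
    by transfer (rule ell2_mem_add(2))
  show "norm (r *\<^sub>R x) = \<bar>r\<bar> * norm x"
    by transfer (simp add: norm_mult power_mult_distrib infsum_cmult_right' real_sqrt_mult)
  show "norm x = 0 \<longleftrightarrow> x = 0"
  proof transfer
    fix x :: "'a \<Rightarrow> complex"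
    assume s: "(\<lambda>i. (cmod (x i))\<^sup>2) summable_on UNIV"
    show "sqrt (\<Sum>\<^sub>\<infinity>i. (cmod (x i))\<^sup>2) = 0 \<longleftrightarrow> x = (\<lambda>_. 0)"
    proof
      assume 0: "sqrt (\<Sum>\<^sub>\<infinity>i. (cmod (x i))\<^sup>2) = 0"
      show "x = (\<lambda>_. 0)"
      proof
        fix i show "x i = 0" using ell2_memD[OF s, of "{i}"] 0 by simp
      qed
    qed simp
  qed
qed

end

lemma L2_set_coord_le: "L2_set (\<lambda>i. cmod (coord x i)) F \<le> norm x"
  by transfer (rule ell2_memD)

lemma cmod_coord_le: "cmod (coord x i) \<le> norm x"
  using L2_set_coord_le[of x "{i}"] by simp

lemma norm_ell2_leI:
  assumes "\<And>F. finite F \<Longrightarrow> L2_set (\<lambda>i. cmod (coord x i)) F \<le> B"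
  shows "norm x \<le> B"
  using assms by transfer (rule ell2_memI(2))

instance ell2 :: (type) banach
proof
  fix X :: "nat \<Rightarrow> 'a ell2"
  assume X: "Cauchy X"
  have "Cauchy (\<lambda>n. coord (X n) i)" for i
  proof (rule CauchyI)
    fix e :: real assume "e > 0"
    with X obtain N where N: "\<And>m n. m \<ge> N \<Longrightarrow> n \<ge> N \<Longrightarrow> norm (X m - X n) < e"
      by (meson CauchyD)
    have "cmod (coord (X m) i - coord (X n) i) < e" if "m \<ge> N" "n \<ge> N" for m n
      using cmod_coord_le[of "X m - X n" i] N[OF that] by (simp add: minus_ell2.rep_eq)
    then show "\<exists>M. \<forall>m\<ge>M. \<forall>n\<ge>M. cmod (coord (X m) i - coord (X n) i) < e" by blast
  qed
  then have "\<exists>l. (\<lambda>n. coord (X n) i) \<longlonglongrightarrow> l" for i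
    by (simp add: Cauchy_convergent_iff convergent_def)
  then obtain L where L: "\<And>i. (\<lambda>n. coord (X n) i) \<longlonglongrightarrow> L i"
    by metis
  have close: "\<exists>N. \<forall>m\<ge>N. \<forall>F. finite F \<longrightarrow> L2_set (\<lambda>i. cmod (coord (X m) i - L i)) F \<le> e"
    if "e > 0" for e
  proof -
    from X that obtain N where N: "\<And>m n. m \<ge> N \<Longrightarrow> n \<ge> N \<Longrightarrow> norm (X m - X n) < e"
      by (meson CauchyD)
    have "L2_set (\<lambda>i. cmod (coord (X m) i - L i)) F \<le> e" if m: "m \<ge> N" and F: "finite F" for m F
    proof (rule tendsto_upperbound)
      show "(\<lambda>n. L2_set (\<lambda>i. cmod (coord (X m) i - coord (X n) i)) F)
              \<longlonglongrightarrow> L2_set (\<lambda>i. cmod (coord (X m) i - L i)) F"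
        unfolding L2_set_def by (intro tendsto_intros L)
      show "\<forall>\<^sub>F n in sequentially. L2_set (\<lambda>i. cmod (coord (X m) i - coord (X n) i)) F \<le> e"
        using eventually_ge_at_top[of N]
      proof eventually_elim
        case (elim n)
        then show ?case
          using L2_set_coord_le[of "X m - X n" F] N[OF m elim] by (simp add: minus_ell2.rep_eq)
      qed
    qed simp
    then show ?thesis by blast
  qed
  obtain N where N: "\<And>F. finite F \<Longrightarrow> L2_set (\<lambda>i. cmod (coord (X N) i - L i)) F \<le> 1"
    using close[of 1] by auto
  have "L2_set (\<lambda>i. cmod (L i)) F \<le> norm (X N) + 1" if "finite F" for F
    using L2_set_cmod_add[of "coord (X N)" "\<lambda>i. L i - coord (X N) i" F]
      L2_set_coord_le[of "X N" F] N[OF that]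
    by (simp add: norm_minus_commute)
  then have "(\<lambda>i. (cmod (L i))\<^sup>2) summable_on UNIV" by (rule ell2_memI(1))
  then have c: "coord (ell2 L) = L" by (simp add: ell2_inverse)
  have "X \<longlonglongrightarrow> ell2 L"
  proof (rule LIMSEQ_I)
    fix e :: real assume "e > 0"
    then obtain N where N: "\<And>m F. m \<ge> N \<Longrightarrow> finite F \<Longrightarrow> L2_set (\<lambda>i. cmod (coord (X m) i - L i)) F \<le> e / 2"
      using close[of "e / 2"] by auto
    have "norm (X m - ell2 L) \<le> e / 2" if "m \<ge> N" for m
      by (rule norm_ell2_leI) (use N[OF that] in \<open>simp add: minus_ell2.rep_eq c\<close>)
    then show "\<exists>no. \<forall>n\<ge>no. norm (X n - ell2 L) < e" using \<open>e > 0\<close> by force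
  qed
  then show "convergent X" by (rule convergentI)
qed

text \<open>There is no type class for complex vector spaces in the library, hence an explicit scalar
  multiplication.\<close>

lift_definition cscale :: "complex \<Rightarrow> 'i ell2 \<Rightarrow> 'i ell2" is "\<lambda>c x i. c * x i"
  by (rule ell2_mem_mult)

lift_definition basis_vec :: "'i \<Rightarrow> 'i ell2" is "\<lambda>j i. if i = j then 1 else 0"
proof (rule ell2_memI(1))
  fix j :: 'i and F :: "'i set" assume F: "finite F"
  have "(\<Sum>i\<in>F. (cmod (if i = j then 1 else 0))\<^sup>2) = (\<Sum>i\<in>F. if i = j then 1 else 0)"
    by (rule sum.cong) auto
  also have "\<dots> \<le> 1" using F by simp
  finally show "L2_set (\<lambda>i. cmod (if i = j then 1 else 0)) F \<le> 1"
    by (simp add: L2_set_def)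
qed

text \<open>Linear in the second argument.\<close>

definition cinner :: "'i ell2 \<Rightarrow> 'i ell2 \<Rightarrow> complex" where
  "cinner y x = (\<Sum>\<^sub>\<infinity>i. cnj (coord y i) * coord x i)"

lemma cscale_of_real: "cscale (of_real r) x = r *\<^sub>R x"
  by transfer simp

lemma norm_cscale: "norm (cscale c x) = cmod c * norm x"
  by transfer (simp add: norm_mult power_mult_distrib infsum_cmult_right' real_sqrt_mult)

lemma cscale_add_right: "cscale c (x + y) = cscale c x + cscale c y"
  by transfer (simp add: algebra_simps)

lemma cscale_cscale: "cscale c (cscale d x) = cscale (c * d) x"
  by transfer (simp add: algebra_simps)

lemma bounded_linear_cscale: "bounded_linear (cscale c)"
proof (rule bounded_linear_intro)
  show "cscale c (x + y) = cscale c x + cscale c y" for x y :: "'i ell2" by (rule cscale_add_right)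
  show "cscale c (r *\<^sub>R x) = r *\<^sub>R cscale c x" for r and x :: "'i ell2"
    by (simp flip: cscale_of_real add: cscale_cscale mult.commute)
  show "norm (cscale c x) \<le> norm x * cmod c" for x :: "'i ell2" by (simp add: norm_cscale)
qed


section \<open>The Banach algebra of bounded complex-linear operators on it\<close>

typedef 'i ell2_op = "{A :: 'i ell2 \<Rightarrow> 'i ell2. bounded_linear A \<and> (\<forall>c x. A (cscale c x) = cscale c (A x))}"
  morphisms op_apply ell2_op
  by (rule exI[of _ "\<lambda>x. x"]) simp

setup_lifting type_definition_ell2_op

lemma bounded_linear_op_apply: "bounded_linear (op_apply A)"
  using op_apply[of A] by simp

lemma op_apply_cscale: "op_apply A (cscale c x) = cscale c (op_apply A x)"
  using op_apply[of A] by simp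

text \<open>The norm is the operator norm and the multiplication is composition. With these instances,
  \<^const>\<open>exp\<close> is the exponential function of the Banach algebra \<^typ>\<open>'i ell2_op\<close>.\<close>

instantiation ell2_op :: (type) real_normed_algebra_1
begin

lift_definition zero_ell2_op :: "'a ell2_op" is "\<lambda>_. 0"
  by (simp add: cscale.rep_eq zero_ell2.rep_eq flip: coord_inject)

lift_definition one_ell2_op :: "'a ell2_op" is "\<lambda>x. x"
  by simp

lift_definition plus_ell2_op :: "'a ell2_op \<Rightarrow> 'a ell2_op \<Rightarrow> 'a ell2_op" is "\<lambda>A B x. A x + B x"
  by (simp add: bounded_linear_add cscale_add_right)

lift_definition uminus_ell2_op :: "'a ell2_op \<Rightarrow> 'a ell2_op" is "\<lambda>A x. - A x"
  by (simp add: bounded_linear_minus linear_neg[OF bounded_linear.linear[OF bounded_linear_cscale]])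

lift_definition minus_ell2_op :: "'a ell2_op \<Rightarrow> 'a ell2_op \<Rightarrow> 'a ell2_op" is "\<lambda>A B x. A x - B x"
  by (simp add: bounded_linear_sub linear_diff[OF bounded_linear.linear[OF bounded_linear_cscale]])

lift_definition times_ell2_op :: "'a ell2_op \<Rightarrow> 'a ell2_op \<Rightarrow> 'a ell2_op" is "\<lambda>A B x. A (B x)"
  by (simp add: bounded_linear_compose)

lift_definition scaleR_ell2_op :: "real \<Rightarrow> 'a ell2_op \<Rightarrow> 'a ell2_op" is "\<lambda>r A x. r *\<^sub>R A x"
  by (simp add: bounded_linear_const_scaleR
      linear_scale[OF bounded_linear.linear[OF bounded_linear_cscale]])

lift_definition norm_ell2_op :: "'a ell2_op \<Rightarrow> real" is onorm .

definition dist_ell2_op :: "'a ell2_op \<Rightarrow> 'a ell2_op \<Rightarrow> real" where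
  "dist_ell2_op A B = norm (A - B)"

definition uniformity_ell2_op :: "('a ell2_op \<times> 'a ell2_op) filter" where
  "uniformity_ell2_op = (INF e\<in>{0 <..}. principal {(x, y). dist x y < e})"

definition open_ell2_op :: "'a ell2_op set \<Rightarrow> bool" where
  "open_ell2_op S = (\<forall>x\<in>S. \<forall>\<^sub>F (x', y) in uniformity. x' = x \<longrightarrow> y \<in> S)"

definition sgn_ell2_op :: "'a ell2_op \<Rightarrow> 'a ell2_op" where
  "sgn_ell2_op x = inverse (norm x) *\<^sub>R x"

instance
proof
  fix A B C :: "'a ell2_op" and r s :: real
  show "A + B + C = A + (B + C)" "A + B = B + A" "0 + A = A" "- A + A = 0" "A - B = A + - B"
    by (transfer, auto)+
  show "r *\<^sub>R (A + B) = r *\<^sub>R A + r *\<^sub>R B" "(r + s) *\<^sub>R A = r *\<^sub>R A + s *\<^sub>R A"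
    "r *\<^sub>R s *\<^sub>R A = (r * s) *\<^sub>R A" "1 *\<^sub>R A = A"
    by (transfer, auto simp: algebra_simps)+
  show "A * B * C = A * (B * C)" "(A + B) * C = A * C + B * C" "1 * A = A" "A * 1 = A"
    "r *\<^sub>R A * B = r *\<^sub>R (A * B)"
    by (transfer, auto)+
  show "A * (B + C) = A * B + A * C"
    by transfer (auto simp: linear_add bounded_linear.linear)
  show "A * r *\<^sub>R B = r *\<^sub>R (A * B)"
    by transfer (auto simp: linear_scale bounded_linear.linear)
  show "dist A B = norm (A - B)" by (rule dist_ell2_op_def)
  show "sgn A = inverse (norm A) *\<^sub>R A" by (rule sgn_ell2_op_def)
  show "(uniformity :: ('a ell2_op \<times> 'a ell2_op) filter) = (INF e\<in>{0 <..}. principal {(x, y). dist x y < e})"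
    by (rule uniformity_ell2_op_def)
  show "open U = (\<forall>x\<in>U. \<forall>\<^sub>F (x', y) in uniformity. x' = x \<longrightarrow> y \<in> U)" for U :: "'a ell2_op set"
    by (rule open_ell2_op_def)
  show "norm (A + B) \<le> norm A + norm B" by transfer (simp add: onorm_triangle)
  show "norm (r *\<^sub>R A) = \<bar>r\<bar> * norm A" by transfer (simp add: onorm_scaleR)
  show "norm A = 0 \<longleftrightarrow> A = 0" by transfer (auto simp: onorm_eq_0)
  show "norm (A * B) \<le> norm A * norm B"
    by transfer (use onorm_compose in \<open>auto simp: o_def\<close>)
  show "(0 :: 'a ell2_op) \<noteq> 1"
  proof
    assume "(0 :: 'a ell2_op) = 1"
    then have "op_apply (0 :: 'a ell2_op) (basis_vec undefined) = op_apply 1 (basis_vec undefined)" by simp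
    then have "coord (basis_vec (undefined :: 'a)) undefined = 0"
      by (simp add: zero_ell2_op.rep_eq one_ell2_op.rep_eq) (metis zero_ell2.rep_eq)
    then show False by (simp add: basis_vec.rep_eq)
  qed
  have nz: "basis_vec (undefined :: 'a) \<noteq> 0"
    by (metis (mono_tags, lifting) basis_vec.rep_eq zero_ell2.rep_eq zero_neq_one)
  have bl: "bounded_linear (\<lambda>x :: 'a ell2. x)" by simp
  have "1 \<le> onorm (\<lambda>x :: 'a ell2. x)"
    using le_onorm[OF bl, of "basis_vec undefined"] nz by simp
  moreover have "onorm (\<lambda>x :: 'a ell2. x) \<le> 1" by (rule onorm_id_le)
  ultimately show "norm (1 :: 'a ell2_op) = 1"
    by (simp add: norm_ell2_op.rep_eq one_ell2_op.rep_eq)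
qed

end

lemma norm_op_apply: "norm (op_apply A x) \<le> norm A * norm x"
  by transfer (auto intro: onorm)

instance ell2_op :: (type) banach
proof
  fix X :: "nat \<Rightarrow> 'a ell2_op"
  assume X: "Cauchy X"
  define Y where "Y n = Blinfun (op_apply (X n))" for n
  have Y: "blinfun_apply (Y n) = op_apply (X n)" for n
    unfolding Y_def by (rule bounded_linear_Blinfun_apply[OF bounded_linear_op_apply])
  have nY: "norm (Y m - Y n) = norm (X m - X n)" for m n
    by (simp add: norm_blinfun.rep_eq minus_blinfun.rep_eq norm_ell2_op.rep_eq minus_ell2_op.rep_eq Y)
  have "Cauchy Y" using X by (simp add: Cauchy_iff nY)
  then obtain L where L: "Y \<longlonglongrightarrow> L" by (auto simp: Cauchy_convergent_iff convergent_def)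
  have lim: "(\<lambda>n. op_apply (X n) x) \<longlonglongrightarrow> blinfun_apply L x" for x
    using blinfun.tendsto[OF L tendsto_const[of x]] by (simp add: Y)
  have "blinfun_apply L (cscale c x) = cscale c (blinfun_apply L x)" for c x
  proof (rule LIMSEQ_unique[OF lim])
    show "(\<lambda>n. op_apply (X n) (cscale c x)) \<longlonglongrightarrow> cscale c (blinfun_apply L x)"
      unfolding op_apply_cscale by (rule bounded_linear.tendsto[OF bounded_linear_cscale lim])
  qed
  then have l: "op_apply (ell2_op (blinfun_apply L)) = blinfun_apply L"
    by (intro ell2_op_inverse) (simp add: blinfun.bounded_linear_right)
  have nL: "norm (Y n - L) = norm (X n - ell2_op (blinfun_apply L))" for n
    by (simp add: norm_blinfun.rep_eq minus_blinfun.rep_eq norm_ell2_op.rep_eq minus_ell2_op.rep_eq Y l)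
  have "X \<longlonglongrightarrow> ell2_op (blinfun_apply L)"
    using L by (simp add: LIMSEQ_iff nL)
  then show "convergent X" by (rule convergentI)
qed

lift_definition cscale_op :: "complex \<Rightarrow> 'i ell2_op \<Rightarrow> 'i ell2_op" is "\<lambda>c A x. cscale c (A x)"
  by (auto intro: bounded_linear_compose[OF bounded_linear_cscale] simp: cscale_cscale mult.commute)

text \<open>Used only for operators that have a two-sided inverse.\<close>

definition op_inv :: "'i ell2_op \<Rightarrow> 'i ell2_op" where
  "op_inv A = (THE B. A * B = 1 \<and> B * A = 1)"

definition entry :: "'i ell2_op \<Rightarrow> 'i \<Rightarrow> 'i \<Rightarrow> complex" where
  "entry A j k = coord (op_apply A (basis_vec k)) j"

lemma op_of_coordsI:
  assumes add: "\<And>x y i. g (x + y) i = g x i + g y i"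
    and scale: "\<And>c x i. g (cscale c x) i = c * g x i"
    and bound: "\<And>x F. finite F \<Longrightarrow> L2_set (\<lambda>i. cmod (g x i)) F \<le> norm x * B"
  shows "bounded_linear (\<lambda>x. ell2 (g x)) \<and> (\<forall>c x. ell2 (g (cscale c x)) = cscale c (ell2 (g x)))"
    and "coord (ell2 (g x)) = g x"
proof -
  have c: "coord (ell2 (g x)) = g x" for x
    by (rule ell2_inverse) (use ell2_memI(1)[OF bound] in simp)
  have s: "ell2 (g (cscale c x)) = cscale c (ell2 (g x))" for c x
    by (simp flip: coord_inject add: c cscale.rep_eq) (simp add: scale fun_eq_iff)
  have "bounded_linear (\<lambda>x. ell2 (g x))"
  proof (rule bounded_linear_intro)
    show "ell2 (g (x + y)) = ell2 (g x) + ell2 (g y)" for x y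
      by (simp flip: coord_inject add: c plus_ell2.rep_eq) (simp add: add fun_eq_iff)
    show "ell2 (g (r *\<^sub>R x)) = r *\<^sub>R ell2 (g x)" for r x
      by (simp flip: cscale_of_real add: s)
    show "norm (ell2 (g x)) \<le> norm x * B" for x
      by (rule norm_ell2_leI) (simp add: c bound)
  qed
  with s show "bounded_linear (\<lambda>x. ell2 (g x)) \<and> (\<forall>c x. ell2 (g (cscale c x)) = cscale c (ell2 (g x)))"
    by blast
  show "coord (ell2 (g x)) = g x" by (rule c)
qed

text \<open>The multiplication operator \<open>bI\<close> is only meaningful for bounded \<open>b\<close>.\<close>

lemma mult_op_bound:
  assumes B: "\<And>i. cmod (b i) \<le> B"
  shows "L2_set (\<lambda>i. cmod (b i * coord x i)) F \<le> norm x * B"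
proof -
  have "0 \<le> B" using order_trans[OF norm_ge_zero B] .
  have "L2_set (\<lambda>i. cmod (b i * coord x i)) F \<le> L2_set (\<lambda>i. B * cmod (coord x i)) F"
    by (rule L2_set_mono) (auto simp: norm_mult intro: mult_right_mono B)
  also have "\<dots> = B * L2_set (\<lambda>i. cmod (coord x i)) F"
    using \<open>0 \<le> B\<close> by (simp add: L2_set_right_distrib)
  also have "\<dots> \<le> norm x * B"
    using \<open>0 \<le> B\<close> L2_set_coord_le[of x F] by (simp add: mult.commute mult_left_mono)
  finally show ?thesis .
qed

lift_definition mult_op :: "('i \<Rightarrow> complex) \<Rightarrow> 'i ell2_op" is
  "\<lambda>b. if bounded (range b) then (\<lambda>x. ell2 (\<lambda>i. b i * coord x i)) else (\<lambda>_. 0)"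
proof -
  fix b :: "'i \<Rightarrow> complex"
  let ?f = "if bounded (range b) then (\<lambda>x. ell2 (\<lambda>i. b i * coord x i)) else (\<lambda>_. 0)"
  show "bounded_linear ?f \<and> (\<forall>c x. ?f (cscale c x) = cscale c (?f x))"
  proof (cases "bounded (range b)")
    case True
    then obtain B where B: "\<And>i. cmod (b i) \<le> B" by (auto simp: bounded_iff)
    have "bounded_linear (\<lambda>x. ell2 (\<lambda>i. b i * coord x i)) \<and>
        (\<forall>c x. ell2 (\<lambda>i. b i * coord (cscale c x) i) = cscale c (ell2 (\<lambda>i. b i * coord x i)))"
      by (rule op_of_coordsI(1)[of "\<lambda>x i. b i * coord x i", OF _ _ mult_op_bound[OF B]])
        (simp_all add: plus_ell2.rep_eq cscale.rep_eq algebra_simps)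
    with True show ?thesis by simp
  next
    case False
    have "cscale c 0 = (0 :: 'i ell2)" for c
      by (simp add: linear_0[OF bounded_linear.linear[OF bounded_linear_cscale]])
    with False show ?thesis by simp
  qed
qed

lemma shift_bound: "L2_set (\<lambda>k :: int. cmod (coord x (k - n))) F \<le> norm x * 1"
proof -
  have "L2_set (\<lambda>k. cmod (coord x (k - n))) F = L2_set (\<lambda>k. cmod (coord x k)) ((\<lambda>k. k - n) ` F)"
    unfolding L2_set_def by (subst sum.reindex) (auto simp: inj_on_def)
  then show ?thesis using L2_set_coord_le[of x "(\<lambda>k. k - n) ` F"] by simp
qed

lift_definition shift_op :: "int \<Rightarrow> int ell2_op" is "\<lambda>n x. ell2 (\<lambda>k. coord x (k - n))"
  by (rule op_of_coordsI(1)[OF _ _ shift_bound]) (simp_all add: plus_ell2.rep_eq cscale.rep_eq)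

definition proj_op :: "'i set \<Rightarrow> 'i ell2_op" where
  "proj_op S = mult_op (indicator S)"


section \<open>Compression to the nonnegative integers\<close>

text \<open>Here \<open>l\<^sup>2(\<int>\<^sup>+)\<close> is \<^typ>\<open>nat ell2\<close>; the compression \<open>PAP\<close> extends by zero, applies \<open>A\<close>, and restricts.\<close>

lemma extend_bound:
  "L2_set (\<lambda>k :: int. cmod (if k \<ge> 0 then coord x (nat k) else 0)) F \<le> norm x"
proof (cases "finite F")
  case True
  have "(\<Sum>k\<in>F. (cmod (if k \<ge> 0 then coord x (nat k) else 0))\<^sup>2)
      = (\<Sum>k\<in>F \<inter> {0..}. (cmod (coord x (nat k)))\<^sup>2)"
    using True by (intro sum.mono_neutral_cong_right) auto
  also have "\<dots> = (\<Sum>k\<in>nat ` (F \<inter> {0..}). (cmod (coord x k))\<^sup>2)"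
    by (subst sum.reindex) (auto simp: inj_on_def)
  finally show ?thesis
    using L2_set_coord_le[of x "nat ` (F \<inter> {0..})"] by (simp add: L2_set_def)
qed simp

lift_definition extend_zero :: "nat ell2 \<Rightarrow> int ell2" is
  "\<lambda>x k. if k \<ge> 0 then x (nat k) else 0"
proof -
  fix x :: "nat \<Rightarrow> complex"
  assume "(\<lambda>i. (cmod (x i))\<^sup>2) summable_on UNIV"
  then have "coord (ell2 x) = x" by (simp add: ell2_inverse)
  then show "(\<lambda>k. (cmod (if k \<ge> 0 then x (nat k) else 0))\<^sup>2) summable_on UNIV"
    using ell2_memI(1)[OF extend_bound[of "ell2 x"]] by (simp only:)
qed

lemma restrict_bound: "L2_set (\<lambda>k :: nat. cmod (coord x (int k))) F \<le> norm x"
proof -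
  have "L2_set (\<lambda>k. cmod (coord x (int k))) F = L2_set (\<lambda>k. cmod (coord x k)) (int ` F)"
    unfolding L2_set_def by (subst sum.reindex) (auto simp: inj_on_def)
  then show ?thesis using L2_set_coord_le[of x "int ` F"] by simp
qed

lift_definition restrict_nonneg :: "int ell2 \<Rightarrow> nat ell2" is "\<lambda>x k. x (int k)"
proof -
  fix x :: "int \<Rightarrow> complex"
  assume "(\<lambda>i. (cmod (x i))\<^sup>2) summable_on UNIV"
  then have "coord (ell2 x) = x" by (simp add: ell2_inverse)
  then show "(\<lambda>k. (cmod (x (int k)))\<^sup>2) summable_on UNIV"
    using ell2_memI(1)[OF restrict_bound[of "ell2 x"]] by (simp only:)
qed

lemma bounded_linear_extend_zero: "bounded_linear extend_zero"
proof (rule bounded_linear_intro)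
  show "extend_zero (x + y) = extend_zero x + extend_zero y" for x y by transfer auto
  show "extend_zero (r *\<^sub>R x) = r *\<^sub>R extend_zero x" for r x by transfer auto
  show "norm (extend_zero x) \<le> norm x * 1" for x
    using norm_ell2_leI[of "extend_zero x" "norm x"] extend_bound[of x]
    by (simp add: extend_zero.rep_eq)
qed

lemma bounded_linear_restrict_nonneg: "bounded_linear restrict_nonneg"
proof (rule bounded_linear_intro)
  show "restrict_nonneg (x + y) = restrict_nonneg x + restrict_nonneg y" for x y by transfer auto
  show "restrict_nonneg (r *\<^sub>R x) = r *\<^sub>R restrict_nonneg x" for r x by transfer auto
  show "norm (restrict_nonneg x) \<le> norm x * 1" for x
    using norm_ell2_leI[of "restrict_nonneg x" "norm x"] restrict_bound[of x]
    by (simp add: restrict_nonneg.rep_eq)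
qed

lemma extend_zero_cscale: "extend_zero (cscale c x) = cscale c (extend_zero x)"
  by transfer auto

lemma restrict_nonneg_cscale: "restrict_nonneg (cscale c x) = cscale c (restrict_nonneg x)"
  by transfer auto

lift_definition compression :: "int ell2_op \<Rightarrow> nat ell2_op" is
  "\<lambda>A x. restrict_nonneg (A (extend_zero x))"
  by (simp add: extend_zero_cscale restrict_nonneg_cscale
      bounded_linear_compose[OF bounded_linear_restrict_nonneg]
      bounded_linear_compose[OF _ bounded_linear_extend_zero])


section \<open>Trace class operators and Fredholm determinants\<close>

text \<open>Trace class operators on a Hilbert space are exactly the nuclear ones, that is, the norm
  absolutely convergent sums of rank one operators \<open>v \<mapsto> \<langle>y\<^sub>n, v\<rangle> x\<^sub>n\<close>.\<close>

definition trace_class :: "'i ell2_op \<Rightarrow> bool" where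
  "trace_class K \<longleftrightarrow>
    (\<exists>x y :: nat \<Rightarrow> 'i ell2. summable (\<lambda>n. norm (x n) * norm (y n)) \<and>
       (\<forall>v. (\<lambda>n. cscale (cinner (y n) v) (x n)) sums op_apply K v))"

definition principal_minor :: "'i::linorder ell2_op \<Rightarrow> 'i set \<Rightarrow> complex" where
  "principal_minor K S =
    (let xs = sorted_list_of_set S
     in det (mat (length xs) (length xs) (\<lambda>(p, q). entry K (xs ! p) (xs ! q))))"

text \<open>Fredholm's expansion \<open>det (1 + K) = (\<Sum>n. tr (\<Lambda>\<^sup>n K))\<close>: the diagonal entries of \<open>\<Lambda>\<^sup>n K\<close> in the
  orthonormal basis \<open>e\<^bsub>i\<^sub>1\<^esub> \<and> \<dots> \<and> e\<^bsub>i\<^sub>n\<^esub>\<close>, \<open>i\<^sub>1 < \<dots> < i\<^sub>n\<close>, are the principal minors of order \<open>n\<close>.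
  The sum converges absolutely for trace class \<open>K\<close>; other operators have no determinant.\<close>

definition fredholm_det :: "'i::linorder ell2_op \<Rightarrow> complex" where
  "fredholm_det B =
    (if trace_class (B - 1) then (\<Sum>\<^sub>\<infinity>S\<in>{S. finite S}. principal_minor (B - 1) S) else undefined)"


section \<open>The algebra of operators with almost periodic diagonals\<close>

definition diagonal :: "int \<Rightarrow> int ell2_op \<Rightarrow> int \<Rightarrow> complex" where
  "diagonal k A j = entry A j (j - k)"

definition power_weight :: "real \<Rightarrow> real \<Rightarrow> int \<Rightarrow> real" where
  "power_weight \<alpha>\<^sub>1 \<alpha>\<^sub>2 k =
    (if k \<ge> 0 then (1 + of_int k) powr \<alpha>\<^sub>1 else (1 + of_int \<bar>k\<bar>) powr \<alpha>\<^sub>2)"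

definition wiener_alg ::
    "real \<Rightarrow> real \<Rightarrow> real_mod_int set \<Rightarrow> (real_mod_int \<Rightarrow> real) \<Rightarrow> int ell2_op set" where
  "wiener_alg \<alpha>\<^sub>1 \<alpha>\<^sub>2 \<Xi> \<beta> =
    {A. (\<forall>k. diagonal k A \<in> APW \<Xi> \<beta>) \<and>
        (\<lambda>k. power_weight \<alpha>\<^sub>1 \<alpha>\<^sub>2 k * APW_norm \<Xi> \<beta> (diagonal k A)) summable_on UNIV}"

definition tau :: "int \<Rightarrow> real_mod_int \<Rightarrow> complex" where
  "tau n \<xi> = echar \<xi> n"

definition twist ::
    "real_mod_int set \<Rightarrow> (real_mod_int \<Rightarrow> complex) \<Rightarrow> int ell2_op \<Rightarrow> int ell2_op" where
  "twist \<Xi> \<tau> A =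
    (\<Sum>\<^sub>\<infinity>n\<in>UNIV. \<Sum>\<^sub>\<infinity>\<xi>\<in>\<Xi>.
       cscale_op (ap_coeff \<Xi> (diagonal n A) \<xi> * \<tau> \<xi>) (mult_op (echar \<xi>) * shift_op n))"

text \<open>In the next two definitions \<open>As = [A\<^sub>1, \<dots>, A\<^sub>r]\<close> and \<open>A = e\<^bsup>A\<^sub>1\<^esup> \<cdots> e\<^bsup>A\<^sub>r\<^esup>\<close>; note that
  \<open>echar \<xi> 1\<close> is \<open>e\<^bsup>2\<pi>i\<xi>\<^esup>\<close>.\<close>

definition Theta1 ::
    "real_mod_int set \<Rightarrow> int ell2_op list \<Rightarrow> (real_mod_int \<Rightarrow> complex) \<Rightarrow> complex" where
  "Theta1 \<Xi> As \<tau> =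
    (let A = prod_list (map exp As); a = diagonal 0 (sum_list As)
     in exp (\<Sum>\<^sub>\<infinity>\<xi>\<in>\<Xi> - {0}. ap_coeff \<Xi> a \<xi> * (\<tau> \<xi> / (1 - echar \<xi> 1))) *
        fredholm_det
          (compression (twist \<Xi> \<tau> A) *
           prod_list (map (\<lambda>B. exp (- compression (twist \<Xi> \<tau> B))) (rev As))))"

definition Theta2 ::
    "real_mod_int set \<Rightarrow> int ell2_op list \<Rightarrow> (real_mod_int \<Rightarrow> complex) \<Rightarrow> complex" where
  "Theta2 \<Xi> As \<tau> =
    (let A = prod_list (map exp As); a = diagonal 0 (sum_list As)
     in exp (\<Sum>\<^sub>\<infinity>\<xi>\<in>\<Xi> - {0}. ap_coeff \<Xi> a \<xi> * (- \<tau> \<xi> / (1 - echar \<xi> 1))) *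
        fredholm_det
          (prod_list (map (\<lambda>B. exp (compression (twist \<Xi> \<tau> B))) As) *
           compression (twist \<Xi> \<tau> (op_inv A))))"

definition finite_section :: "int \<Rightarrow> int \<Rightarrow> int ell2_op \<Rightarrow> complex mat" where
  "finite_section n\<^sub>1 n\<^sub>2 A =
    (let P = proj_op {n\<^sub>1..<n\<^sub>2}
     in mat (nat (n\<^sub>2 - n\<^sub>1)) (nat (n\<^sub>2 - n\<^sub>1))
          (\<lambda>(i, j). entry (P * A * P) (n\<^sub>1 + int i) (n\<^sub>1 + int j)))"

end

theory Submission
  imports Defs
begin

text \<open>All operators involved are dominated entrywise by one Toeplitz kernel \<open>c\<close> with a finite weighted sum.
  Since the two exponents sum to 1, a product of two opposite Hankel-type corners of such operators has absolutely
  summable matrix entries, with bounds uniform in the position of the corner. Hence Fredholm determinants can be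
  compared through their expansion into principal minors, and no Schatten classes are needed.

  For a set \<open>S\<close> of integers let \<open>E\<^sub>S\<close> be the product of the exponentials of the compressions of \<open>A\<^sub>1, \<dots>, A\<^sub>r\<close>
  to \<open>S\<close>. With \<open>J = {n\<^sub>1..<n\<^sub>2}\<close> and \<open>H = {n\<^sub>1..}\<close>, the section of \<open>A P\<^sub>J E\<^sub>J\<^sup>-\<^sup>1\<close> is, up to an error that vanishes
  as \<open>n\<^sub>2 - n\<^sub>1\<close> grows, the product of the sections of \<open>A P\<^sub>H E\<^sub>H\<^sup>-\<^sup>1\<close> and \<open>E\<^sub>H P\<^sub>J E\<^sub>J\<^sup>-\<^sup>1\<close>. The determinant of the first
  tends to the determinant in \<open>\<Theta>\<^sub>1\<close>; Jacobi's identity for complementary minors turns that of the second into a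
  determinant on \<open>{n\<^sub>2..}\<close>, which tends to the one in \<open>\<Theta>\<^sub>2\<close>. Finally \<open>det E\<^sub>J\<close> is the exponential of the sum of
  \<open>a\<close> over \<open>J\<close>, and that sum telescopes up to the mean value.\<close>

section \<open>Determinants of absolutely summable perturbations of the identity\<close>

text \<open>An almost periodic operator is not translation invariant, yet the limit is uniform in
  the position of the window. Twisting by \<open>tau n\<close> is translation by \<open>n\<close>
  (\<open>entry_twist_tau\<close>), so the moving characters pose the same half-line problem at
  every cut, and all estimates are made on a Toeplitz majorant, which does not see the translation.
  The exponentials enter because E_S commutes with the projection P_S, whence E_S P_S E_S^-1 = P_S
  exactly. Replacing one of the two sets by a larger T changes this by a difference of exponentials,
  bounded by a sum over paths that visit T - S; between compressions to S these are the corners, and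
  only corners have to be summed. Kernels take values in [0, infinity], so sums are interchanged
  without side conditions; finiteness rests on the weighted sum of \<open>c\<close> and on the
  corner at 0. Finite and infinite determinants are both written as one series of principal minors,
  so that the single bound \<open>exp l * (exp d - 1)\<close> also compares a matrix with an
  operator on a half-line.\<close>

definition leibniz_det :: "'i set \<Rightarrow> ('i \<Rightarrow> 'i \<Rightarrow> complex) \<Rightarrow> complex" where
  "leibniz_det S K = (\<Sum>p | p permutes S. of_int (sign p) * (\<Prod>i\<in>S. K i (p i)))"

text \<open>Polymorphic in the values because it serves both as the complex identity matrix and as
  the real majorant of it in \<open>cmod_leibniz_det_perturb_le\<close>.\<close>

definition delta :: "'i \<Rightarrow> 'i \<Rightarrow> 'a::zero_neq_one" where
  "delta i j = (if i = j then 1 else 0)"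

lemma leibniz_det_cong:
  assumes "\<And>i j. i \<in> S \<Longrightarrow> j \<in> S \<Longrightarrow> K i j = L i j"
  shows "leibniz_det S K = leibniz_det S L"
  unfolding leibniz_det_def
  by (intro sum.cong refl arg_cong2[of _ _ _ _ "(*)"] prod.cong) (use assms permutes_in_image in fastforce)+

text \<open>Conjugation by \<open>f\<close> carries the permutations of \<open>S\<close> to those of
  \<open>T\<close> and preserves signs. This frees determinants from the sorted enumeration that
  \<open>principal_minor\<close> uses.\<close>

lemma leibniz_det_reindex:
  assumes f: "bij_betw f S T" and S: "finite S"
  shows "leibniz_det T K = leibniz_det S (\<lambda>i j. K (f i) (f j))"
proof -
  have inj: "inj_on f S" and T: "T = f ` S" using f by (auto simp: bij_betw_def)
  have g: "bij_betw (inv_into S f) T S" by (rule bij_betw_inv_into[OF f])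
  show ?thesis
    unfolding leibniz_det_def
  proof (rule sum.reindex_bij_witness[of _ "map_permutation S f" "map_permutation T (inv_into S f)"])
    fix p assume p: "p \<in> {p. p permutes S}"
    then show "map_permutation T (inv_into S f) (map_permutation S f p) = p"
      by (intro map_permutation_compose_inv[OF f]) (auto simp: inv_into_f_f[OF inj])
    show "map_permutation S f p \<in> {p. p permutes T}"
      using map_permutation_permutes[OF f] p by auto
  next
    fix q assume q: "q \<in> {q. q permutes T}"
    then show e: "map_permutation S f (map_permutation T (inv_into S f) q) = q"
      by (intro map_permutation_compose_inv[OF g]) (auto simp: T f_inv_into_f)
    show p: "map_permutation T (inv_into S f) q \<in> {p. p permutes S}"
      using map_permutation_permutes[OF g] q by auto
    define p where "p = map_permutation T (inv_into S f) q"
    have pS: "p permutes S" using p by (simp add: p_def)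
    have qp: "q = map_permutation S f p" using e by (simp add: p_def)
    have "sign q = sign p"
      unfolding qp using sign_map_permutation[OF inj pS S] .
    moreover have "(\<Prod>i\<in>T. K i (q i)) = (\<Prod>i\<in>S. K (f i) (f (p i)))"
      unfolding T by (subst prod.reindex[OF inj]) (auto intro!: prod.cong simp: qp map_permutation_apply[OF inj])
    ultimately show "of_int (sign (map_permutation T (inv_into S f) q)) *
         (\<Prod>i\<in>S. K (f i) (f (map_permutation T (inv_into S f) q i))) =
         of_int (sign q) * (\<Prod>i\<in>T. K i (q i))"
      by (simp add: p_def)
  qed
qed

lemma det_mat_eq_leibniz_det: "det (mat n n (\<lambda>(i, j). K i j)) = leibniz_det {..<n} K"
proof -
  have "det (mat n n (\<lambda>(i, j). K i j)) = leibniz_det {0..<n} K"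
    unfolding leibniz_det_def
  proof (subst det_def'[of _ n], simp, intro sum.cong refl arg_cong2[of _ _ _ _ "(*)"] prod.cong)
    fix p i assume "p \<in> {p. p permutes {0..<n}}" "i \<in> {0..<n}"
    then show "mat n n (\<lambda>(i, j). K i j) $$ (i, p i) = K i (p i)"
      using permutes_in_image[of p "{0..<n}" i] by simp
  qed
  then show ?thesis by (simp add: atLeast0LessThan)
qed

lemma principal_minor_eq_leibniz_det:
  fixes S :: "'i::linorder set"
  assumes "finite S"
  shows "principal_minor K S = leibniz_det S (entry K)"
proof -
  let ?xs = "sorted_list_of_set S"
  have "bij_betw ((!) ?xs) {..<length ?xs} S"
    using assms by (intro bij_betw_nth) auto
  then show ?thesis
    unfolding principal_minor_def Let_def
    by (simp add: det_mat_eq_leibniz_det leibniz_det_reindex[of _ "{..<length ?xs}"])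
qed

lemma inj_on_restrict_permutes: "inj_on (\<lambda>p. restrict p S) {p. p permutes S}"
proof (rule inj_onI)
  fix p q assume pq: "p \<in> {p. p permutes S}" "q \<in> {p. p permutes S}" "restrict p S = restrict q S"
  show "p = q"
  proof
    fix x show "p x = q x"
      using pq(1,2) restrict_apply'[of x S p] restrict_apply'[of x S q]
      by (cases "x \<in> S") (auto simp: pq(3) permutes_not_in)
  qed
qed

text \<open>Permutations are determined by their restrictions, which are among all maps of
  \<open>S\<close> to itself. A sum of products over all maps factors into a product of row sums,
  which is the purpose of the enlargement.\<close>

lemma sum_permutes_le_sum_PiE:
  fixes F :: "('i \<Rightarrow> 'i) \<Rightarrow> real"
  assumes S: "finite S" and F: "\<And>h. 0 \<le> F h" "\<And>p. F (restrict p S) = F p"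
  shows "(\<Sum>p | p permutes S. F p) \<le> (\<Sum>h\<in>S \<rightarrow>\<^sub>E S. F h)"
proof -
  have "(\<Sum>p | p permutes S. F p) = (\<Sum>h\<in>(\<lambda>p. restrict p S) ` {p. p permutes S}. F h)"
    by (simp add: sum.reindex[OF inj_on_restrict_permutes] F(2))
  also have "\<dots> \<le> (\<Sum>h\<in>S \<rightarrow>\<^sub>E S. F h)"
    using S F(1) permutes_in_image by (intro sum_mono2) (fastforce intro!: finite_PiE)+
  finally show ?thesis .
qed

lemma abs_of_int_sign: "\<bar>of_int (sign p) :: real\<bar> = 1"
  by (cases p rule: sign_cases) auto

lemma cmod_leibniz_det_le:
  assumes "finite S"
  shows "cmod (leibniz_det S K) \<le> (\<Prod>i\<in>S. \<Sum>j\<in>S. cmod (K i j))"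
proof -
  have "cmod (leibniz_det S K) \<le> (\<Sum>p | p permutes S. \<Prod>i\<in>S. cmod (K i (p i)))"
    unfolding leibniz_det_def
    by (rule order_trans[OF norm_sum]) (simp add: norm_mult abs_of_int_sign prod_norm)
  also have "\<dots> \<le> (\<Prod>i\<in>S. \<Sum>j\<in>S. cmod (K i j))"
    unfolding prod_sum_PiE[OF assms assms]
    by (rule sum_permutes_le_sum_PiE[OF assms]) (auto intro: prod_nonneg prod.cong)
  finally show ?thesis .
qed

text \<open>Induction splitting \<open>x a * X - y a * Y\<close> as
  \<open>x a * (X - Y) + (x a - y a) * Y\<close>. The bound is the growth of a product of majorants,
  a form that remains manageable when summed over maps.\<close>

lemma norm_prod_diff_le_prod_add:
  fixes x y :: "'i \<Rightarrow> complex"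
  assumes "\<And>i. i \<in> S \<Longrightarrow> cmod (y i) \<le> m i" "\<And>i. i \<in> S \<Longrightarrow> cmod (x i - y i) \<le> d i"
  shows "cmod ((\<Prod>i\<in>S. x i) - (\<Prod>i\<in>S. y i)) \<le> (\<Prod>i\<in>S. m i + d i) - (\<Prod>i\<in>S. m i)"
proof (cases "finite S")
  case True
  then show ?thesis using assms
  proof (induction S rule: finite_induct)
    case (insert a S)
    let ?X = "\<Prod>i\<in>S. x i" and ?Y = "\<Prod>i\<in>S. y i"
    have IH: "cmod (?X - ?Y) \<le> (\<Prod>i\<in>S. m i + d i) - (\<Prod>i\<in>S. m i)"
      using insert by auto
    have xa: "cmod (x a) \<le> m a + d a"
      using insert.prems(1)[of a] insert.prems(2)[of a] norm_triangle_ineq[of "y a" "x a - y a"] by simp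
    have Y: "cmod ?Y \<le> (\<Prod>i\<in>S. m i)"
      unfolding prod_norm[symmetric] using insert.prems(1) by (intro prod_mono) auto
    have pos: "0 \<le> d a" "0 \<le> m a + d a"
      using insert.prems(2)[of a] xa by (auto intro: order_trans[OF norm_ge_zero])
    have "x a * ?X - y a * ?Y = x a * (?X - ?Y) + (x a - y a) * ?Y"
      by (simp add: algebra_simps)
    then have "cmod (x a * ?X - y a * ?Y) \<le> cmod (x a) * cmod (?X - ?Y) + cmod (x a - y a) * cmod ?Y"
      by (metis norm_mult norm_triangle_ineq)
    also have "\<dots> \<le> (m a + d a) * ((\<Prod>i\<in>S. m i + d i) - (\<Prod>i\<in>S. m i)) + d a * (\<Prod>i\<in>S. m i)"
      using IH xa Y pos insert.prems(2)[of a] by (intro add_mono mult_mono) auto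
    also have "\<dots> = (\<Prod>i\<in>insert a S. m i + d i) - (\<Prod>i\<in>insert a S. m i)"
      using insert by (simp add: algebra_simps)
    finally show ?case using insert by simp
  qed simp
qed simp

lemma cmod_leibniz_det_diff_le:
  assumes S: "finite S" and L: "\<And>i j. cmod (L i j) \<le> m i j"
  shows "cmod (leibniz_det S K - leibniz_det S L)
    \<le> (\<Prod>i\<in>S. \<Sum>j\<in>S. m i j + cmod (K i j - L i j)) - (\<Prod>i\<in>S. \<Sum>j\<in>S. m i j)"
proof -
  let ?d = "\<lambda>i j. cmod (K i j - L i j)"
  have m: "0 \<le> m i j" for i j using order_trans[OF norm_ge_zero L] .
  have "cmod (leibniz_det S K - leibniz_det S L)
      \<le> (\<Sum>p | p permutes S. cmod ((\<Prod>i\<in>S. K i (p i)) - (\<Prod>i\<in>S. L i (p i))))"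
    unfolding leibniz_det_def sum_subtractf[symmetric] right_diff_distrib[symmetric]
    by (rule order_trans[OF norm_sum]) (simp add: norm_mult abs_of_int_sign)
  also have "\<dots> \<le> (\<Sum>p | p permutes S. (\<Prod>i\<in>S. m i (p i) + ?d i (p i)) - (\<Prod>i\<in>S. m i (p i)))"
    by (intro sum_mono norm_prod_diff_le_prod_add L) auto
  \<comment> \<open>Each summand is nonnegative because the majorant only grows, so passing from
    permutations to all maps enlarges the sum.\<close>
  also have "\<dots> \<le> (\<Sum>h\<in>S \<rightarrow>\<^sub>E S. (\<Prod>i\<in>S. m i (h i) + ?d i (h i)) - (\<Prod>i\<in>S. m i (h i)))"
    using m by (intro sum_permutes_le_sum_PiE S) (auto intro!: prod_mono arg_cong2[of _ _ _ _ "(-)"] prod.cong)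
  finally show ?thesis using S by (simp add: sum_subtractf prod_sum_PiE)
qed

lemma prod_one_add_le_exp:
  fixes x :: "'i \<Rightarrow> real"
  assumes "\<And>i. i \<in> S \<Longrightarrow> 0 \<le> x i"
  shows "(\<Prod>i\<in>S. 1 + x i) \<le> exp (\<Sum>i\<in>S. x i)"
proof (cases "finite S")
  case True
  then show ?thesis
    unfolding exp_sum[OF True] using assms by (intro prod_mono) (auto simp: add_nonneg_nonneg)
qed simp

text \<open>After expanding every factor, \<open>U\<close> collects the rows where \<open>K\<close>
  was chosen; the deltas on the other rows vanish unless the permutation fixes \<open>S - U\<close>
  pointwise, that is, permutes \<open>U\<close>.\<close>

lemma leibniz_det_delta_add:
  assumes S: "finite S"
  shows "leibniz_det S (\<lambda>i j. delta i j + K i j) = (\<Sum>U\<in>Pow S. leibniz_det U K)"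
proof -
  let ?F = "\<lambda>U p. of_int (sign p) * ((\<Prod>i\<in>U. K i (p i)) * (\<Prod>i\<in>S - U. delta i (p i)))"
  have "leibniz_det S (\<lambda>i j. delta i j + K i j)
      = (\<Sum>p | p permutes S. \<Sum>U\<in>Pow S. ?F U p)"
    unfolding leibniz_det_def using prod_add[OF S, of "\<lambda>i. K i (_ i)" "\<lambda>i. delta i (_ i)"]
    by (simp add: add.commute sum_distrib_left)
  also have "\<dots> = (\<Sum>U\<in>Pow S. \<Sum>p | p permutes S. ?F U p)"
    by (rule sum.swap)
  also have "\<dots> = (\<Sum>U\<in>Pow S. leibniz_det U K)"
  proof (rule sum.cong[OF refl])
    fix U assume U: "U \<in> Pow S"
    have perm: "p permutes U" if "p permutes S" "\<forall>i\<in>S - U. p i = i" for p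
      using that U unfolding permutes_def by blast
    have "(\<Sum>p | p permutes S. ?F U p)
        = (\<Sum>p | p permutes U. ?F U p)"
    proof (rule sum.mono_neutral_right)
      show "finite {p. p permutes S}" by (rule finite_permutations[OF S])
      show "{p. p permutes U} \<subseteq> {p. p permutes S}" using U permutes_subset by blast
      show "\<forall>p\<in>{p. p permutes S} - {p. p permutes U}.
          ?F U p = 0"
      proof
        fix p assume "p \<in> {p. p permutes S} - {p. p permutes U}"
        then obtain i where "i \<in> S - U" "p i \<noteq> i" using perm by blast
        then have "(\<Prod>i\<in>S - U. delta i (p i)) = (0 :: complex)"
          using S by (intro prod_zero) (auto simp: delta_def intro!: bexI[of _ i])
        then show "?F U p = 0" by simp
      qed
    qed
    also have "\<dots> = leibniz_det U K"
      unfolding leibniz_det_def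
      by (intro sum.cong refl) (auto simp: delta_def permutes_not_in intro!: prod.neutral)
    finally show "(\<Sum>p | p permutes S. ?F U p)
        = leibniz_det U K" .
  qed
  finally show ?thesis .
qed

section \<open>Fredholm series of infinite matrices with summable entries\<close>

definition entry_sum_le :: "(nat \<Rightarrow> nat \<Rightarrow> complex) \<Rightarrow> real \<Rightarrow> bool" where
  "entry_sum_le K k \<longleftrightarrow> (\<forall>N. (\<Sum>i<N. \<Sum>j<N. cmod (K i j)) \<le> k)"

definition fredholm_series :: "(nat \<Rightarrow> nat \<Rightarrow> complex) \<Rightarrow> complex" where
  "fredholm_series K = (\<Sum>\<^sub>\<infinity>S\<in>{S. finite S}. leibniz_det S K)"

text \<open>Bounding each minor by its row sums turns the sum over subsets of \<open>{..<N}\<close>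
  into a product of factors 1 + row sum, which is at most \<open>exp k\<close> independently of
  \<open>N\<close>.\<close>

lemma summable_on_leibniz_det:
  assumes K: "entry_sum_le K k"
  shows "(\<lambda>S. leibniz_det S K) summable_on {S. finite S}"
proof (rule abs_summable_summable, rule nonneg_bdd_above_summable_on)
  show "bdd_above (sum (\<lambda>S. cmod (leibniz_det S K)) ` {F. F \<subseteq> {S. finite S} \<and> finite F})"
  proof (rule bdd_aboveI[of _ "exp k"], clarify)
    fix F :: "nat set set" assume F: "F \<subseteq> {S. finite S}" "finite F"
    then have "finite (\<Union>F)" by auto
    then obtain N where N: "\<Union>F \<subseteq> {..<N}" using finite_nat_iff_bounded by blast
    have "(\<Sum>S\<in>F. cmod (leibniz_det S K)) \<le> (\<Sum>S\<in>Pow {..<N}. cmod (leibniz_det S K))"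
      using N by (intro sum_mono2) auto
    also have "\<dots> \<le> (\<Sum>S\<in>Pow {..<N}. \<Prod>i\<in>S. \<Sum>j<N. cmod (K i j))"
    proof (rule sum_mono)
      fix S assume S: "S \<in> Pow {..<N}"
      then have "finite S" using finite_subset by blast
      then show "cmod (leibniz_det S K) \<le> (\<Prod>i\<in>S. \<Sum>j<N. cmod (K i j))"
        using S by (intro order_trans[OF cmod_leibniz_det_le] prod_mono conjI sum_mono2 sum_nonneg) auto
    qed
    also have "\<dots> = (\<Prod>i<N. 1 + (\<Sum>j<N. cmod (K i j)))"
      using prod_add[of "{..<N}" "\<lambda>i. \<Sum>j<N. cmod (K i j)" "\<lambda>_. 1"] by (simp add: add.commute)
    also have "\<dots> \<le> exp (\<Sum>i<N. \<Sum>j<N. cmod (K i j))"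
      by (intro prod_one_add_le_exp sum_nonneg) auto
    also have "\<dots> \<le> exp k" using K by (simp add: entry_sum_le_def)
    finally show "(\<Sum>S\<in>F. cmod (leibniz_det S K)) \<le> exp k" .
  qed
qed auto

text \<open>The power sets of \<open>{..<N}\<close> exhaust the finite sets, so the partial sums
  along them are the determinants of truncations. Every estimate for finite determinants is
  transferred to the series in this way.\<close>

lemma tendsto_fredholm_series:
  assumes K: "entry_sum_le K k"
  shows "(\<lambda>N. leibniz_det {..<N} (\<lambda>i j. delta i j + K i j)) \<longlonglongrightarrow> fredholm_series K"
proof -
  have "((\<lambda>S. leibniz_det S K) has_sum fredholm_series K) {S. finite S}"
    unfolding fredholm_series_def by (rule has_sum_infsum[OF summable_on_leibniz_det[OF K]])
  then have lim: "(sum (\<lambda>S. leibniz_det S K) \<longlongrightarrow> fredholm_series K) (finite_subsets_at_top {S. finite S})"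
    by (simp add: has_sum_def)
  have "filterlim (\<lambda>N. Pow {..<N}) (finite_subsets_at_top {S :: nat set. finite S}) sequentially"
    unfolding filterlim_finite_subsets_at_top
  proof (intro allI impI, elim conjE)
    fix X :: "nat set set" assume X: "finite X" "X \<subseteq> {S. finite S}"
    then have "finite (\<Union>X)" by auto
    then obtain N where N: "\<Union>X \<subseteq> {..<N}" using finite_nat_iff_bounded by blast
    show "\<forall>\<^sub>F n in sequentially. finite (Pow {..<n}) \<and> X \<subseteq> Pow {..<n} \<and> Pow {..<n} \<subseteq> {S :: nat set. finite S}"
      using eventually_ge_at_top[of N]
    proof eventually_elim
      case (elim n)
      then show ?case using N by (force simp: finite_subset)
    qed
  qed
  from filterlim_compose[OF lim this] show ?thesis
    by (simp add: leibniz_det_delta_add)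
qed

text \<open>The bound depends on \<open>S\<close> only through the two sums and vanishes with
  \<open>d\<close>, so it survives all limits taken later.\<close>

lemma cmod_leibniz_det_perturb_le:
  assumes S: "finite S"
    and L: "(\<Sum>i\<in>S. \<Sum>j\<in>S. cmod (L i j)) \<le> l" and d: "(\<Sum>i\<in>S. \<Sum>j\<in>S. cmod (K i j - L i j)) \<le> d"
  shows "cmod (leibniz_det S (\<lambda>i j. delta i j + K i j) - leibniz_det S (\<lambda>i j. delta i j + L i j))
    \<le> exp l * (exp d - 1)"
proof -
  define R where "R i = 1 + (\<Sum>j\<in>S. cmod (L i j))" for i
  define D where "D i = (\<Sum>j\<in>S. cmod (K i j - L i j))" for i
  have R1: "R i \<ge> 1" for i by (simp add: R_def sum_nonneg)
  have D0: "D i \<ge> 0" for i by (simp add: D_def sum_nonneg)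
  have delta: "(\<Sum>j\<in>S. delta i j + g j) = 1 + (\<Sum>j\<in>S. g j)" if "i \<in> S" for i and g :: "_ \<Rightarrow> real"
    using S that by (simp add: sum.distrib delta_def)
  have delta': "(\<Sum>j\<in>S. delta i j) = (1 :: real)" if "i \<in> S" for i
    using delta[OF that, of "\<lambda>_. 0"] by simp
  have "cmod (leibniz_det S (\<lambda>i j. delta i j + K i j) - leibniz_det S (\<lambda>i j. delta i j + L i j))
      \<le> (\<Prod>i\<in>S. \<Sum>j\<in>S. delta i j + cmod (L i j) + cmod ((delta i j + K i j) - (delta i j + L i j)))
        - (\<Prod>i\<in>S. \<Sum>j\<in>S. delta i j + cmod (L i j))"
  proof (rule cmod_leibniz_det_diff_le[OF S])
    fix i j show "cmod (delta i j + L i j) \<le> delta i j + cmod (L i j)"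
      using norm_triangle_ineq[of "delta i j" "L i j"] by (simp add: delta_def split: if_splits)
  qed
  also have "\<dots> = (\<Prod>i\<in>S. R i + D i) - (\<Prod>i\<in>S. R i)"
    by (simp add: delta' R_def D_def sum.distrib add.assoc cong: prod.cong)
  also have "\<dots> \<le> (\<Prod>i\<in>S. R i * (1 + D i)) - (\<Prod>i\<in>S. R i)"
  proof -
    \<comment> \<open>The identity matrix makes every \<open>R i\<close> at least 1; this separates
      the perturbation into a factor of its own.\<close>
    have "R i + D i \<le> R i * (1 + D i)" for i
      using mult_right_mono[OF R1[of i] D0[of i]] by (simp add: algebra_simps)
    moreover have "0 \<le> R i + D i" for i using R1[of i] D0[of i] by simp
    ultimately show ?thesis by (simp add: prod_mono)
  qed
  also have "\<dots> = (\<Prod>i\<in>S. R i) * ((\<Prod>i\<in>S. 1 + D i) - 1)"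
    by (simp only: prod.distrib right_diff_distrib mult_1_right)
  also have "\<dots> \<le> exp l * (exp d - 1)"
  proof (rule mult_mono)
    have "(\<Prod>i\<in>S. R i) \<le> exp (\<Sum>i\<in>S. \<Sum>j\<in>S. cmod (L i j))"
      unfolding R_def by (rule prod_one_add_le_exp) (auto intro: sum_nonneg)
    also have "\<dots> \<le> exp l" using L by simp
    finally show "(\<Prod>i\<in>S. R i) \<le> exp l" .
    have "(\<Prod>i\<in>S. 1 + D i) \<le> exp (\<Sum>i\<in>S. D i)"
      by (rule prod_one_add_le_exp) (rule D0)
    also have "\<dots> \<le> exp d" using d by (simp add: D_def)
    finally show "(\<Prod>i\<in>S. 1 + D i) - 1 \<le> exp d - 1" by simp
    show "0 \<le> (\<Prod>i\<in>S. 1 + D i) - 1" using D0 by (simp add: prod_ge_1)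
  qed auto
  finally show ?thesis .
qed

lemma cmod_fredholm_series_diff_le:
  assumes K: "entry_sum_le K k" and L: "entry_sum_le L l" and d: "entry_sum_le (\<lambda>i j. K i j - L i j) d"
  shows "cmod (fredholm_series K - fredholm_series L) \<le> exp l * (exp d - 1)"
proof (rule tendsto_upperbound)
  show "(\<lambda>N. cmod (leibniz_det {..<N} (\<lambda>i j. delta i j + K i j) - leibniz_det {..<N} (\<lambda>i j. delta i j + L i j)))
    \<longlonglongrightarrow> cmod (fredholm_series K - fredholm_series L)"
    by (intro tendsto_intros tendsto_fredholm_series[OF K] tendsto_fredholm_series[OF L])
  show "\<forall>\<^sub>F N in sequentially. cmod (leibniz_det {..<N} (\<lambda>i j. delta i j + K i j) -
      leibniz_det {..<N} (\<lambda>i j. delta i j + L i j)) \<le> exp l * (exp d - 1)"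
    using L d by (intro always_eventually allI cmod_leibniz_det_perturb_le) (auto simp: entry_sum_le_def)
qed simp

text \<open>In the expansion into principal minors, every minor that meets a vanishing row is
  zero.\<close>

lemma leibniz_det_restrict:
  assumes T: "finite T" "S \<subseteq> T" and K: "\<And>i j. i \<in> T - S \<Longrightarrow> K i j = 0"
  shows "leibniz_det T (\<lambda>i j. delta i j + K i j) = leibniz_det S (\<lambda>i j. delta i j + K i j)"
proof -
  have S: "finite S" using T finite_subset by blast
  have "leibniz_det U K = 0" if "U \<in> Pow T - Pow S" for U
  proof -
    from that obtain i where i: "i \<in> U" "i \<in> T - S" by auto
    have "finite U" using that T finite_subset by auto
    then have "(\<Prod>i\<in>U. K i (p i)) = 0" for p using i K by (meson prod_zero)
    then show ?thesis by (simp add: leibniz_det_def)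
  qed
  then show ?thesis
    unfolding leibniz_det_delta_add[OF T(1)] leibniz_det_delta_add[OF S]
    using T by (intro sum.mono_neutral_right) auto
qed

lemma entry_sum_le_finite_support:
  assumes "\<And>i j. \<not> (i < N \<and> j < N) \<Longrightarrow> K i j = 0"
  shows "entry_sum_le K (\<Sum>i<N. \<Sum>j<N. cmod (K i j))"
  unfolding entry_sum_le_def
proof
  fix M
  have "(\<Sum>i<M. \<Sum>j<M. cmod (K i j)) \<le> (\<Sum>i<max M N. \<Sum>j<max M N. cmod (K i j))"
    by (intro order_trans[OF sum_mono sum_mono2] sum_mono2) (auto intro: sum_nonneg)
  also have "\<dots> = (\<Sum>i<N. \<Sum>j<max M N. cmod (K i j))"
    using assms by (intro sum.mono_neutral_right) (auto intro!: sum.neutral)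
  also have "\<dots> = (\<Sum>i<N. \<Sum>j<N. cmod (K i j))"
    using assms by (intro sum.cong refl sum.mono_neutral_right) auto
  finally show "(\<Sum>i<M. \<Sum>j<M. cmod (K i j)) \<le> (\<Sum>i<N. \<Sum>j<N. cmod (K i j))" .
qed

text \<open>Places determinants of finite sections and Fredholm determinants under the same
  perturbation estimates.\<close>

lemma fredholm_series_finite_support:
  assumes K: "\<And>i j. \<not> (i < N \<and> j < N) \<Longrightarrow> K i j = 0"
  shows "fredholm_series K = leibniz_det {..<N} (\<lambda>i j. delta i j + K i j)"
proof (rule LIMSEQ_unique[OF tendsto_fredholm_series[OF entry_sum_le_finite_support[OF K]]])
  have "\<forall>\<^sub>F M in sequentially. leibniz_det {..<N} (\<lambda>i j. delta i j + K i j)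
      = leibniz_det {..<M} (\<lambda>i j. delta i j + K i j)"
    using eventually_ge_at_top[of N]
    by eventually_elim (rule leibniz_det_restrict[symmetric], use K in auto)
  then show "(\<lambda>M. leibniz_det {..<M} (\<lambda>i j. delta i j + K i j))
      \<longlonglongrightarrow> leibniz_det {..<N} (\<lambda>i j. delta i j + K i j)"
    by (rule Lim_transform_eventually[OF tendsto_const])
qed simp_all

lemma cmod_fredholm_series_le:
  assumes K: "entry_sum_le K k"
  shows "cmod (fredholm_series K) \<le> exp k"
proof (rule tendsto_upperbound)
  show "(\<lambda>N. cmod (leibniz_det {..<N} (\<lambda>i j. delta i j + K i j))) \<longlonglongrightarrow> cmod (fredholm_series K)"
    by (intro tendsto_intros tendsto_fredholm_series[OF K])
  have "cmod (leibniz_det {..<N} (\<lambda>i j. delta i j + K i j)) \<le> exp k" for N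
  proof -
    have "leibniz_det {..<N} (\<lambda>i j. delta i j + 0) = 1"
      by (subst leibniz_det_restrict[of _ "{}"]) (auto simp: leibniz_det_def)
    \<comment> \<open>Comparison with the zero perturbation, whose determinant is 1:
      \<open>1 + exp 0 * (exp k - 1)\<close> equals \<open>exp k\<close>.\<close>
    then have "cmod (leibniz_det {..<N} (\<lambda>i j. delta i j + K i j)) \<le> 1 + exp 0 * (exp k - 1)"
      using cmod_leibniz_det_perturb_le[of "{..<N}" "\<lambda>_ _. 0" 0 K k] K
        norm_triangle_ineq2[of "leibniz_det {..<N} (\<lambda>i j. delta i j + K i j)" 1]
      by (auto simp: entry_sum_le_def)
    then show ?thesis by simp
  qed
  then show "\<forall>\<^sub>F N in sequentially. cmod (leibniz_det {..<N} (\<lambda>i j. delta i j + K i j)) \<le> exp k" by simp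
qed simp

section \<open>Sums of nonnegative families and nonnegative kernels\<close>

text \<open>Taken in the extended nonnegative reals, so that summations can be exchanged
  unconditionally.\<close>

definition esum :: "('a \<Rightarrow> ennreal) \<Rightarrow> ennreal" where
  "esum f = (\<integral>\<^sup>+ x. f x \<partial>count_space UNIV)"

lemma esum_mono: "(\<And>x. f x \<le> g x) \<Longrightarrow> esum f \<le> esum g"
  unfolding esum_def by (rule nn_integral_mono) auto

lemma esum_cong: "(\<And>x. f x = g x) \<Longrightarrow> esum f = esum g"
  by (rule arg_cong[of _ _ esum]) (rule ext)

lemma esum_cmult: "esum (\<lambda>x. c * f x) = c * esum f"
  unfolding esum_def by (rule nn_integral_cmult) auto

lemma esum_multc: "esum (\<lambda>x. f x * c) = esum f * c"
  unfolding esum_def by (rule nn_integral_multc) auto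

lemma esum_add: "esum (\<lambda>x. f x + g x) = esum f + esum g"
  unfolding esum_def by (rule nn_integral_add) auto

lemma esum_0 [simp]: "esum (\<lambda>_. 0) = 0"
  unfolding esum_def by simp

lemma esum_suminf: "esum (\<lambda>x. \<Sum>n. f n x) = (\<Sum>n. esum (f n))"
  unfolding esum_def by (rule nn_integral_suminf) auto

lemma esum_swap: "esum (\<lambda>x. esum (\<lambda>y. f x y)) = esum (\<lambda>y. esum (\<lambda>x. f x y))"
  unfolding esum_def using nn_integral_fst_count_space[of "\<lambda>(x, y). f x y"]
    nn_integral_snd_count_space[of "\<lambda>(x, y). f x y"] by simp

lemma esum_prod: "esum (\<lambda>x. esum (\<lambda>y. f x y)) = esum (\<lambda>z. f (fst z) (snd z))"
  unfolding esum_def using nn_integral_fst_count_space[of "\<lambda>(x, y). f x y"]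
  by (simp add: case_prod_unfold)

lemma esum_reindex: "bij g \<Longrightarrow> esum (\<lambda>x. f (g x)) = esum f"
  unfolding esum_def by (rule nn_integral_bij_count_space)

lemma esum_finite_support:
  assumes "finite A" "\<And>x. x \<notin> A \<Longrightarrow> f x = 0"
  shows "esum f = (\<Sum>x\<in>A. f x)"
  unfolding esum_def by (rule nn_integral_count_space') (use assms in auto)

lemma sum_le_esum:
  assumes "finite A" shows "(\<Sum>x\<in>A. f x) \<le> esum f"
proof -
  have "(\<Sum>x\<in>A. f x) = esum (\<lambda>x. if x \<in> A then f x else 0)"
    using assms by (subst esum_finite_support[of A]) auto
  also have "\<dots> \<le> esum f" by (rule esum_mono) simp
  finally show ?thesis .
qed

lemma le_esum: "f x \<le> esum f"
  using sum_le_esum[of "{x}" f] by simp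

lemma esum_inj_le:
  assumes "inj g" shows "esum (\<lambda>x. f (g x)) \<le> esum f"
proof -
  have "esum (\<lambda>x. f (g x)) = (\<integral>\<^sup>+ y. f y \<partial>count_space (range g))"
    unfolding esum_def by (rule nn_integral_bij_count_space) (use assms in \<open>simp add: inj_on_imp_bij_betw\<close>)
  also have "\<dots> \<le> esum f"
    unfolding esum_def by (subst nn_integral_count_space_indicator)
      (auto intro!: nn_integral_mono simp: indicator_def)
  finally show ?thesis .
qed

lemma esum_tendsto_0:
  fixes g :: "nat \<Rightarrow> 'a::countable \<Rightarrow> ennreal"
  assumes f: "esum f < \<infinity>" and le: "\<And>n x. g n x \<le> f x" and lim: "\<And>x. (\<lambda>n. g n x) \<longlonglongrightarrow> 0"
  shows "(\<lambda>n. esum (g n)) \<longlonglongrightarrow> 0"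
proof -
  have "(\<lambda>n. \<integral>\<^sup>+ x. g n x \<partial>count_space UNIV) \<longlonglongrightarrow> (\<integral>\<^sup>+ x. 0 \<partial>count_space (UNIV :: 'a set))"
    by (rule nn_integral_dominated_convergence[where w = f]) (use assms in \<open>auto simp: esum_def\<close>)
  then show ?thesis by (simp add: esum_def)
qed

lemma tendsto_0_eventually_0:
  fixes u :: "nat \<Rightarrow> ennreal"
  assumes "\<And>N. N > K \<Longrightarrow> u N = 0" shows "u \<longlonglongrightarrow> 0"
  by (rule tendsto_eventually, rule eventually_mono[OF eventually_gt_at_top[of K]]) (rule assms)

text \<open>The bound holds for finite partial sums and passes to the limit. Since the right side
  may be infinite, it applies to every entry of a product of operators.\<close>

lemma has_sum_norm_le_esum:
  assumes "(f has_sum s) UNIV"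
  shows "ennreal (norm s) \<le> esum (\<lambda>x. ennreal (norm (f x)))"
proof -
  have "((\<lambda>F. ennreal (norm (sum f F))) \<longlongrightarrow> ennreal (norm s)) (finite_subsets_at_top UNIV)"
    using assms by (auto simp: has_sum_def intro!: tendsto_ennrealI tendsto_norm)
  moreover have "\<forall>\<^sub>F F in finite_subsets_at_top UNIV.
      ennreal (norm (sum f F)) \<le> esum (\<lambda>x. ennreal (norm (f x)))"
  proof (rule eventually_finite_subsets_at_top_weakI)
    fix F :: "'a set" assume "finite F"
    have "ennreal (norm (sum f F)) \<le> ennreal (\<Sum>x\<in>F. norm (f x))"
      by (rule ennreal_leI) (rule norm_sum)
    also have "\<dots> = (\<Sum>x\<in>F. ennreal (norm (f x)))" by simp
    also have "\<dots> \<le> esum (\<lambda>x. ennreal (norm (f x)))" by (rule sum_le_esum[OF \<open>finite F\<close>])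
    finally show "ennreal (norm (sum f F)) \<le> esum (\<lambda>x. ennreal (norm (f x)))" .
  qed
  ultimately show ?thesis by (rule tendsto_upperbound) simp
qed

lemma esum_ennreal_finite:
  assumes "f summable_on UNIV" "\<And>x. 0 \<le> f x"
  shows "esum (\<lambda>x. ennreal (f x)) = ennreal (infsum f UNIV)"
  unfolding esum_def
  using nn_integral_conv_infsetsum[of f UNIV] abs_summable_equivalent[of f UNIV] assms
    infsetsum_infsum[of f UNIV] by simp

section \<open>The algebra of nonnegative kernels\<close>

type_synonym kernel = "int \<Rightarrow> int \<Rightarrow> ennreal"

definition kmul :: "kernel \<Rightarrow> kernel \<Rightarrow> kernel" (infixl "\<cdot>" 70) where
  "(f \<cdot> g) i j = esum (\<lambda>k. f i k * g k j)"

definition kproj :: "int set \<Rightarrow> kernel" where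
  "kproj S i j = (if i = j \<and> i \<in> S then 1 else 0)"

lemma kmul_assoc: "f \<cdot> g \<cdot> h = f \<cdot> (g \<cdot> h)"
proof (intro ext)
  fix i j
  have "(f \<cdot> g \<cdot> h) i j = esum (\<lambda>k. esum (\<lambda>l. f i l * g l k * h k j))"
    by (simp add: kmul_def esum_multc)
  also have "\<dots> = esum (\<lambda>l. esum (\<lambda>k. f i l * g l k * h k j))" by (rule esum_swap)
  also have "\<dots> = (f \<cdot> (g \<cdot> h)) i j"
    by (simp add: kmul_def esum_cmult[symmetric] mult.assoc)
  finally show "(f \<cdot> g \<cdot> h) i j = (f \<cdot> (g \<cdot> h)) i j" .
qed

lemma kmul_mono:
  assumes "f \<le> f'" "g \<le> g'" shows "f \<cdot> g \<le> f' \<cdot> g'"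
  using assms by (auto simp: le_fun_def kmul_def intro!: esum_mono mult_mono)

lemma kproj_kmul: "(kproj S \<cdot> f) i j = (if i \<in> S then f i j else 0)"
  unfolding kmul_def by (subst esum_finite_support[of "{i}"]) (auto simp: kproj_def)

lemma kmul_kproj: "(f \<cdot> kproj S) i j = (if j \<in> S then f i j else 0)"
  unfolding kmul_def by (subst esum_finite_support[of "{j}"]) (auto simp: kproj_def)

lemma kproj_UNIV_kmul [simp]: "kproj UNIV \<cdot> f = f" "f \<cdot> kproj UNIV = f"
  by (auto simp: fun_eq_iff kproj_kmul kmul_kproj)

lemma kproj_kmul_le: "kproj S \<cdot> f \<le> f" and kmul_kproj_le: "f \<cdot> kproj S \<le> f"
  by (auto simp: le_fun_def kproj_kmul kmul_kproj)

lemma kproj_mono: "S \<subseteq> T \<Longrightarrow> kproj S \<le> kproj T"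
  by (auto simp: le_fun_def kproj_def)

lemma kmul_add_left: "(\<lambda>i j. f i j + g i j) \<cdot> h = (\<lambda>i j. (f \<cdot> h) i j + (g \<cdot> h) i j)"
  by (simp add: kmul_def fun_eq_iff distrib_right esum_add)

lemma kmul_add_right: "h \<cdot> (\<lambda>i j. f i j + g i j) = (\<lambda>i j. (h \<cdot> f) i j + (h \<cdot> g) i j)"
  by (simp add: kmul_def fun_eq_iff distrib_left esum_add)

lemma kmul_scale_left: "(\<lambda>i j. a * f i j) \<cdot> h = (\<lambda>i j. a * (f \<cdot> h) i j)"
  by (simp add: kmul_def fun_eq_iff mult.assoc esum_cmult)

lemma kmul_scale_right: "h \<cdot> (\<lambda>i j. a * f i j) = (\<lambda>i j. a * (h \<cdot> f) i j)"
  by (simp add: kmul_def fun_eq_iff mult.left_commute[of _ a] esum_cmult)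

lemma kmul_sum_left: "(\<lambda>i j. \<Sum>n\<in>A. f n i j) \<cdot> h = (\<lambda>i j. \<Sum>n\<in>A. (f n \<cdot> h) i j)"
  by (induction A rule: infinite_finite_induct) (simp_all add: kmul_add_left, simp_all add: kmul_def)

lemma kmul_sum_right: "h \<cdot> (\<lambda>i j. \<Sum>n\<in>A. f n i j) = (\<lambda>i j. \<Sum>n\<in>A. (h \<cdot> f n) i j)"
  by (induction A rule: infinite_finite_induct) (simp_all add: kmul_add_right, simp_all add: kmul_def)

fun kpow :: "kernel \<Rightarrow> nat \<Rightarrow> kernel" where
  "kpow f 0 = kproj UNIV"
| "kpow f (Suc n) = kpow f n \<cdot> f"

lemma kpow_Suc_left: "f \<cdot> kpow f n = kpow f n \<cdot> f"
  by (induction n) (simp_all flip: kmul_assoc)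

definition kexp_partial :: "kernel \<Rightarrow> nat \<Rightarrow> kernel" where
  "kexp_partial f N i j = (\<Sum>n<N. ennreal (1 / fact n) * kpow f n i j)"

definition kexp :: "kernel \<Rightarrow> kernel" where
  "kexp f i j = (\<Sum>n. ennreal (1 / fact n) * kpow f n i j)"

lemma kexp_partial_le: "kexp_partial f N \<le> kexp f"
  unfolding le_fun_def kexp_partial_def kexp_def by (auto intro!: sum_le_suminf)

lemma kproj_le_kexp: "kproj UNIV \<le> kexp f"
  by (rule order_trans[OF _ kexp_partial_le[of f 1]]) (simp add: le_fun_def kexp_partial_def)

definition toeplitz :: "kernel \<Rightarrow> bool" where
  "toeplitz f \<longleftrightarrow> (\<forall>i j n. f (i + n) (j + n) = f i j)"

lemma toeplitz_eq: "toeplitz f \<Longrightarrow> i - j = i' - j' \<Longrightarrow> f i j = f i' j'"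
proof -
  assume f: "toeplitz f" and eq: "i - j = i' - j'"
  from eq have "f (i' + (i - i')) (j' + (i - i')) = f i j" by (simp add: algebra_simps)
  moreover have "f (i' + (i - i')) (j' + (i - i')) = f i' j'" using f by (simp only: toeplitz_def)
  ultimately show "f i j = f i' j'" by simp
qed

lemma bij_add_int: "bij (\<lambda>i :: int. i + n)"
  by (rule bij_betwI[of _ _ _ "\<lambda>i. i - n"]) auto

lemma bij_diff_int: "bij (\<lambda>i :: int. n - i)"
  by (rule bij_betwI[of _ _ _ "\<lambda>i. n - i"]) auto

lemma kmul_shift: "(\<lambda>i j. (f \<cdot> g) (i + n) (j + n)) = (\<lambda>i j. f (i + n) (j + n)) \<cdot> (\<lambda>i j. g (i + n) (j + n))"
proof (intro ext)
  fix i j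
  show "(f \<cdot> g) (i + n) (j + n) = ((\<lambda>i j. f (i + n) (j + n)) \<cdot> (\<lambda>i j. g (i + n) (j + n))) i j"
    unfolding kmul_def by (rule esum_reindex[OF bij_add_int, symmetric])
qed

lemma toeplitz_kmul: "toeplitz f \<Longrightarrow> toeplitz g \<Longrightarrow> toeplitz (f \<cdot> g)"
  using kmul_shift[of f g] unfolding toeplitz_def fun_eq_iff by simp

lemma toeplitz_kproj_UNIV: "toeplitz (kproj UNIV)"
  by (simp add: toeplitz_def kproj_def)

lemma toeplitz_kpow: "toeplitz f \<Longrightarrow> toeplitz (kpow f n)"
  by (induction n) (simp_all add: toeplitz_kproj_UNIV toeplitz_kmul)

lemma toeplitz_kexp: "toeplitz f \<Longrightarrow> toeplitz (kexp f)"
  using toeplitz_kpow[of f] by (simp add: toeplitz_def kexp_def)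

lemma esum_toeplitz_row:
  assumes "toeplitz f" shows "esum (\<lambda>j. f k j) = esum (\<lambda>i. f i 0)"
proof -
  have "esum (\<lambda>j. f k j) = esum (\<lambda>j. (\<lambda>i. f i 0) (k - j))"
    by (intro arg_cong[of _ _ esum] ext toeplitz_eq[OF assms]) simp
  also have "\<dots> = esum (\<lambda>i. f i 0)" by (rule esum_reindex[OF bij_diff_int])
  finally show ?thesis .
qed

lemma esum_toeplitz_col:
  assumes "toeplitz f" shows "esum (\<lambda>i. f i k) = esum (\<lambda>i. f i 0)"
proof -
  have "esum (\<lambda>i. f i k) = esum (\<lambda>i. (\<lambda>i. f i 0) (i + (-k)))"
    by (intro arg_cong[of _ _ esum] ext toeplitz_eq[OF assms]) simp
  also have "\<dots> = esum (\<lambda>i. f i 0)" by (rule esum_reindex[OF bij_add_int])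
  finally show ?thesis .
qed

text \<open>The norm of the weighted Wiener algebra, read off column 0 of a Toeplitz kernel.\<close>

definition weighted_sum :: "(int \<Rightarrow> real) \<Rightarrow> kernel \<Rightarrow> ennreal" where
  "weighted_sum \<alpha> f = esum (\<lambda>i. ennreal (\<alpha> i) * f i 0)"

text \<open>Column 0 of a product of Toeplitz kernels is a convolution, and a submultiplicative
  weight makes the weighted norm submultiplicative for convolution.\<close>

lemma weighted_sum_kmul_le:
  assumes "toeplitz f" "toeplitz g" and \<alpha>: "\<And>i. 0 \<le> \<alpha> i" "\<And>i j. \<alpha> (i + j) \<le> \<alpha> i * \<alpha> j"
  shows "weighted_sum \<alpha> (f \<cdot> g) \<le> weighted_sum \<alpha> f * weighted_sum \<alpha> g"
proof -
  have "weighted_sum \<alpha> (f \<cdot> g) = esum (\<lambda>i. esum (\<lambda>k. ennreal (\<alpha> i) * (f i k * g k 0)))"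
    by (simp add: weighted_sum_def kmul_def esum_cmult)
  also have "\<dots> = esum (\<lambda>k. esum (\<lambda>i. ennreal (\<alpha> i) * (f i k * g k 0)))" by (rule esum_swap)
  also have "\<dots> = esum (\<lambda>k. esum (\<lambda>i. ennreal (\<alpha> (i + k)) * (f (i + k) k * g k 0)))"
    by (rule esum_cong, rule esum_reindex[OF bij_add_int, symmetric])
  also have "\<dots> \<le> esum (\<lambda>k. esum (\<lambda>i. (ennreal (\<alpha> i) * f i 0) * (ennreal (\<alpha> k) * g k 0)))"
  proof (intro esum_mono)
    fix k i
    have "f (i + k) k = f i 0" by (rule toeplitz_eq[OF assms(1)]) simp
    moreover have "ennreal (\<alpha> (i + k)) \<le> ennreal (\<alpha> i) * ennreal (\<alpha> k)"
      using \<alpha> by (simp add: ennreal_leI flip: ennreal_mult)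
    ultimately show "ennreal (\<alpha> (i + k)) * (f (i + k) k * g k 0)
        \<le> (ennreal (\<alpha> i) * f i 0) * (ennreal (\<alpha> k) * g k 0)"
      using mult_right_mono[of "ennreal (\<alpha> (i + k))" "ennreal (\<alpha> i) * ennreal (\<alpha> k)" "f i 0 * g k 0"]
      by (simp add: mult_ac)
  qed
  also have "\<dots> = weighted_sum \<alpha> f * weighted_sum \<alpha> g"
    by (simp add: weighted_sum_def esum_multc esum_cmult)
  finally show ?thesis .
qed

lemma weighted_sum_kproj: "\<alpha> 0 = 1 \<Longrightarrow> weighted_sum \<alpha> (kproj UNIV) = 1"
  unfolding weighted_sum_def by (subst esum_finite_support[of "{0}"]) (auto simp: kproj_def)

lemma weighted_sum_kpow_le:
  assumes "toeplitz f" and \<alpha>: "\<And>i. 0 \<le> \<alpha> i" "\<And>i j. \<alpha> (i + j) \<le> \<alpha> i * \<alpha> j" "\<alpha> 0 = 1"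
  shows "weighted_sum \<alpha> (kpow f n) \<le> weighted_sum \<alpha> f ^ n"
proof (induction n)
  case (Suc n)
  have "weighted_sum \<alpha> (kpow f n \<cdot> f) \<le> weighted_sum \<alpha> (kpow f n) * weighted_sum \<alpha> f"
    by (rule weighted_sum_kmul_le[OF toeplitz_kpow]) (use assms in auto)
  also have "\<dots> \<le> weighted_sum \<alpha> f ^ n * weighted_sum \<alpha> f"
    by (rule mult_right_mono[OF Suc]) simp
  finally show ?case by (simp add: mult.commute)
qed (simp add: weighted_sum_kproj assms)

text \<open>Submultiplicativity bounds the exponential series term by term by that of the number
  \<open>weighted_sum \<alpha> f\<close>.\<close>

lemma weighted_sum_kexp_finite:
  assumes "toeplitz f" and \<alpha>: "\<And>i. 0 \<le> \<alpha> i" "\<And>i j. \<alpha> (i + j) \<le> \<alpha> i * \<alpha> j" "\<alpha> 0 = 1"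
    and fin: "weighted_sum \<alpha> f < \<infinity>"
  shows "weighted_sum \<alpha> (kexp f) < \<infinity>"
proof -
  obtain x where x: "weighted_sum \<alpha> f = ennreal x" "x \<ge> 0"
    using fin by (cases "weighted_sum \<alpha> f") auto
  have "weighted_sum \<alpha> (kexp f) = esum (\<lambda>i. \<Sum>n. ennreal (\<alpha> i) * (ennreal (1 / fact n) * kpow f n i 0))"
    by (simp add: weighted_sum_def kexp_def)
  also have "\<dots> = (\<Sum>n. ennreal (1 / fact n) * weighted_sum \<alpha> (kpow f n))"
    unfolding esum_suminf weighted_sum_def by (simp only: mult.left_commute[of "ennreal (\<alpha> _)"] esum_cmult)
  also have "\<dots> \<le> (\<Sum>n. ennreal (x ^ n / fact n))"
  proof (intro suminf_le)
    fix n
    have "ennreal (1 / fact n) * weighted_sum \<alpha> (kpow f n) \<le> ennreal (1 / fact n) * ennreal x ^ n"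
      using weighted_sum_kpow_le[OF assms(1-4), of n] by (intro mult_left_mono) (auto simp: x)
    also have "\<dots> = ennreal (x ^ n / fact n)"
      using x(2) by (simp add: ennreal_power flip: ennreal_mult)
    finally show "ennreal (1 / fact n) * weighted_sum \<alpha> (kpow f n) \<le> ennreal (x ^ n / fact n)" .
  qed auto
  also have "\<dots> = ennreal (exp x)"
    using x(2) exp_converges[of x] by (intro suminf_ennreal_eq) (auto simp: field_simps)
  also have "\<dots> < \<infinity>" by simp
  finally show ?thesis .
qed

section \<open>Total mass of a kernel, in the role of a trace norm, and the mass of corners\<close>

definition ktotal :: "kernel \<Rightarrow> ennreal" where
  "ktotal f = esum (\<lambda>i. esum (\<lambda>j. f i j))"

lemma ktotal_mono: "f \<le> g \<Longrightarrow> ktotal f \<le> ktotal g"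
  by (auto simp: ktotal_def le_fun_def intro!: esum_mono)

lemma ktotal_scale: "ktotal (\<lambda>i j. a * f i j) = a * ktotal f"
  by (simp add: ktotal_def esum_cmult)

lemma ktotal_add: "ktotal (\<lambda>i j. f i j + g i j) = ktotal f + ktotal g"
  by (simp add: ktotal_def esum_add)

lemma ktotal_shift: "ktotal (\<lambda>i j. f (i + n) (j + n)) = ktotal f"
proof -
  have "esum (\<lambda>j. f (i + n) (j + n)) = esum (f (i + n))" for i
    by (rule esum_reindex[OF bij_add_int])
  then have "ktotal (\<lambda>i j. f (i + n) (j + n)) = esum (\<lambda>i. esum (f (i + n)))"
    by (simp only: ktotal_def)
  also have "\<dots> = esum (\<lambda>i. esum (f i))" by (rule esum_reindex[OF bij_add_int])
  finally show ?thesis by (simp only: ktotal_def)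
qed

text \<open>An ideal property: all rows of a Toeplitz kernel have the same sum, so this sum factors
  out. \<open>ktotal_kmul_le'\<close> is the version with columns.\<close>

lemma ktotal_kmul_le:
  assumes "toeplitz g"
  shows "ktotal (f \<cdot> g) \<le> ktotal f * esum (\<lambda>i. g i 0)"
proof -
  define s where "s = esum (\<lambda>i. g i 0)"
  have row: "esum (g k) = s" for k using esum_toeplitz_row[OF assms] by (simp add: s_def)
  have "ktotal (f \<cdot> g) = esum (\<lambda>i. esum (\<lambda>k. esum (\<lambda>j. f i k * g k j)))"
    unfolding ktotal_def kmul_def by (rule esum_cong, rule esum_swap)
  also have "\<dots> = ktotal f * s"
    by (simp only: esum_cmult row esum_multc ktotal_def)
  finally show ?thesis by (simp add: s_def)
qed

lemma ktotal_kmul_le':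
  assumes "toeplitz g"
  shows "ktotal (g \<cdot> f) \<le> esum (\<lambda>i. g i 0) * ktotal f"
proof -
  define s where "s = esum (\<lambda>i. g i 0)"
  have col: "esum (\<lambda>i. g i k) = s" for k unfolding s_def by (rule esum_toeplitz_col[OF assms])
  have "ktotal (g \<cdot> f) = esum (\<lambda>i. esum (\<lambda>k. esum (\<lambda>j. g i k * f k j)))"
    unfolding ktotal_def kmul_def by (rule esum_cong, rule esum_swap)
  also have "\<dots> = esum (\<lambda>k. esum (\<lambda>i. g i k * esum (\<lambda>j. f k j)))"
    unfolding esum_cmult[symmetric] by (rule esum_swap)
  also have "\<dots> = s * ktotal f"
    by (simp only: esum_multc col esum_cmult ktotal_def)
  finally show ?thesis by (simp add: s_def)
qed

text \<open>Weights of paths from \<open>S\<close> into \<open>D\<close> and back. For complementary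
  half-lines this is the product of two opposite Hankel blocks.\<close>

definition corner :: "kernel \<Rightarrow> int set \<Rightarrow> int set \<Rightarrow> kernel" where
  "corner c S D = kproj S \<cdot> c \<cdot> kproj D \<cdot> c \<cdot> kproj S"

lemma corner_eq:
  "corner c S D i j = esum (\<lambda>l. if i \<in> S \<and> j \<in> S \<and> l \<in> D then c i l * c l j else 0)"
proof -
  have "(kproj S \<cdot> c \<cdot> kproj D \<cdot> c) i j = esum (\<lambda>l. if i \<in> S \<and> l \<in> D then c i l * c l j else 0)"
    unfolding kmul_def[of "kproj S \<cdot> c \<cdot> kproj D"]
    by (rule arg_cong[of _ _ esum]) (simp add: fun_eq_iff kmul_kproj kproj_kmul)
  then show ?thesis by (cases "j \<in> S") (simp_all add: corner_def kmul_kproj)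
qed

lemma esum_rotate: "esum (\<lambda>x. esum (\<lambda>y. esum (\<lambda>z. f x y z))) = esum (\<lambda>z. esum (\<lambda>x. esum (\<lambda>y. f x y z)))"
proof -
  have "esum (\<lambda>x. esum (\<lambda>y. esum (\<lambda>z. f x y z))) = esum (\<lambda>x. esum (\<lambda>z. esum (\<lambda>y. f x y z)))"
    by (rule esum_cong, rule esum_swap)
  also have "\<dots> = esum (\<lambda>z. esum (\<lambda>x. esum (\<lambda>y. f x y z)))"
    using esum_swap[of "\<lambda>x z. esum (\<lambda>y. f x y z)"] .
  finally show ?thesis .
qed

lemma ktotal_corner:
  "ktotal (corner c S D) = esum (\<lambda>l. esum (\<lambda>i. esum (\<lambda>j. if i \<in> S \<and> j \<in> S \<and> l \<in> D then c i l * c l j else 0)))"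
  using esum_rotate[of "\<lambda>i j l. if i \<in> S \<and> j \<in> S \<and> l \<in> D then c i l * c l j else 0"]
  by (simp only: ktotal_def corner_eq)

text \<open>A path that starts and ends in the right half-line and jumps by \<open>-q\<close> and \<open>p\<close> meets the left one
  for at most \<open>min p q\<close> starting points; the exponents of the weights sum to 1 exactly to absorb this factor.\<close>

lemma ktotal_corner_le:
  assumes c: "toeplitz c" and \<alpha>: "\<And>i. 0 \<le> \<alpha> i"
    "\<And>p q. 0 \<le> p \<Longrightarrow> 0 \<le> q \<Longrightarrow> of_int (min p q) \<le> \<alpha> p * \<alpha> (- q)"
  shows "ktotal (corner c {0..} {..<0}) \<le> weighted_sum \<alpha> c * weighted_sum \<alpha> c"
proof -
  let ?f = "\<lambda>l i j. if i \<ge> 0 \<and> j \<ge> 0 \<and> l < 0 then c i l * c l j else 0" and ?h = "\<lambda>l p q. if l \<in> {- min p q..<0} then c p 0 * c (- q) 0 else 0"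
  have "ktotal (corner c {0..} {..<0})
      = esum (\<lambda>l. esum (\<lambda>i. esum (\<lambda>j. ?f l i j)))"
    by (simp add: ktotal_corner)
  \<comment> \<open>In the coordinates \<open>p = i - l\<close> and \<open>q = j - l\<close> the
    constraints become \<open>- min p q <= l < 0\<close>; since \<open>c\<close> is Toeplitz,
    \<open>l\<close> is merely counted and yields the factor \<open>min p q\<close>.\<close>
  also have "\<dots> = esum (\<lambda>l. esum (\<lambda>p. esum (\<lambda>q. ?f l (p + l) (q + l))))"
  proof (rule esum_cong)
    fix l :: int
    have "esum (\<lambda>i. esum (\<lambda>j. ?f l i j)) = esum (\<lambda>p. esum (\<lambda>j. ?f l (p + l) j))"
      by (rule esum_reindex[OF bij_add_int, symmetric])
    also have "\<dots> = esum (\<lambda>p. esum (\<lambda>q. ?f l (p + l) (q + l)))"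
      by (rule esum_cong, rule esum_reindex[OF bij_add_int, symmetric])
    finally show "esum (\<lambda>i. esum (\<lambda>j. ?f l i j)) = esum (\<lambda>p. esum (\<lambda>q. ?f l (p + l) (q + l)))" .
  qed
  also have "\<dots> = esum (\<lambda>l. esum (\<lambda>p. esum (\<lambda>q. ?h l p q)))"
  proof (rule esum_cong, rule esum_cong, rule esum_cong)
    fix l p q :: int
    have "c (p + l) l = c p 0" "c l (q + l) = c (- q) 0"
      by (rule toeplitz_eq[OF c], simp)+
    then show "?f l (p + l) (q + l)
        = ?h l p q" by auto
  qed
  also have "\<dots> = esum (\<lambda>p. esum (\<lambda>l. esum (\<lambda>q. ?h l p q)))"
    by (rule esum_swap)
  also have "\<dots> = esum (\<lambda>p. esum (\<lambda>q. esum (\<lambda>l. ?h l p q)))"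
    by (rule esum_cong, rule esum_swap)
  also have "\<dots> \<le> esum (\<lambda>p. esum (\<lambda>q. (ennreal (\<alpha> p) * c p 0) * (ennreal (\<alpha> (- q)) * c (- q) 0)))"
  proof (intro esum_mono)
    fix p q :: int
    have "esum (\<lambda>l. ?h l p q)
        = (\<Sum>l\<in>{- min p q..<0}. ?h l p q)"
      by (rule esum_finite_support) auto
    also have "\<dots> = (\<Sum>l\<in>{- min p q..<0}. c p 0 * c (- q) 0)" by (rule sum.cong) simp_all
    also have "\<dots> = of_nat (nat (min p q)) * (c p 0 * c (- q) 0)" by simp
    also have "\<dots> \<le> (ennreal (\<alpha> p) * ennreal (\<alpha> (- q))) * (c p 0 * c (- q) 0)"
    proof (rule mult_right_mono)
      have "real (nat (min p q)) \<le> \<alpha> p * \<alpha> (- q)"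
      proof (cases "0 \<le> min p q")
        case True
        then have "real (nat (min p q)) = of_int (min p q)" by simp
        with True \<alpha>(2)[of p q] show ?thesis by simp
      next
        case False
        then have "real (nat (min p q)) = 0" by (auto simp: min_def)
        with \<alpha>(1) show ?thesis by (simp only: mult_nonneg_nonneg)
      qed
      then show "of_nat (nat (min p q)) \<le> ennreal (\<alpha> p) * ennreal (\<alpha> (- q))"
        using \<alpha>(1) by (metis ennreal_leI ennreal_mult ennreal_of_nat_eq_real_of_nat)
    qed simp
    finally show "esum (\<lambda>l. ?h l p q)
        \<le> (ennreal (\<alpha> p) * c p 0) * (ennreal (\<alpha> (- q)) * c (- q) 0)" by (simp add: mult_ac)
  qed
  also have "\<dots> = weighted_sum \<alpha> c * esum (\<lambda>q. ennreal (\<alpha> (- q)) * c (- q) 0)"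
    by (simp add: weighted_sum_def esum_multc esum_cmult)
  also have "esum (\<lambda>q. ennreal (\<alpha> (- q)) * c (- q) 0) = weighted_sum \<alpha> c"
    unfolding weighted_sum_def using esum_reindex[OF bij_diff_int[of 0], of "\<lambda>q. ennreal (\<alpha> q) * c q 0"] by simp
  finally show ?thesis .
qed

text \<open>The reflection \<open>i\<close> to \<open>-1 - i\<close> exchanges the two half-lines
  but transposes a Toeplitz kernel; exchanging the end points \<open>i\<close> and \<open>j\<close>
  undoes the transposition. The shift by -1 accounts for 0 lying in the right half-line.\<close>

lemma ktotal_corner_reflect:
  assumes c: "toeplitz c"
  shows "ktotal (corner c {..<0} {0..}) = ktotal (corner c {0..} {..<0})"
proof -
  let ?f = "\<lambda>l i j. if i < 0 \<and> j < 0 \<and> 0 \<le> l then c i l * c l j else 0"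
  have "ktotal (corner c {..<0} {0..}) = esum (\<lambda>l. esum (\<lambda>i. esum (\<lambda>j. ?f l i j)))"
    by (simp add: ktotal_corner)
  also have "\<dots> = esum (\<lambda>l. esum (\<lambda>i. esum (\<lambda>j. ?f (-1 - l) i j)))"
    by (rule esum_reindex[OF bij_diff_int, symmetric])
  also have "\<dots> = esum (\<lambda>l. esum (\<lambda>i. esum (\<lambda>j. ?f (-1 - l) (-1 - i) j)))"
    by (rule esum_cong, rule esum_reindex[OF bij_diff_int, symmetric])
  also have "\<dots> = esum (\<lambda>l. esum (\<lambda>i. esum (\<lambda>j. ?f (-1 - l) (-1 - i) (-1 - j))))"
    by (rule esum_cong, rule esum_cong,
        rule esum_reindex[OF bij_diff_int, symmetric])
  also have "\<dots> = esum (\<lambda>l. esum (\<lambda>i. esum (\<lambda>j. if j \<ge> 0 \<and> i \<ge> 0 \<and> l < 0 then c j l * c l i else 0)))"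
  proof (rule esum_cong, rule esum_cong, rule esum_cong)
    fix l i j :: int
    have "c (-1 - i) (-1 - l) = c l i" "c (-1 - l) (-1 - j) = c j l"
      by (rule toeplitz_eq[OF c], simp)+
    then show "?f (-1 - l) (-1 - i) (-1 - j) = (if j \<ge> 0 \<and> i \<ge> 0 \<and> l < 0 then c j l * c l i else 0)"
      by (auto simp: mult.commute)
  qed
  also have "\<dots> = esum (\<lambda>l. esum (\<lambda>j. esum (\<lambda>i. if j \<ge> 0 \<and> i \<ge> 0 \<and> l < 0 then c j l * c l i else 0)))"
    by (rule esum_cong, rule esum_swap)
  also have "\<dots> = ktotal (corner c {0..} {..<0})" by (simp add: ktotal_corner)
  finally show ?thesis .
qed

lemma kproj_shift: "(\<lambda>i j. kproj S (i + n) (j + n)) = kproj ((\<lambda>i. i - n) ` S)"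
  by (force simp: kproj_def fun_eq_iff image_iff)

lemma corner_shift:
  assumes "toeplitz c"
  shows "(\<lambda>i j. corner c S D (i + n) (j + n)) = corner c ((\<lambda>i. i - n) ` S) ((\<lambda>i. i - n) ` D)"
proof -
  have c: "(\<lambda>i j. c (i + n) (j + n)) = c" using assms by (simp add: toeplitz_def fun_eq_iff)
  show ?thesis unfolding corner_def by (simp only: kmul_shift kproj_shift c)
qed

text \<open>The source of all uniformity in the position of the cut.\<close>

lemma ktotal_corner_shift:
  assumes "toeplitz c"
  shows "ktotal (corner c ((\<lambda>i. i - n) ` S) ((\<lambda>i. i - n) ` D)) = ktotal (corner c S D)"
  unfolding corner_shift[OF assms, symmetric] by (rule ktotal_shift)

lemma ktotal_tendsto_0:
  assumes f: "ktotal f < \<infinity>" and le: "\<And>n. g n \<le> f" and lim: "\<And>i j. (\<lambda>n. g n i j) \<longlonglongrightarrow> 0"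
  shows "(\<lambda>n. ktotal (g n)) \<longlonglongrightarrow> 0"
  unfolding ktotal_def esum_prod
  by (rule esum_tendsto_0[of "\<lambda>z. f (fst z) (snd z)"])
    (use assms in \<open>auto simp: ktotal_def esum_prod le_fun_def\<close>)

section \<open>Matrix entries of operators\<close>

text \<open>The squared error of the partial sum over \<open>F\<close> is exactly the part of the
  squared norm that lies outside \<open>F\<close>.\<close>

lemma has_sum_basis_expansion: "((\<lambda>k. cscale (coord v k) (basis_vec k)) has_sum v) UNIV"
proof -
  have sq: "(\<lambda>i. (cmod (coord v i))\<^sup>2) summable_on UNIV" using coord[of v] by simp
  have coord_sum: "coord (\<Sum>k\<in>F. cscale (coord v k) (basis_vec k)) i = (if i \<in> F then coord v i else 0)"
    if "finite F" for F i
    using that by (induction F rule: finite_induct)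
      (auto simp: zero_ell2.rep_eq plus_ell2.rep_eq cscale.rep_eq basis_vec.rep_eq)
  have "(sum (\<lambda>k. cscale (coord v k) (basis_vec k)) \<longlongrightarrow> v) (finite_subsets_at_top UNIV)"
    unfolding tendsto_iff
  proof (intro allI impI)
    fix e :: real assume e: "e > 0"
    have "(sum (\<lambda>i. (cmod (coord v i))\<^sup>2) \<longlongrightarrow> (\<Sum>\<^sub>\<infinity>i. (cmod (coord v i))\<^sup>2)) (finite_subsets_at_top UNIV)"
      using has_sum_infsum[OF sq] by (simp add: has_sum_def)
    then have "\<forall>\<^sub>F F in finite_subsets_at_top UNIV.
        dist (\<Sum>i\<in>F. (cmod (coord v i))\<^sup>2) (\<Sum>\<^sub>\<infinity>i. (cmod (coord v i))\<^sup>2) < e\<^sup>2"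
      using e unfolding tendsto_iff by simp
    moreover have "\<forall>\<^sub>F F in finite_subsets_at_top (UNIV :: 'a set). finite F"
      by (rule eventually_finite_subsets_at_top_weakI)
    ultimately show "\<forall>\<^sub>F F in finite_subsets_at_top UNIV.
        dist (\<Sum>k\<in>F. cscale (coord v k) (basis_vec k)) v < e"
    proof eventually_elim
      case (elim F)
      let ?w = "(\<Sum>k\<in>F. cscale (coord v k) (basis_vec k)) - v"
      have "(norm ?w)\<^sup>2 = (\<Sum>\<^sub>\<infinity>i. (cmod (coord ?w i))\<^sup>2)"
        by (simp add: norm_ell2.rep_eq infsum_nonneg)
      also have "\<dots> = (\<Sum>\<^sub>\<infinity>i\<in>UNIV - F. (cmod (coord v i))\<^sup>2)"
        using elim by (intro infsum_cong_neutral) (auto simp: minus_ell2.rep_eq coord_sum)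
      also have "\<dots> = (\<Sum>\<^sub>\<infinity>i. (cmod (coord v i))\<^sup>2) - (\<Sum>i\<in>F. (cmod (coord v i))\<^sup>2)"
        using elim infsum_Diff[OF sq, of F] by simp
      also have "\<dots> < e\<^sup>2" using elim by (simp add: dist_real_def)
      finally have "norm ?w < e" using e by (simp add: power_less_imp_less_base)
      then show ?case by (simp add: dist_norm)
    qed
  qed
  then show ?thesis by (simp add: has_sum_def)
qed

lemma bounded_linear_coord: "bounded_linear (\<lambda>x. coord x i)"
  by (rule bounded_linear_intro[of _ 1])
    (simp_all add: plus_ell2.rep_eq scaleR_ell2.rep_eq cmod_coord_le scaleR_conv_of_real)

lemma has_sum_coord_op_apply: "((\<lambda>k. entry A i k * coord v k) has_sum coord (op_apply A v) i) UNIV"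
proof -
  have "bounded_linear (\<lambda>x. coord (op_apply A x) i)"
    by (rule bounded_linear_compose[OF bounded_linear_coord bounded_linear_op_apply])
  from has_sum_bounded_linear[OF this has_sum_basis_expansion[of v]]
  show ?thesis by (simp add: o_def op_apply_cscale cscale.rep_eq entry_def mult.commute)
qed

text \<open>Reduces operator identities to matrix entries, where projections, shifts and
  multiplications are explicit.\<close>

lemma op_eqI:
  assumes "\<And>i j. entry A i j = entry B i j" shows "A = B"
proof -
  have "coord (op_apply A v) i = coord (op_apply B v) i" for v i
    using has_sum_unique[OF has_sum_coord_op_apply[of A i v], of "coord (op_apply B v) i"]
      has_sum_coord_op_apply[of B i v] assms by simp
  then show ?thesis by (metis op_apply_inject coord_inject ext)
qed

lemma has_sum_entry_mult: "((\<lambda>k. entry A i k * entry B k j) has_sum entry (A * B) i j) UNIV"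
  using has_sum_coord_op_apply[of A i "op_apply B (basis_vec j)"]
  by (simp add: entry_def times_ell2_op.rep_eq)

lemma bounded_linear_entry: "bounded_linear (\<lambda>A. entry A i j)"
proof (rule bounded_linear_intro)
  fix A B :: "'a ell2_op" and r :: real
  show "entry (A + B) i j = entry A i j + entry B i j"
    by (simp add: entry_def plus_ell2_op.rep_eq plus_ell2.rep_eq)
  show "entry (r *\<^sub>R A) i j = r *\<^sub>R entry A i j"
    by (simp add: entry_def scaleR_ell2_op.rep_eq scaleR_ell2.rep_eq scaleR_conv_of_real[of r "_ :: complex"])
  have "cmod (entry A i j) \<le> norm (op_apply A (basis_vec j))" unfolding entry_def by (rule cmod_coord_le)
  also have "\<dots> \<le> norm A * norm (basis_vec j)" by (rule norm_op_apply)
  finally show "cmod (entry A i j) \<le> norm A * norm (basis_vec j)" .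
qed

lemmas entry_add = linear_add[OF bounded_linear.linear[OF bounded_linear_entry]]
  and entry_diff = linear_diff[OF bounded_linear.linear[OF bounded_linear_entry]]
  and entry_minus = linear_neg[OF bounded_linear.linear[OF bounded_linear_entry]]
  and entry_scaleR = linear_scale[OF bounded_linear.linear[OF bounded_linear_entry]]
  and entry_zero = linear_0[OF bounded_linear.linear[OF bounded_linear_entry]]

lemma entry_one: "entry 1 i j = (if i = j then 1 else 0)"
  by (simp add: entry_def one_ell2_op.rep_eq basis_vec.rep_eq)

lemma entry_mult_op:
  assumes "bounded (range b)" shows "entry (mult_op b) i j = (if i = j then b i else 0)"
proof -
  obtain B where B: "\<And>i. cmod (b i) \<le> B" using assms by (auto simp: bounded_iff)
  have "coord (ell2 (\<lambda>i. b i * coord (basis_vec j) i)) = (\<lambda>i. b i * coord (basis_vec j) i)"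
    by (rule op_of_coordsI(2)[of "\<lambda>x i. b i * coord x i", OF _ _ mult_op_bound[OF B]])
      (simp_all add: plus_ell2.rep_eq cscale.rep_eq algebra_simps)
  then show ?thesis using assms by (simp add: entry_def mult_op.rep_eq basis_vec.rep_eq)
qed

lemma coord_shift_op: "coord (op_apply (shift_op n) x) k = coord x (k - n)"
proof -
  have "coord (ell2 (\<lambda>k. coord x (k - n))) = (\<lambda>k. coord x (k - n))"
    by (rule op_of_coordsI(2)[of "\<lambda>x k. coord x (k - n)", OF _ _ shift_bound])
      (simp_all add: plus_ell2.rep_eq cscale.rep_eq)
  then show ?thesis by (simp add: shift_op.rep_eq)
qed

lemma entry_proj_op: "entry (proj_op S) i j = (if i = j \<and> i \<in> S then 1 else 0)"
proof -
  have "bounded (range (indicator S :: 'a \<Rightarrow> complex))"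
    unfolding bounded_iff by (intro exI[of _ 1]) (auto simp: indicator_def)
  then show ?thesis unfolding proj_op_def by (simp add: entry_mult_op indicator_def)
qed

lemma entry_proj_op_mult: "entry (proj_op S * A) i j = (if i \<in> S then entry A i j else 0)"
proof -
  have "((\<lambda>k. entry (proj_op S) i k * entry A k j) has_sum (if i \<in> S then entry A i j else 0)) UNIV"
    by (rule has_sum_finite_neutralI[of "{i}"]) (auto simp: entry_proj_op)
  from has_sum_unique[OF has_sum_entry_mult this] show ?thesis .
qed

lemma entry_mult_proj_op: "entry (A * proj_op S) i j = (if j \<in> S then entry A i j else 0)"
proof -
  have "((\<lambda>k. entry A i k * entry (proj_op S) k j) has_sum (if j \<in> S then entry A i j else 0)) UNIV"
    by (rule has_sum_finite_neutralI[of "{j}"]) (auto simp: entry_proj_op)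
  from has_sum_unique[OF has_sum_entry_mult this] show ?thesis .
qed

lemma proj_op_mult_proj_op: "proj_op S * proj_op T = proj_op (S \<inter> T)"
  by (rule op_eqI) (auto simp: entry_proj_op_mult entry_proj_op)

lemma proj_op_UNIV: "proj_op UNIV = 1"
  by (rule op_eqI) (simp add: entry_proj_op entry_one)

lemma proj_op_Un: "S \<inter> T = {} \<Longrightarrow> proj_op (S \<union> T) = proj_op S + proj_op T"
  by (rule op_eqI) (auto simp: entry_proj_op entry_add)

section \<open>Domination by nonnegative kernels\<close>

text \<open>Stable under sums, products, compressions and norm limits, hence under
  exponentials.\<close>

definition dominated :: "int ell2_op \<Rightarrow> kernel \<Rightarrow> bool" where
  "dominated X f \<longleftrightarrow> (\<forall>i j. ennreal (cmod (entry X i j)) \<le> f i j)"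

lemma dominated_mono: "dominated X f \<Longrightarrow> f \<le> g \<Longrightarrow> dominated X g"
  unfolding dominated_def le_fun_def by (meson order_trans)

lemma dominated_add: "dominated X f \<Longrightarrow> dominated Y g \<Longrightarrow> dominated (X + Y) (\<lambda>i j. f i j + g i j)"
proof -
  have "ennreal (cmod (entry X i j + entry Y i j)) \<le> ennreal (cmod (entry X i j)) + ennreal (cmod (entry Y i j))" for i j
    by (simp add: ennreal_leI norm_triangle_ineq flip: ennreal_plus)
  then show "dominated X f \<Longrightarrow> dominated Y g \<Longrightarrow> dominated (X + Y) (\<lambda>i j. f i j + g i j)"
    unfolding dominated_def entry_add by (meson add_mono order_trans)
qed

lemma dominated_mult:
  assumes "dominated X f" "dominated Y g" shows "dominated (X * Y) (f \<cdot> g)"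
  unfolding dominated_def
proof (intro allI)
  fix i j
  have "ennreal (cmod (entry (X * Y) i j)) \<le> esum (\<lambda>k. ennreal (cmod (entry X i k * entry Y k j)))"
    by (rule has_sum_norm_le_esum[OF has_sum_entry_mult])
  also have "\<dots> \<le> (f \<cdot> g) i j"
    unfolding kmul_def using assms by (intro esum_mono) (auto simp: norm_mult ennreal_mult dominated_def intro!: mult_mono)
  finally show "ennreal (cmod (entry (X * Y) i j)) \<le> (f \<cdot> g) i j" .
qed

lemma dominated_uminus: "dominated (- X) f = dominated X f"
  by (simp add: dominated_def entry_minus)

lemma dominated_proj_op: "dominated (proj_op S) (kproj S)"
  by (simp add: dominated_def entry_proj_op kproj_def)

lemma dominated_one: "dominated 1 (kproj UNIV)"
  using dominated_proj_op[of UNIV] by (simp add: proj_op_UNIV)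

lemma dominated_power: "dominated X f \<Longrightarrow> dominated (X ^ n) (kpow f n)"
  by (induction n) (simp_all add: dominated_one dominated_mult power_Suc2 del: power_Suc)

lemma dominated_scaleR: "dominated X f \<Longrightarrow> dominated (r *\<^sub>R X) (\<lambda>i j. ennreal \<bar>r\<bar> * f i j)"
  by (auto simp: dominated_def entry_scaleR ennreal_mult intro: mult_left_mono)

lemma dominated_sum:
  assumes "\<And>n. n \<in> A \<Longrightarrow> dominated (X n) (f n)"
  shows "dominated (\<Sum>n\<in>A. X n) (\<lambda>i j. \<Sum>n\<in>A. f n i j)"
  using assms
proof (induction A rule: infinite_finite_induct)
  case (insert a A)
  then show ?case using dominated_add[of "X a" "f a" "\<Sum>n\<in>A. X n"] by simp
qed (auto simp: dominated_def entry_zero)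

lemma dominated_lim:
  assumes "X \<longlonglongrightarrow> L" "\<And>n. dominated (X n) f" shows "dominated L f"
  unfolding dominated_def
proof (intro allI)
  fix i j
  have "(\<lambda>n. ennreal (cmod (entry (X n) i j))) \<longlonglongrightarrow> ennreal (cmod (entry L i j))"
    by (intro tendsto_ennrealI tendsto_norm bounded_linear.tendsto[OF bounded_linear_entry] assms)
  then show "ennreal (cmod (entry L i j)) \<le> f i j"
    by (rule tendsto_upperbound) (use assms(2) in \<open>auto simp: dominated_def\<close>)
qed

definition exp_partial :: "'a::{real_normed_algebra_1,banach} \<Rightarrow> nat \<Rightarrow> 'a" where
  "exp_partial X N = (\<Sum>n<N. (1 / fact n) *\<^sub>R X ^ n)"

lemma exp_partial_tendsto: "exp_partial X \<longlonglongrightarrow> exp X"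
  using summable_sums[OF summable_exp_generic[of X]]
  by (simp add: exp_partial_def[abs_def] exp_def sums_def divide_inverse)

lemma dominated_exp_partial: "dominated X f \<Longrightarrow> dominated (exp_partial X N) (kexp_partial f N)"
  unfolding exp_partial_def kexp_partial_def
proof (rule dominated_sum)
  fix n assume "dominated X f"
  from dominated_scaleR[OF dominated_power[OF this], of "1 / fact n" n]
  show "dominated ((1 / fact n) *\<^sub>R X ^ n) (\<lambda>i j. ennreal (1 / fact n) * kpow f n i j)" by simp
qed

lemma dominated_exp: "dominated X f \<Longrightarrow> dominated (exp X) (kexp f)"
  by (rule dominated_lim[OF exp_partial_tendsto], rule dominated_mono[OF dominated_exp_partial kexp_partial_le])

text \<open>Kept as an operator on the whole of l2(Z): its exponential is then the identity off
  \<open>S\<close>, and compressions to different sets can be subtracted.\<close>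

definition compress :: "int set \<Rightarrow> int ell2_op \<Rightarrow> int ell2_op" where
  "compress S A = proj_op S * A * proj_op S"

lemma entry_compress: "entry (compress S A) i j = (if i \<in> S \<and> j \<in> S then entry A i j else 0)"
  by (simp add: compress_def entry_mult_proj_op entry_proj_op_mult)

lemma dominated_compress: "dominated A f \<Longrightarrow> dominated (compress S A) f"
  by (auto simp: dominated_def entry_compress)

text \<open>A word in \<open>A\<close> that survives the compression to \<open>S\<close> but not to \<open>T\<close> visits \<open>S - T\<close>; the kernel
  \<open>kexp f \<cdot> kproj (S - T) \<cdot> kexp f\<close> splits the path at such a visit.\<close>

lemma dominated_power_compress_diff:
  assumes A: "dominated A f" and T: "T \<subseteq> S"
  shows "dominated (compress S A ^ n - compress T A ^ n)
    (\<lambda>i j. (\<Sum>k<n. (kpow f k \<cdot> kproj (S - T) \<cdot> kpow f (n - k)) i j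
                  + (kpow f (Suc k) \<cdot> kproj (S - T) \<cdot> kpow f (n - Suc k)) i j))"
proof (induction n)
  case (Suc n)
  let ?X = "compress S A" and ?Y = "compress T A" and ?D = "kproj (S - T)"
  \<comment> \<open>An entry lost in passing from \<open>S\<close> to \<open>T\<close> has its row
    or its column in \<open>S - T\<close>; the two summands record a visit before or after the
    letter \<open>A\<close>.\<close>
  have XY: "dominated (?X - ?Y) (\<lambda>i j. (?D \<cdot> f) i j + (f \<cdot> ?D) i j)"
    unfolding dominated_def
  proof (intro allI)
    fix i j
    have le: "ennreal (cmod (entry A i j)) \<le> f i j" using A by (simp add: dominated_def)
    then have "ennreal (cmod (entry A i j)) \<le> f i j + f i j" by (simp add: add_increasing)
    with le T show "ennreal (cmod (entry (?X - ?Y) i j)) \<le> (?D \<cdot> f) i j + (f \<cdot> ?D) i j"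
      by (cases "i \<in> S"; cases "j \<in> S"; cases "i \<in> T"; cases "j \<in> T")
        (auto simp: entry_diff entry_compress kproj_kmul kmul_kproj)
  qed
  have "?X ^ Suc n - ?Y ^ Suc n = (?X ^ n - ?Y ^ n) * ?Y + ?X ^ n * (?X - ?Y)"
    by (simp add: algebra_simps power_commutes)
  also have "dominated \<dots> (\<lambda>i j. ((\<lambda>i j. (\<Sum>k<n. (kpow f k \<cdot> ?D \<cdot> kpow f (n - k)) i j
                  + (kpow f (Suc k) \<cdot> ?D \<cdot> kpow f (n - Suc k)) i j)) \<cdot> f) i j
       + (kpow f n \<cdot> (\<lambda>i j. (?D \<cdot> f) i j + (f \<cdot> ?D) i j)) i j)"
    by (intro dominated_add dominated_mult Suc XY dominated_power dominated_compress A)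
  also have "\<dots> = (\<lambda>i j. (\<Sum>k<n. (kpow f k \<cdot> ?D \<cdot> kpow f (Suc n - k)) i j
                  + (kpow f (Suc k) \<cdot> ?D \<cdot> kpow f (Suc n - Suc k)) i j)
       + ((kpow f n \<cdot> ?D \<cdot> kpow f (Suc n - n)) i j + (kpow f (Suc n) \<cdot> ?D \<cdot> kpow f (Suc n - Suc n)) i j))"
  proof -
    have a: "kpow f k \<cdot> ?D \<cdot> kpow f (n - k) \<cdot> f = kpow f k \<cdot> ?D \<cdot> kpow f (Suc n - k)"
      and b: "kpow f (Suc k) \<cdot> ?D \<cdot> kpow f (n - Suc k) \<cdot> f = kpow f (Suc k) \<cdot> ?D \<cdot> kpow f (Suc n - Suc k)"
      if "k < n" for k
      using that Suc_diff_le[of k n] Suc_diff_le[of "Suc k" n] by (simp_all add: kmul_assoc)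
    have c: "kpow f n \<cdot> (?D \<cdot> f) = kpow f n \<cdot> ?D \<cdot> kpow f (Suc n - n)"
      "kpow f n \<cdot> (f \<cdot> ?D) = kpow f (Suc n) \<cdot> ?D \<cdot> kpow f (Suc n - Suc n)"
      by (simp_all add: kmul_assoc Suc_diff_le)
    have "(\<Sum>k<n. (kpow f k \<cdot> ?D \<cdot> kpow f (n - k) \<cdot> f) i j
            + (kpow f (Suc k) \<cdot> ?D \<cdot> kpow f (n - Suc k) \<cdot> f) i j)
        = (\<Sum>k<n. (kpow f k \<cdot> ?D \<cdot> kpow f (Suc n - k)) i j
            + (kpow f (Suc k) \<cdot> ?D \<cdot> kpow f (Suc n - Suc k)) i j)" for i j
      by (rule sum.cong[OF refl]) (simp only: lessThan_iff a b)
    then show ?thesis by (simp only: kmul_sum_left kmul_add_left kmul_add_right c)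
  qed
  finally show ?case by (simp only: sum.lessThan_Suc)
qed (simp add: dominated_def entry_zero)

text \<open>Splitting a word of length \<open>k + l\<close> at a visit to \<open>S - T\<close> is
  compatible with the factorials because 1/(k + l)! is at most 1/(k! l!), so two full exponential
  kernels appear. The factor 2 counts visits before and after a letter.\<close>

lemma dominated_exp_compress_diff:
  assumes A: "dominated A f" and T: "T \<subseteq> S"
  shows "dominated (exp (compress S A) - exp (compress T A))
    (\<lambda>i j. 2 * (kexp f \<cdot> kproj (S - T) \<cdot> kexp f) i j)"
proof (rule dominated_lim[OF tendsto_diff[OF exp_partial_tendsto exp_partial_tendsto]])
  fix N
  let ?D = "kproj (S - T)"
  let ?P = "\<lambda>n k i j. (kpow f k \<cdot> ?D \<cdot> kpow f (n - k)) i j + (kpow f (Suc k) \<cdot> ?D \<cdot> kpow f (n - Suc k)) i j"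
  define t where "t k l i j = ennreal (1 / fact k) * (ennreal (1 / fact l) * (kpow f k \<cdot> ?D \<cdot> kpow f l) i j)" for k l i j
  have t: "(\<lambda>i j. ennreal (1 / fact k) * kpow f k i j) \<cdot> ?D \<cdot> (\<lambda>i j. ennreal (1 / fact l) * kpow f l i j) = t k l" for k l
    by (simp only: kmul_scale_left kmul_scale_right t_def[abs_def] mult.left_commute)
  have step: "ennreal (1 / fact (k + l)) * (kpow f k \<cdot> ?D \<cdot> kpow f l) i j \<le> t k l i j" for k l i j
  proof -
    have "(fact k * fact l :: nat) \<le> fact (k + l)"
      by (rule dvd_imp_le[OF fact_fact_dvd_fact]) simp
    then have "(fact k * fact l :: real) \<le> fact (k + l)"
      by (metis of_nat_fact of_nat_le_iff of_nat_mult)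
    then have "1 / fact (k + l) \<le> (1 / fact k) * (1 / fact l :: real)"
      by (simp add: frac_le)
    then have "ennreal (1 / fact (k + l)) \<le> ennreal (1 / fact k) * ennreal (1 / fact l)"
      by (metis ennreal_leI ennreal_mult' fact_ge_zero zero_le_divide_1_iff)
    then show ?thesis
      unfolding t_def mult.assoc[symmetric] by (rule mult_right_mono) simp
  qed
  have sumt: "(\<Sum>k<N. \<Sum>l<N. t k l i j) \<le> (kexp f \<cdot> ?D \<cdot> kexp f) i j" for i j
  proof -
    have "(\<Sum>k<N. \<Sum>l<N. t k l i j) = (kexp_partial f N \<cdot> ?D \<cdot> kexp_partial f N) i j"
      unfolding kexp_partial_def[abs_def] kmul_sum_left kmul_sum_right t ..
    also have "\<dots> \<le> (kexp f \<cdot> ?D \<cdot> kexp f) i j"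
      using kmul_mono[OF kmul_mono[OF kexp_partial_le order_refl] kexp_partial_le, of f N ?D f N]
      by (simp add: le_fun_def)
    finally show ?thesis .
  qed
  have "exp_partial (compress S A) N - exp_partial (compress T A) N
      = (\<Sum>n<N. (1 / fact n) *\<^sub>R (compress S A ^ n - compress T A ^ n))"
    by (simp add: exp_partial_def sum_subtractf scaleR_right_diff_distrib)
  also have "dominated \<dots> (\<lambda>i j. \<Sum>n<N. ennreal \<bar>1 / fact n\<bar> * (\<Sum>k<n. ?P n k i j))"
    by (intro dominated_sum dominated_scaleR dominated_power_compress_diff A T)
  finally show "dominated (exp_partial (compress S A) N - exp_partial (compress T A) N)
      (\<lambda>i j. 2 * (kexp f \<cdot> ?D \<cdot> kexp f) i j)"
  proof (rule dominated_mono, unfold le_fun_def, intro allI)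
    fix i j
    let ?E = "(\<Sum>n<N. ennreal \<bar>1 / fact n\<bar> * (\<Sum>k<n. ?P n k i j))" and ?A = "(\<Sum>(n, k)\<in>Sigma {..<N} lessThan. t k (n - k) i j)"
      and ?B = "(\<Sum>(n, k)\<in>Sigma {..<N} lessThan. t (Suc k) (n - Suc k) i j)" and ?C = "(\<Sum>(k, l)\<in>{..<N} \<times> {..<N}. t k l i j)"
    have "?E
        \<le> (\<Sum>n<N. \<Sum>k<n. t k (n - k) i j + t (Suc k) (n - Suc k) i j)"
      unfolding sum_distrib_left
    proof (rule sum_mono, rule sum_mono)
      fix n k :: nat assume "k \<in> {..<n}"
      then show "ennreal \<bar>1 / fact n\<bar> * ?P n k i j
            \<le> t k (n - k) i j + t (Suc k) (n - Suc k) i j"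
        using step[of k "n - k" i j] step[of "Suc k" "n - Suc k" i j]
        by (simp add: distrib_left add_mono del: kpow.simps)
    qed
    also have "\<dots> = ?A
        + ?B"
      by (simp add: sum.distrib sum.Sigma)
    also have "\<dots> \<le> ?C + ?C"
    proof (rule add_mono)
      \<comment> \<open>The split \<open>(n, k)\<close> to \<open>(k, n - k)\<close> is injective
        into the square of side \<open>N\<close>; the same holds below for the split after the
        letter.\<close>
      have "?A
          = (\<Sum>(k, l)\<in>(\<lambda>(n, k). (k, n - k)) ` Sigma {..<N} lessThan. t k l i j)"
        by (subst sum.reindex) (auto simp: inj_on_def case_prod_unfold)
      also have "\<dots> \<le> ?C" by (rule sum_mono2) auto
      finally show "?A \<le> \<dots>" .
      have "?B
          = (\<Sum>(k, l)\<in>(\<lambda>(n, k). (Suc k, n - Suc k)) ` Sigma {..<N} lessThan. t k l i j)"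
        by (subst sum.reindex) (auto simp: inj_on_def case_prod_unfold)
      also have "\<dots> \<le> ?C" by (rule sum_mono2) auto
      finally show "?B \<le> \<dots>" .
    qed
    also have "\<dots> = 2 * (\<Sum>k<N. \<Sum>l<N. t k l i j)"
      by (simp only: sum.cartesian_product mult_2)
    also have "\<dots> \<le> 2 * (kexp f \<cdot> ?D \<cdot> kexp f) i j" by (rule mult_left_mono[OF sumt]) simp
    finally show "?E
        \<le> 2 * (kexp f \<cdot> ?D \<cdot> kexp f) i j" .
  qed
qed

lemma dominated_prod_list_exp:
  assumes "\<And>B. B \<in> set Bs \<Longrightarrow> dominated B f"
  shows "dominated (prod_list (map exp Bs)) (kpow (kexp f) (length Bs))"
  using assms
proof (induction Bs)
  case (Cons B Bs)
  have "dominated (exp B * prod_list (map exp Bs)) (kexp f \<cdot> kpow (kexp f) (length Bs))"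
    using Cons by (intro dominated_mult dominated_exp) auto
  then show ?case by (simp add: kpow_Suc_left)
qed (simp add: dominated_one)

text \<open>Used to pad all terms to a common exponent, since \<open>kexp f\<close> lies above the
  identity.\<close>

lemma kpow_mono_exponent:
  assumes "kproj UNIV \<le> f" "m \<le> n" shows "kpow f m \<le> kpow f n"
  using assms(2)
proof (induction rule: dec_induct)
  case (step n)
  have "kpow f n \<cdot> kproj UNIV \<le> kpow f n \<cdot> f" by (intro kmul_mono assms(1)) simp
  then show ?case using step by simp
qed simp

text \<open>Telescoping over the factors: each contributes one difference of exponentials with
  constant 2, and the neighbouring factors are padded to the full power, which gives
  \<open>2 * length Bs\<close>.\<close>

lemma dominated_prod_list_exp_compress_diff:
  assumes Bs: "\<And>B. B \<in> set Bs \<Longrightarrow> dominated B f" and T: "T \<subseteq> S"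
  shows "dominated (prod_list (map (\<lambda>B. exp (compress S B)) Bs) - prod_list (map (\<lambda>B. exp (compress T B)) Bs))
    (\<lambda>i j. ennreal (2 * length Bs) * (kpow (kexp f) (length Bs) \<cdot> kproj (S - T) \<cdot> kpow (kexp f) (length Bs)) i j)"
  using Bs
proof (induction Bs)
  case (Cons B Bs)
  let ?e = "kexp f" and ?m = "length Bs" and ?D = "kproj (S - T)"
  let ?U = "prod_list (map (\<lambda>B. exp (compress S B)) Bs)" and ?V = "prod_list (map (\<lambda>B. exp (compress T B)) Bs)"
  let ?K = "\<lambda>i j. (?e \<cdot> (\<lambda>i j. ennreal (2 * ?m) * (kpow ?e ?m \<cdot> ?D \<cdot> kpow ?e ?m) i j)) i j
      + ((\<lambda>i j. 2 * (?e \<cdot> ?D \<cdot> ?e) i j) \<cdot> kpow ?e ?m) i j"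
  have V: "dominated ?V (kpow ?e ?m)"
    using dominated_prod_list_exp[of "map (compress T) Bs" f] Cons.prems by (auto simp: o_def intro: dominated_compress)
  have B: "dominated B f" using Cons.prems by simp
  have "exp (compress S B) * ?U - exp (compress T B) * ?V
      = exp (compress S B) * (?U - ?V) + (exp (compress S B) - exp (compress T B)) * ?V"
    by (simp add: algebra_simps)
  also have "dominated \<dots> ?K"
    using Cons by (intro dominated_add dominated_mult dominated_exp dominated_compress B
        dominated_exp_compress_diff T V Cons.IH) auto
  finally have "dominated (exp (compress S B) * ?U - exp (compress T B) * ?V) \<dots>" .
  then have "dominated (exp (compress S B) * ?U - exp (compress T B) * ?V)
     (\<lambda>i j. ennreal (2 * Suc ?m) * (kpow ?e (Suc ?m) \<cdot> ?D \<cdot> kpow ?e (Suc ?m)) i j)"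
  proof (rule dominated_mono, unfold le_fun_def, intro allI)
    fix i j
    let ?G = "kpow ?e (Suc ?m) \<cdot> ?D \<cdot> kpow ?e (Suc ?m)"
    have 1: "?e \<cdot> (kpow ?e ?m \<cdot> ?D \<cdot> kpow ?e ?m) \<le> ?G"
    proof -
      have "?e \<cdot> (kpow ?e ?m \<cdot> ?D \<cdot> kpow ?e ?m) = kpow ?e (Suc ?m) \<cdot> ?D \<cdot> kpow ?e ?m"
        by (simp add: kpow_Suc_left flip: kmul_assoc)
      also have "\<dots> \<le> ?G" by (intro kmul_mono order_refl kpow_mono_exponent kproj_le_kexp) simp
      finally show ?thesis .
    qed
    have 2: "?e \<cdot> ?D \<cdot> ?e \<cdot> kpow ?e ?m \<le> ?G"
    proof -
      have "?e \<cdot> ?D \<cdot> ?e \<cdot> kpow ?e ?m = kpow ?e 1 \<cdot> ?D \<cdot> kpow ?e (Suc ?m)"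
        by (simp add: kmul_assoc kpow_Suc_left)
      also have "\<dots> \<le> ?G" by (intro kmul_mono order_refl kpow_mono_exponent kproj_le_kexp) simp
      finally show ?thesis .
    qed
    have "?K i j
      \<le> ennreal (2 * ?m) * ?G i j + 2 * ?G i j"
      unfolding kmul_scale_left kmul_scale_right
      using 1 2 by (intro add_mono mult_left_mono) (auto simp: le_fun_def)
    also have "\<dots> = (ennreal (2 * ?m) + ennreal 2) * ?G i j" by (simp add: distrib_right)
    finally have le: "?K i j \<le> (ennreal (2 * ?m) + ennreal 2) * ?G i j" .
    have "ennreal (2 * ?m) + ennreal 2 = ennreal (real (2 * ?m) + 2)" by (rule ennreal_plus[symmetric]) simp_all
    also have "\<dots> = ennreal (2 * Suc ?m)" by (rule arg_cong[of _ _ ennreal]) simp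
    finally have "ennreal (2 * ?m) + ennreal 2 = ennreal (2 * Suc ?m)" .
    with le show "?K i j \<le> ennreal (2 * Suc ?m) * ?G i j"
      by (simp only:)
  qed
  then show ?case by (simp del: kpow.simps)
qed (simp add: dominated_def entry_zero)

section \<open>Finite sections\<close>

definition sect :: "int \<Rightarrow> nat \<Rightarrow> int ell2_op \<Rightarrow> complex mat" where
  "sect n N X = mat N N (\<lambda>(i, j). entry X (n + int i) (n + int j))"

abbreviation window :: "int \<Rightarrow> nat \<Rightarrow> int set" where
  "window n N \<equiv> {n..<n + int N}"

lemma sect_carrier [simp]: "sect n N X \<in> carrier_mat N N" "dim_row (sect n N X) = N" "dim_col (sect n N X) = N"
  by (simp_all add: sect_def)

lemma det_sect: "det (sect n N X) = leibniz_det {..<N} (\<lambda>i j. entry X (n + int i) (n + int j))"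
  unfolding sect_def by (rule det_mat_eq_leibniz_det)

lemma entry_mult_proj_op_mult:
  assumes "finite S" shows "entry (X * proj_op S * Y) i j = (\<Sum>k\<in>S. entry X i k * entry Y k j)"
proof (rule has_sum_unique[OF has_sum_entry_mult])
  show "((\<lambda>k. entry (X * proj_op S) i k * entry Y k j) has_sum (\<Sum>k\<in>S. entry X i k * entry Y k j)) UNIV"
    by (rule has_sum_finite_neutralI[of S]) (use assms in \<open>auto simp: entry_mult_proj_op\<close>)
qed

lemma sum_window: "(\<Sum>k\<in>window n N. f k) = (\<Sum>i<N. f (n + int i))"
  by (rule sum.reindex_bij_witness[of _ "\<lambda>i. n + int i" "\<lambda>k. nat (k - n)"]) auto

lemma sect_mult: "sect n N (X * proj_op (window n N) * Y) = sect n N X * sect n N Y"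
proof (rule eq_matI)
  fix i j assume "i < dim_row (sect n N X * sect n N Y)" "j < dim_col (sect n N X * sect n N Y)"
  then show "sect n N (X * proj_op (window n N) * Y) $$ (i, j) = (sect n N X * sect n N Y) $$ (i, j)"
    by (simp add: sect_def entry_mult_proj_op_mult sum_window scalar_prod_def atLeast0LessThan)
qed simp_all

lemma sect_cong:
  assumes "\<And>i j. i \<in> window n N \<Longrightarrow> j \<in> window n N \<Longrightarrow> entry X i j = entry Y i j"
  shows "sect n N X = sect n N Y"
  by (rule eq_matI) (use assms in \<open>auto simp: sect_def\<close>)

lemma sect_mult_commute:
  assumes "proj_op (window n N) * Y = Y * proj_op (window n N)"
  shows "sect n N (X * Y) = sect n N X * sect n N Y"
proof -
  have "sect n N (X * Y) = sect n N (X * Y * proj_op (window n N))"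
    by (rule sect_cong) (simp add: entry_mult_proj_op)
  also have "X * Y * proj_op (window n N) = X * proj_op (window n N) * Y"
    by (simp add: mult.assoc assms)
  finally show ?thesis by (simp only: sect_mult)
qed

lemma sect_one: "sect n N 1 = 1\<^sub>m N"
  by (rule eq_matI) (auto simp: sect_def entry_one)

text \<open>Jacobi's identity for complementary minors. If \<open>?U\<close> is \<open>B\<close>
  with its first block column replaced by that of the identity, then \<open>A * ?U\<close> has
  blocks \<open>a\<close>, 0, \<open>c\<close>, 1; taking determinants gives the claim.\<close>

lemma det_upper_left_block:
  fixes A B :: "'a::field mat"
  assumes A: "A = four_block_mat a b c d" and B: "B = four_block_mat a' b' c' d'"
    and car [simp]: "a \<in> carrier_mat N N" "b \<in> carrier_mat N M" "c \<in> carrier_mat M N" "d \<in> carrier_mat M M"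
      "a' \<in> carrier_mat N N" "b' \<in> carrier_mat N M" "c' \<in> carrier_mat M N" "d' \<in> carrier_mat M M"
    and AB: "A * B = 1\<^sub>m (N + M)"
  shows "det a = det A * det d'"
proof -
  note [simp] = car[THEN carrier_matD(1)] car[THEN carrier_matD(2)]
  let ?U = "four_block_mat (1\<^sub>m N) b' (0\<^sub>m M N) d'"
  have "A * B = four_block_mat (a * a' + b * c') (a * b' + b * d') (c * a' + d * c') (c * b' + d * d')"
    unfolding A B by (rule mult_four_block_mat[OF car])
  then have one: "four_block_mat (a * a' + b * c') (a * b' + b * d') (c * a' + d * c') (c * b' + d * d')
      = four_block_mat (1\<^sub>m N) (0\<^sub>m N M) (0\<^sub>m M N) (1\<^sub>m M)"
    using AB by simp
  have ur: "a * b' + b * d' = 0\<^sub>m N M"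
  proof (rule eq_matI)
    fix i j assume "i < dim_row (0\<^sub>m N M :: 'a mat)" "j < dim_col (0\<^sub>m N M :: 'a mat)"
    then show "(a * b' + b * d') $$ (i, j) = 0\<^sub>m N M $$ (i, j)"
      using arg_cong[OF one, of "\<lambda>X. X $$ (i, N + j)"] by (simp add: index_mat_four_block)
  qed auto
  have lr: "c * b' + d * d' = 1\<^sub>m M"
  proof (rule eq_matI)
    fix i j assume "i < dim_row (1\<^sub>m M :: 'a mat)" "j < dim_col (1\<^sub>m M :: 'a mat)"
    then show "(c * b' + d * d') $$ (i, j) = 1\<^sub>m M $$ (i, j)"
      using arg_cong[OF one, of "\<lambda>X. X $$ (N + i, N + j)"] by (simp add: index_mat_four_block)
  qed auto
  have "A * ?U = four_block_mat (a * 1\<^sub>m N + b * 0\<^sub>m M N) (a * b' + b * d') (c * 1\<^sub>m N + d * 0\<^sub>m M N) (c * b' + d * d')"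
    unfolding A by (rule mult_four_block_mat[OF car(1-4) _ car(6) _ car(8)]) auto
  also have "a * 1\<^sub>m N + b * 0\<^sub>m M N = a"
    by (subst right_mult_one_mat[of a N N], simp, subst right_mult_zero_mat[of b N M], simp, rule right_add_zero_mat, simp)
  also have "c * 1\<^sub>m N + d * 0\<^sub>m M N = c"
    by (subst right_mult_one_mat[of c M N], simp, subst right_mult_zero_mat[of d M M], simp, rule right_add_zero_mat, simp)
  finally have "det (A * ?U) = det (four_block_mat a (0\<^sub>m N M) c (1\<^sub>m M))" by (simp only: ur lr)
  also have "\<dots> = det a" by (subst det_four_block_mat_upper_right_zero[of _ N _ M]) auto
  finally have "det (A * ?U) = det a" .
  moreover have "det (A * ?U) = det A * det ?U"
    by (rule det_mult[of _ "N + M"]) (auto simp: A)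
  moreover have "det ?U = det d'" by (subst det_four_block_mat_lower_left_zero[of _ N _ M]) auto
  ultimately show ?thesis by simp
qed

lemma det_sect_jacobi:
  assumes "sect n (N + M) X * sect n (N + M) Y = 1\<^sub>m (N + M)"
  shows "det (sect n N X) = det (sect n (N + M) X) * det (sect (n + int N) M Y)"
proof (rule det_upper_left_block[OF _ _ _ _ _ _ _ _ _ _ assms])
  let ?b = "\<lambda>X. mat N M (\<lambda>(i, j). entry X (n + int i) (n + int N + int j))"
    and ?c = "\<lambda>X. mat M N (\<lambda>(i, j). entry X (n + int N + int i) (n + int j))"
  show "sect n (N + M) X = four_block_mat (sect n N X) (?b X) (?c X) (sect (n + int N) M X)"
    "sect n (N + M) Y = four_block_mat (sect n N Y) (?b Y) (?c Y) (sect (n + int N) M Y)"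
    by (rule eq_matI; auto simp: sect_def four_block_mat_def Let_def of_nat_diff add.assoc)+
qed auto

section \<open>Exponentials of operators and the determinant of an exponential\<close>

lemma exp_eqI:
  assumes f: "bounded_linear f" and "\<And>n. f (X ^ n) = Z n" "\<And>n. Z n = g (Y ^ n)" and g: "bounded_linear g"
  shows "f (exp X) = g (exp Y)"
proof (rule LIMSEQ_unique)
  show "(\<lambda>N. f (exp_partial X N)) \<longlonglongrightarrow> f (exp X)"
    by (rule bounded_linear.tendsto[OF f exp_partial_tendsto])
  have "f (exp_partial X N) = g (exp_partial Y N)" for N
    unfolding exp_partial_def
    using assms by (simp add: linear_sum[OF bounded_linear.linear] linear_scale[OF bounded_linear.linear])
  then show "(\<lambda>N. f (exp_partial X N)) \<longlonglongrightarrow> g (exp Y)"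
    using bounded_linear.tendsto[OF g exp_partial_tendsto[of Y]] by simp
qed

lemma exp_commute:
  fixes X Y :: "'a::{real_normed_algebra_1,banach}"
  assumes "Y * X = X * Y" shows "Y * exp X = exp X * Y"
proof (rule exp_eqI[where f = "\<lambda>Z. Y * Z" and g = "\<lambda>Z. Z * Y", OF bounded_linear_mult_right _ refl bounded_linear_mult_left])
  show "Y * X ^ n = X ^ n * Y" for n
    by (induction n) (simp_all add: mult.assoc[symmetric] assms, simp add: mult.assoc)
qed

lemma exp_mult_minus: "exp X * exp (- X) = (1 :: 'a::{real_normed_algebra_1,banach})"
  using exp_add_commuting[of X "- X"] by simp

lemma proj_op_idem [simp]: "proj_op S * proj_op S = proj_op S"
  by (simp add: proj_op_mult_proj_op)

lemma proj_op_idem_left [simp]: "proj_op S * (proj_op S * X) = proj_op S * X"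
  by (simp add: mult.assoc[symmetric])

lemma proj_op_exp_compress: "proj_op S * exp (compress S B) = exp (compress S B) * proj_op S"
  by (rule exp_commute) (simp add: compress_def mult.assoc)

text \<open>If \<open>a\<close> is moved, so is its image, by injectivity. Hence removing one factor
  from a Leibniz product at the identity matrix still leaves a zero unless the permutation is the
  identity.\<close>

lemma bij_moves_two:
  assumes "p permutes S" "p \<noteq> id"
  obtains a b where "a \<in> S" "b \<in> S" "a \<noteq> b" "p a \<noteq> a" "p b \<noteq> b"
proof -
  obtain a where a: "p a \<noteq> a" using assms(2) by (auto simp: fun_eq_iff)
  have "p (p a) \<noteq> p a" using a permutes_inj[OF assms(1)] by (auto dest: injD)
  with a that[of a "p a"] permutes_not_in[OF assms(1)] show thesis by metis
qed

text \<open>The identity det exp = exp tr, by a differential equation: \<open>g t\<close>, the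
  determinant of the section of exp(tC), is multiplicative in \<open>t\<close> and has derivative
  the trace at 0.\<close>

lemma det_sect_exp_compress:
  "det (sect n N (exp (compress (window n N) B))) = exp (\<Sum>i<N. entry B (n + int i) (n + int i))"
proof -
  define C where "C = compress (window n N) B"
  define g where "g t = det (sect n N (exp (t *\<^sub>R C)))" for t :: real
  define c where "c = (\<Sum>i<N. entry B (n + int i) (n + int i))"
  have com: "proj_op (window n N) * exp (t *\<^sub>R C) = exp (t *\<^sub>R C) * proj_op (window n N)" for t
    by (rule exp_commute) (simp add: C_def compress_def mult.assoc)
  have mult: "g (s + t) = g s * g t" for s t
  proof -
    have "exp ((s + t) *\<^sub>R C) = exp (s *\<^sub>R C) * exp (t *\<^sub>R C)"
      unfolding scaleR_left_distrib by (rule exp_add_commuting) simp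
    then show ?thesis unfolding g_def by (simp add: sect_mult_commute[OF com] det_mult[of _ N])
  qed
  have g0: "g 0 = 1" by (simp add: g_def sect_one)
  let ?u = "\<lambda>i j t. entry (exp (t *\<^sub>R C)) (n + int i) (n + int j)"
  let ?C = "\<lambda>i j. entry C (n + int i) (n + int j)"
  have du: "(?u i j has_derivative (\<lambda>h. h *\<^sub>R ?C i j)) (at 0)" for i j
  proof -
    have "((\<lambda>t. exp (t *\<^sub>R C)) has_vector_derivative exp (0 *\<^sub>R C) * C) (at 0)"
      by (rule exp_scaleR_has_vector_derivative_right)
    from bounded_linear.has_vector_derivative[OF bounded_linear_entry this, of "n + int i" "n + int j"]
    show ?thesis by (simp add: has_vector_derivative_def)
  qed
  let ?T = "\<lambda>h p. \<Sum>i<N. h *\<^sub>R ?C i (p i) * (\<Prod>j\<in>{..<N} - {i}. ?u j (p j) 0)"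
  have "(g has_derivative (\<lambda>h. \<Sum>p | p permutes {..<N}. of_int (sign p) * ?T h p)) (at 0)"
    unfolding g_def det_sect leibniz_det_def
    by (intro has_derivative_sum has_derivative_mult_right has_derivative_prod du)
  also have "(\<lambda>h. \<Sum>p | p permutes {..<N}. of_int (sign p) * ?T h p) = (\<lambda>h. h *\<^sub>R c)"
  proof
    fix h :: real
    have "(\<Sum>p | p permutes {..<N}. of_int (sign p) * ?T h p)
      = (\<Sum>p\<in>{id}. of_int (sign p) * ?T h p)"
    proof (rule sum.mono_neutral_right)
      show "\<forall>p\<in>{p. p permutes {..<N}} - {id}. of_int (sign p) * ?T h p = 0"
      proof
        fix p assume "p \<in> {p. p permutes {..<N}} - {id}"
        then obtain a b where ab: "a < N" "b < N" "a \<noteq> b" "p a \<noteq> a" "p b \<noteq> b"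
          by (auto elim: bij_moves_two)
        \<comment> \<open>Of two moved points at least one differs from \<open>i\<close>; its factor
          is an off-diagonal entry of exp(0) = 1.\<close>
        have z: "(\<Prod>j\<in>{..<N} - {i}. ?u j (p j) 0) = 0" for i
          using ab by (intro prod_zero bexI[of _ "if i = a then b else a"]) (auto simp: entry_one)
        show "of_int (sign p) * ?T h p = 0"
          by (simp only: z mult_zero_right sum.neutral_const)
      qed
    qed (auto simp: finite_permutations permutes_id)
    also have "\<dots> = h *\<^sub>R c"
      by (simp add: entry_one c_def C_def entry_compress scaleR_sum_right)
    finally show "(\<Sum>p | p permutes {..<N}. of_int (sign p) * ?T h p) = h *\<^sub>R c" .
  qed
  finally have g0': "(g has_vector_derivative c) (at 0)" by (simp add: has_vector_derivative_def)
  \<comment> \<open>Multiplicativity, \<open>g s = g t * g (s - t)\<close>, transports the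
    derivative from 0 to \<open>t\<close>.\<close>
  have g': "(g has_vector_derivative g t * c) (at t)" for t
  proof -
    have "((\<lambda>s. s - t) has_vector_derivative 1) (at t)" by (auto intro!: derivative_eq_intros)
    from vector_diff_chain_at[OF this, of g c] g0'
    have "((\<lambda>s. g (s - t)) has_vector_derivative c) (at t)" by (simp add: o_def)
    from has_vector_derivative_mult_right[OF this, of "g t"]
    have "((\<lambda>s. g t * g (s - t)) has_vector_derivative g t * c) (at t)" .
    moreover have "g t * g (s - t) = g s" for s using mult[of t "s - t"] by simp
    ultimately show ?thesis by simp
  qed
  \<comment> \<open>The quotient of \<open>g\<close> by the expected exponential; its derivative
    vanishes.\<close>
  define h where "h t = g t * exp (t *\<^sub>R (- c))" for t
  have "(h has_vector_derivative 0) (at t)" for t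
  proof -
    have "((\<lambda>t. exp (t *\<^sub>R (- c))) has_vector_derivative exp (t *\<^sub>R (- c)) * (- c)) (at t)"
      by (rule exp_scaleR_has_vector_derivative_right)
    from has_vector_derivative_mult[OF g' this] show ?thesis
      by (simp add: h_def[abs_def] algebra_simps)
  qed
  then have "h 1 = h 0"
    using has_vector_derivative_zero_constant[of UNIV h] by (metis UNIV_I convex_UNIV)
  then have "g 1 * exp (- c) = 1" using g0 by (simp add: h_def)
  then have "g 1 = exp c" by (simp add: exp_minus field_simps)
  then show ?thesis by (simp add: g_def C_def c_def)
qed

section \<open>Products of exponentials of compressions\<close>

definition exp_prod :: "int set \<Rightarrow> int ell2_op list \<Rightarrow> int ell2_op" where
  "exp_prod S As = prod_list (map (\<lambda>B. exp (compress S B)) As)"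

definition exp_prod_inv :: "int set \<Rightarrow> int ell2_op list \<Rightarrow> int ell2_op" where
  "exp_prod_inv S As = prod_list (map (\<lambda>B. exp (- compress S B)) (rev As))"

text \<open>The inverse is the same construction for the reversed list of negated operators, so
  every property of \<open>exp_prod\<close> carries over.\<close>

lemma exp_prod_inv_eq: "exp_prod_inv S As = exp_prod S (rev (map uminus As))"
proof -
  have "- compress S B = compress S (- B)" for B by (simp add: compress_def)
  then show ?thesis by (simp add: exp_prod_inv_def exp_prod_def rev_map o_def)
qed

lemma exp_prod_mult_inv: "exp_prod S As * exp_prod_inv S As = 1"
proof (induction As)
  case (Cons B As)
  have "exp_prod S (B # As) * exp_prod_inv S (B # As)
      = exp (compress S B) * (exp_prod S As * exp_prod_inv S As) * exp (- compress S B)"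
    by (simp add: exp_prod_def exp_prod_inv_def mult.assoc)
  then show ?case using Cons by (simp add: exp_mult_minus)
qed (simp add: exp_prod_def exp_prod_inv_def)

lemma exp_prod_inv_mult: "exp_prod_inv S As * exp_prod S As = 1"
  using exp_prod_mult_inv[of S "rev (map uminus As)"]
  unfolding exp_prod_inv_eq by (simp add: rev_map o_def)

lemma proj_op_exp_prod: "proj_op S * exp_prod S As = exp_prod S As * proj_op S"
proof (induction As)
  case (Cons B As)
  have "proj_op S * exp_prod S (B # As) = (proj_op S * exp (compress S B)) * exp_prod S As"
    by (simp add: exp_prod_def mult.assoc)
  also have "\<dots> = exp (compress S B) * (proj_op S * exp_prod S As)"
    by (simp add: proj_op_exp_compress mult.assoc)
  also have "\<dots> = exp_prod S (B # As) * proj_op S" using Cons by (simp add: exp_prod_def mult.assoc)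
  finally show ?case .
qed (simp add: exp_prod_def)

lemma proj_op_exp_prod_inv: "proj_op S * exp_prod_inv S As = exp_prod_inv S As * proj_op S"
  unfolding exp_prod_inv_eq by (rule proj_op_exp_prod)

lemma exp_prod_proj_inv: "exp_prod S As * proj_op S * exp_prod_inv S As = proj_op S"
  by (simp add: proj_op_exp_prod[symmetric] mult.assoc exp_prod_mult_inv)

lemma exp_prod_inv_proj: "exp_prod_inv S As * proj_op S * exp_prod S As = proj_op S"
  by (simp add: proj_op_exp_prod_inv[symmetric] mult.assoc exp_prod_inv_mult)

lemma det_sect_exp_prod:
  "det (sect n N (exp_prod (window n N) As)) = exp (\<Sum>i<N. entry (sum_list As) (n + int i) (n + int i))"
proof (induction As)
  case (Cons B As)
  have "sect n N (exp_prod (window n N) (B # As))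
      = sect n N (exp (compress (window n N) B)) * sect n N (exp_prod (window n N) As)"
    using sect_mult_commute[OF proj_op_exp_prod] by (simp add: exp_prod_def)
  then show ?case using Cons
    by (simp add: det_mult[of _ N] det_sect_exp_compress entry_add sum.distrib exp_add)
qed (simp add: exp_prod_def sect_one entry_zero)

lemma sum_list_rev_uminus: "sum_list (rev (map uminus As)) = - sum_list (As :: 'a::ab_group_add list)"
  by (induction As) simp_all

lemma det_sect_exp_prod_inv:
  "det (sect n N (exp_prod_inv (window n N) As)) = exp (- (\<Sum>i<N. entry (sum_list As) (n + int i) (n + int i)))"
  unfolding exp_prod_inv_eq det_sect_exp_prod sum_list_rev_uminus by (simp add: entry_minus sum_negf)

text \<open>Jacobi's identity, normalised by the determinants of the exponentials, which cancel because the trace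
  is additive.\<close>

lemma det_sect_duality:
  assumes W: "W = window n (N + M)" and J: "J = window n N" and J': "J' = window (n + int N) M"
  shows "det (sect n N (exp_prod W As * proj_op J * exp_prod_inv J As))
    = det (sect (n + int N) M (exp_prod J' As * proj_op J' * exp_prod_inv W As))"
proof -
  let ?tr = "\<lambda>n N. \<Sum>i<N. entry (sum_list As) (n + int i) (n + int i)"
  have "sect n (N + M) (exp_prod W As) * sect n (N + M) (exp_prod_inv W As)
      = sect n (N + M) (exp_prod W As * proj_op W * exp_prod_inv W As)"
    by (simp only: sect_mult W)
  also have "\<dots> = 1\<^sub>m (N + M)"
    unfolding exp_prod_proj_inv unfolding W by (rule eq_matI) (auto simp: sect_def entry_proj_op)
  finally have jac: "det (sect n N (exp_prod W As))
      = exp (?tr n (N + M)) * det (sect (n + int N) M (exp_prod_inv W As))"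
    using det_sect_jacobi det_sect_exp_prod[of n "N + M"] by (simp add: W)
  have tr: "?tr n (N + M) = ?tr n N + ?tr (n + int N) M"
  proof -
    have u: "{..<N + M} = {..<N} \<union> {N..<N + M}" by auto
    have "?tr n (N + M) = ?tr n N + (\<Sum>i\<in>{N..<N + M}. entry (sum_list As) (n + int i) (n + int i))"
      unfolding u by (rule sum.union_disjoint) auto
    also have "(\<Sum>i\<in>{N..<N + M}. entry (sum_list As) (n + int i) (n + int i)) = ?tr (n + int N) M"
      by (rule sum.reindex_bij_witness[of _ "\<lambda>i. i + N" "\<lambda>i. i - N"]) (auto simp: algebra_simps)
    finally show ?thesis .
  qed
  have "det (sect n N (exp_prod W As * proj_op J * exp_prod_inv J As))
      = det (sect n N (exp_prod W As)) * exp (- ?tr n N)"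
    unfolding J sect_mult by (subst det_mult[of _ N]) (simp_all add: det_sect_exp_prod_inv)
  also have "\<dots> = exp (?tr (n + int N) M) * det (sect (n + int N) M (exp_prod_inv W As))"
    by (simp add: jac tr exp_add exp_minus)
  also have "\<dots> = det (sect (n + int N) M (exp_prod J' As * proj_op J' * exp_prod_inv W As))"
    unfolding J' sect_mult by (subst det_mult[of _ M]) (simp_all add: det_sect_exp_prod)
  finally show ?thesis .
qed

section \<open>Operators with absolutely summable Fourier coefficients\<close>

lemma summable_on_if_esum_finite:
  fixes f :: "'a \<Rightarrow> real"
  assumes "esum (\<lambda>x. ennreal (f x)) < \<infinity>" "\<And>x. 0 \<le> f x"
  shows "f summable_on UNIV"
proof (rule nonneg_bdd_above_summable_on)
  obtain B where B: "esum (\<lambda>x. ennreal (f x)) = ennreal B" "B \<ge> 0"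
    using assms(1) by (cases "esum (\<lambda>x. ennreal (f x))") auto
  show "bdd_above (sum f ` {F. F \<subseteq> UNIV \<and> finite F})"
  proof (rule bdd_aboveI[of _ B], clarify)
    fix F :: "'a set" assume F: "finite F"
    have "ennreal (sum f F) = (\<Sum>x\<in>F. ennreal (f x))" using assms(2) by simp
    also have "\<dots> \<le> ennreal B" using sum_le_esum[OF F, of "\<lambda>x. ennreal (f x)"] B by simp
    finally show "sum f F \<le> B" using B by simp
  qed
qed (use assms in auto)

lemma norm_op_leI:
  assumes "0 \<le> b" "\<And>x. norm (op_apply A x) \<le> b * norm x"
  shows "norm A \<le> b"
  unfolding norm_ell2_op.rep_eq by (rule onorm_bound) (rule assms)+

lemma op_apply_cscale_op: "op_apply (cscale_op c A) x = cscale c (op_apply A x)"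
  by (simp add: cscale_op.rep_eq)

lemma entry_cscale_op: "entry (cscale_op c A) i j = c * entry A i j"
  by (simp add: entry_def op_apply_cscale_op cscale.rep_eq)

lemma norm_cscale_op_le: "norm (cscale_op c A) \<le> cmod c * norm A"
proof (rule norm_op_leI)
  show "0 \<le> cmod c * norm A" by simp
  fix x show "norm (op_apply (cscale_op c A) x) \<le> cmod c * norm A * norm x"
    using mult_left_mono[OF norm_op_apply[of A x], of "cmod c"]
    by (simp add: op_apply_cscale_op norm_cscale mult.assoc)
qed

lemma bounded_linear_cscale_op: "bounded_linear (\<lambda>c. cscale_op c A)"
proof (rule bounded_linear_intro)
  show "cscale_op (c + d) A = cscale_op c A + cscale_op d A" for c d
    by (rule op_eqI) (simp add: entry_cscale_op entry_add distrib_right)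
  show "cscale_op (r *\<^sub>R c) A = r *\<^sub>R cscale_op c A" for r c
    by (rule op_eqI) (simp add: entry_cscale_op entry_scaleR)
qed (rule norm_cscale_op_le)

lemma cscale_op_mult: "cscale_op c A * cscale_op d B = cscale_op (c * d) (A * B)"
  by transfer (simp add: cscale_cscale)

lemma echar_add_int: "echar x (i + m) = echar x i * echar x m"
  by transfer (simp add: algebra_simps flip: exp_add)

section \<open>The monomials e_xi U_n and absolutely convergent expansions in them\<close>

definition mono_op :: "int \<times> real_mod_int \<Rightarrow> int ell2_op" where
  "mono_op p = mult_op (echar (snd p)) * shift_op (fst p)"

lemma entry_mono_op: "entry (mono_op p) i j = (if j = i - fst p then echar (snd p) i else 0)"
proof -
  have "bounded (range (echar (snd p)))" unfolding bounded_iff by (intro exI[of _ 1]) (auto simp: norm_echar)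
  then have m: "entry (mult_op (echar (snd p))) i k = (if i = k then echar (snd p) i else 0)" for k
    by (rule entry_mult_op)
  have s: "entry (shift_op (fst p)) k j = (if j = k - fst p then 1 else 0)" for k
    by (simp add: entry_def coord_shift_op basis_vec.rep_eq eq_commute)
  have "((\<lambda>k. entry (mult_op (echar (snd p))) i k * entry (shift_op (fst p)) k j)
      has_sum (if j = i - fst p then echar (snd p) i else 0)) UNIV"
    by (rule has_sum_finite_neutralI[of "{i}"]) (auto simp: m s)
  from has_sum_unique[OF has_sum_entry_mult this] show ?thesis by (simp add: mono_op_def)
qed

text \<open>Moving U_n past e_xi costs the scalar e_xi(-n). Up to unimodular scalars the monomials
  therefore multiply like the group of indices.\<close>

lemma mono_op_mult:
  "mono_op p * mono_op q = cscale_op (echar (snd q) (- fst p)) (mono_op (p + q))"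
proof (rule op_eqI)
  fix i j
  have "((\<lambda>k. entry (mono_op p) i k * entry (mono_op q) k j) has_sum
      entry (mono_op p) i (i - fst p) * entry (mono_op q) (i - fst p) j) UNIV"
    by (rule has_sum_finite_neutralI[of "{i - fst p}"]) (auto simp: entry_mono_op)
  from has_sum_unique[OF has_sum_entry_mult this]
  show "entry (mono_op p * mono_op q) i j = entry (cscale_op (echar (snd q) (- fst p)) (mono_op (p + q))) i j"
    using echar_add_int[of "snd q" i "- fst p"]
    by (simp add: entry_mono_op entry_cscale_op echar_add algebra_simps)
qed

lemma norm_mono_op_le: "norm (mono_op p) \<le> 1"
proof (rule norm_op_leI)
  fix x :: "int ell2"
  have c: "coord (op_apply (mono_op p) x) i = echar (snd p) i * coord x (i - fst p)" for i
  proof -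
    have "((\<lambda>k. entry (mono_op p) i k * coord x k) has_sum echar (snd p) i * coord x (i - fst p)) UNIV"
      by (rule has_sum_finite_neutralI[of "{i - fst p}"]) (auto simp: entry_mono_op)
    from has_sum_unique[OF has_sum_coord_op_apply this] show ?thesis .
  qed
  show "norm (op_apply (mono_op p) x) \<le> 1 * norm x"
    by (rule norm_ell2_leI) (use shift_bound[of x "fst p"] in \<open>simp add: c norm_mult norm_echar\<close>)
qed simp

definition mass :: "(int \<times> real_mod_int \<Rightarrow> complex) \<Rightarrow> ennreal" where
  "mass c = esum (\<lambda>p. ennreal (cmod (c p)))"

text \<open>Twists have to be computed for \<open>A\<close> and its inverse as well as for the given
  operators; this class of expansions is preserved by products and exponentials and determines
  \<open>twist\<close>.\<close>

definition fourier_rep :: "real_mod_int set \<Rightarrow> (int \<times> real_mod_int \<Rightarrow> complex) \<Rightarrow> int ell2_op \<Rightarrow> bool" where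
  "fourier_rep \<Xi> c A \<longleftrightarrow> (\<forall>p. snd p \<notin> \<Xi> \<longrightarrow> c p = 0) \<and> mass c < \<infinity> \<and>
     ((\<lambda>p. cscale_op (c p) (mono_op p)) has_sum A) UNIV"

lemma summable_on_mono_op:
  assumes "esum (\<lambda>x. ennreal (cmod (d x))) < \<infinity>"
  shows "(\<lambda>x. cscale_op (d x) (mono_op (f x))) summable_on UNIV"
proof (rule abs_summable_summable, rule Infinite_Sum.abs_summable_on_comparison_test')
  show "(\<lambda>x. cmod (d x)) summable_on UNIV" by (rule summable_on_if_esum_finite[OF assms]) simp
  show "norm (cscale_op (d x) (mono_op (f x))) \<le> cmod (d x)" for x
    using norm_cscale_op_le[of "d x" "mono_op (f x)"] mult_left_mono[OF norm_mono_op_le[of "f x"], of "cmod (d x)"]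
    by simp
qed

lemma fourier_repD:
  assumes "fourier_rep \<Xi> c A"
  shows "c p \<noteq> 0 \<Longrightarrow> snd p \<in> \<Xi>" "mass c < \<infinity>" "((\<lambda>p. cscale_op (c p) (mono_op p)) has_sum A) UNIV"
  using assms unfolding fourier_rep_def by blast+

text \<open>A series in which monomials repeat is regrouped along the fibres of \<open>f\<close>;
  the triangle inequality in each fibre bounds the mass.\<close>

lemma fourier_rep_collect:
  assumes d: "esum (\<lambda>x. ennreal (cmod (d x))) < \<infinity>" and supp: "\<And>x. d x \<noteq> 0 \<Longrightarrow> snd (f x) \<in> \<Xi>"
    and A: "((\<lambda>x. cscale_op (d x) (mono_op (f x))) has_sum A) UNIV"
  obtains c where "fourier_rep \<Xi> c A" "mass c \<le> esum (\<lambda>x. ennreal (cmod (d x)))"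
proof
  let ?B = "\<lambda>p. {x. f x = p}"
  define c where "c p = (\<Sum>\<^sub>\<infinity>x\<in>?B p. d x)" for p
  have sd: "d summable_on B" for B
  proof (rule abs_summable_summable, rule summable_on_subset_banach)
    show "(\<lambda>x. cmod (d x)) summable_on UNIV" by (rule summable_on_if_esum_finite[OF d]) simp
  qed simp
  have hd: "(d has_sum c p) (?B p)" for p unfolding c_def by (rule has_sum_infsum[OF sd])
  have cm: "ennreal (cmod (c p)) \<le> esum (\<lambda>x. if f x = p then ennreal (cmod (d x)) else 0)" for p
  proof -
    have "((\<lambda>x. if f x = p then d x else 0) has_sum c p) UNIV"
      using hd[of p] by (rule has_sum_cong_neutral[THEN iffD1, rotated -1]) auto
    from has_sum_norm_le_esum[OF this] show ?thesis by (simp add: if_distrib cong: if_cong)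
  qed
  have "mass c \<le> esum (\<lambda>p. esum (\<lambda>x. if f x = p then ennreal (cmod (d x)) else 0))"
    unfolding mass_def by (rule esum_mono[OF cm])
  also have "\<dots> = esum (\<lambda>x. esum (\<lambda>p. if f x = p then ennreal (cmod (d x)) else 0))" by (rule esum_swap)
  also have "\<dots> = esum (\<lambda>x. ennreal (cmod (d x)))"
    by (rule esum_cong, subst esum_finite_support[of "{f _}"]) auto
  finally show m: "mass c \<le> esum (\<lambda>x. ennreal (cmod (d x)))" .
  have "((\<lambda>p. cscale_op (c p) (mono_op p)) has_sum A) UNIV"
  proof (rule has_sum_SigmaD)
    have "bij_betw snd (Sigma UNIV ?B) UNIV"
      by (rule bij_betwI[of _ _ _ "\<lambda>x. (f x, x)"]) auto
    from has_sum_reindex_bij_betw[OF this, of "\<lambda>x. cscale_op (d x) (mono_op (f x))" A] A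
    show "((\<lambda>z. cscale_op (d (snd z)) (mono_op (f (snd z)))) has_sum A) (Sigma UNIV ?B)" by simp
    show "((\<lambda>x. cscale_op (d (snd (p, x))) (mono_op (f (snd (p, x))))) has_sum cscale_op (c p) (mono_op p)) (?B p)" for p
      using has_sum_bounded_linear[OF bounded_linear_cscale_op hd[of p], of "mono_op p"]
      by (rule has_sum_cong[THEN iffD1, rotated]) auto
  qed
  moreover have "c p = 0" if "snd p \<notin> \<Xi>" for p
    unfolding c_def using supp that by (intro infsum_0) auto
  ultimately show "fourier_rep \<Xi> c A" using m d by (auto simp: fourier_rep_def)
qed

text \<open>The double series has moduli \<open>cmod (a p) * cmod (b q)\<close>, because the
  commutation scalars are unimodular; its mass factors before like monomials are collected.\<close>

lemma fourier_rep_mult: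
  assumes \<Xi>: "add_subgroup \<Xi>" and A: "fourier_rep \<Xi> a A" and B: "fourier_rep \<Xi> b B"
  obtains c where "fourier_rep \<Xi> c (A * B)" "mass c \<le> mass a * mass b"
proof -
  define d where "d z = a (fst z) * b (snd z) * echar (snd (snd z)) (- fst (fst z))" for z
  let ?f = "\<lambda>z. fst z + snd z :: int \<times> real_mod_int"
  let ?F = "\<lambda>z. cscale_op (d z) (mono_op (?f z))"
  have F: "?F (p, q) = cscale_op (a p) (mono_op p) * cscale_op (b q) (mono_op q)" for p q
    unfolding cscale_op_mult mono_op_mult
    by (rule op_eqI) (simp add: entry_cscale_op d_def)
  have m: "esum (\<lambda>z. ennreal (cmod (d z))) = mass a * mass b"
  proof -
    have "esum (\<lambda>z. ennreal (cmod (d z))) = esum (\<lambda>z. ennreal (cmod (a (fst z))) * ennreal (cmod (b (snd z))))"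
      by (rule esum_cong) (simp add: d_def norm_mult norm_echar ennreal_mult)
    also have "\<dots> = esum (\<lambda>p. esum (\<lambda>q. ennreal (cmod (a p)) * ennreal (cmod (b q))))"
      by (rule esum_prod[symmetric])
    also have "\<dots> = mass a * mass b" by (simp only: mass_def esum_cmult esum_multc)
    finally show ?thesis .
  qed
  have fin: "esum (\<lambda>z. ennreal (cmod (d z))) < \<infinity>"
    using fourier_repD(2)[OF A] fourier_repD(2)[OF B] unfolding m by (simp add: ennreal_mult_less_top)
  have hs: "(?F has_sum (A * B)) UNIV"
  proof -
    have s: "?F summable_on UNIV \<times> UNIV" using summable_on_mono_op[OF fin, of ?f] by simp
    then obtain L where L: "(?F has_sum L) (UNIV \<times> UNIV)" by (auto simp: summable_on_def)
    have "((\<lambda>p. cscale_op (a p) (mono_op p) * B) has_sum L) UNIV"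
    proof (rule has_sum_SigmaD[OF L])
      fix p
      from has_sum_bounded_linear[OF bounded_linear_mult_right fourier_repD(3)[OF B]]
      show "((\<lambda>q. ?F (p, q)) has_sum cscale_op (a p) (mono_op p) * B) UNIV" by (simp only: F)
    qed
    moreover have "((\<lambda>p. cscale_op (a p) (mono_op p) * B) has_sum A * B) UNIV"
      by (rule has_sum_bounded_linear[OF bounded_linear_mult_left fourier_repD(3)[OF A]])
    ultimately have "L = A * B" by (rule has_sum_unique)
    with L show ?thesis by simp
  qed
  have supp: "snd (?f z) \<in> \<Xi>" if "d z \<noteq> 0" for z
  proof -
    have "a (fst z) \<noteq> 0" "b (snd z) \<noteq> 0" using that by (auto simp: d_def)
    then have "snd (fst z) \<in> \<Xi>" "snd (snd z) \<in> \<Xi>" using fourier_repD(1)[OF A] fourier_repD(1)[OF B] by blast+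
    then show ?thesis using \<Xi> by (simp add: add_subgroup_def)
  qed
  obtain c where "fourier_rep \<Xi> c (A * B)" "mass c \<le> esum (\<lambda>z. ennreal (cmod (d z)))"
    by (rule fourier_rep_collect[OF fin supp hs])
  then show thesis using that m by simp
qed

lemma fourier_rep_one:
  assumes "add_subgroup \<Xi>"
  obtains c where "fourier_rep \<Xi> c 1" "mass c = 1"
proof
  let ?c = "\<lambda>p. if p = 0 then 1 else 0 :: complex"
  show m: "mass ?c = 1" unfolding mass_def by (subst esum_finite_support[of "{0}"]) auto
  have "cscale_op 1 (mono_op 0) = 1" by (rule op_eqI) (auto simp: entry_cscale_op entry_mono_op entry_one echar_0)
  moreover have "cscale_op 0 X = 0" for X :: "int ell2_op" by (rule op_eqI) (simp add: entry_cscale_op entry_zero)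
  ultimately have "((\<lambda>p. cscale_op (?c p) (mono_op p)) has_sum 1) UNIV"
    by (intro has_sum_finite_neutralI[of "{0}"]) auto
  then show "fourier_rep \<Xi> ?c 1" using m assms by (auto simp: fourier_rep_def add_subgroup_def zero_prod_def)
qed

lemma fourier_rep_power:
  assumes "add_subgroup \<Xi>" "fourier_rep \<Xi> a A"
  shows "\<exists>c. fourier_rep \<Xi> c (A ^ n) \<and> mass c \<le> mass a ^ n"
proof (induction n)
  case 0
  show ?case using fourier_rep_one[OF assms(1)] by (metis order_refl power_0)
next
  case (Suc n)
  then obtain c where c: "fourier_rep \<Xi> c (A ^ n)" "mass c \<le> mass a ^ n" by blast
  obtain c' where "fourier_rep \<Xi> c' (A * A ^ n)" "mass c' \<le> mass a * mass c"
    by (rule fourier_rep_mult[OF assms c(1)])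
  then show ?case using c(2) by (metis mult_left_mono order_trans power_Suc zero_le)
qed

text \<open>The powers have mass at most \<open>mass a ^ n\<close>, so the series over degree and
  monomial together is absolutely summable; collecting it by monomials gives the expansion.\<close>

lemma fourier_rep_exp:
  assumes "add_subgroup \<Xi>" "fourier_rep \<Xi> a A"
  shows "\<exists>c. fourier_rep \<Xi> c (exp A)"
proof -
  obtain c where c: "\<And>n. fourier_rep \<Xi> (c n) (A ^ n)" "\<And>n. mass (c n) \<le> mass a ^ n"
    using fourier_rep_power[OF assms] by metis
  obtain x where x: "mass a = ennreal x" "x \<ge> 0"
    using fourier_repD(2)[OF assms(2)] by (cases "mass a") auto
  define d where "d z = of_real (1 / fact (fst z)) * c (fst z) (snd z)" for z
  let ?F = "\<lambda>z. cscale_op (d z) (mono_op (snd z))"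
  have "esum (\<lambda>z. ennreal (cmod (d z))) = esum (\<lambda>z. ennreal (1 / fact (fst z)) * ennreal (cmod (c (fst z) (snd z))))"
    by (rule esum_cong) (simp add: d_def norm_mult norm_divide flip: ennreal_mult)
  also have "\<dots> = esum (\<lambda>n. esum (\<lambda>p. ennreal (1 / fact n) * ennreal (cmod (c n p))))"
    by (rule esum_prod[symmetric])
  also have "\<dots> = esum (\<lambda>n. ennreal (1 / fact n) * mass (c n))" by (simp only: mass_def esum_cmult)
  also have "\<dots> \<le> esum (\<lambda>n. ennreal (x ^ n / fact n))"
  proof (rule esum_mono)
    fix n
    have "ennreal (1 / fact n) * mass (c n) \<le> ennreal (1 / fact n) * ennreal x ^ n"
      using c(2)[of n] by (intro mult_left_mono) (auto simp: x)
    then show "ennreal (1 / fact n) * mass (c n) \<le> ennreal (x ^ n / fact n)"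
      using x(2) by (simp add: ennreal_power flip: ennreal_mult)
  qed
  also have "\<dots> = ennreal (exp x)"
    unfolding esum_def nn_integral_count_space_nat
    using x(2) exp_converges[of x] by (intro suminf_ennreal_eq) (auto simp: field_simps)
  finally have fin: "esum (\<lambda>z. ennreal (cmod (d z))) < \<infinity>" by (simp add: le_less_trans)
  have hs: "(?F has_sum exp A) UNIV"
  proof -
    have s: "?F summable_on UNIV \<times> UNIV" using summable_on_mono_op[OF fin, of snd] by simp
    then obtain L where L: "(?F has_sum L) (UNIV \<times> UNIV)" by (auto simp: summable_on_def)
    have "((\<lambda>n. (1 / fact n) *\<^sub>R A ^ n) has_sum L) UNIV"
    proof (rule has_sum_SigmaD[OF L])
      fix n :: nat
      from has_sum_bounded_linear[OF bounded_linear_scaleR_right fourier_repD(3)[OF c(1)], of "1 / fact n"]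
      show "((\<lambda>p. ?F (n, p)) has_sum (1 / fact n) *\<^sub>R A ^ n) UNIV"
      proof (rule has_sum_cong[THEN iffD1, rotated])
        show "(1 / fact n) *\<^sub>R cscale_op (c n p) (mono_op p) = ?F (n, p)" for p
          by (rule op_eqI) (simp add: d_def entry_cscale_op entry_scaleR scaleR_conv_of_real[of _ "_ :: complex"] divide_inverse)
      qed
    qed
    then have "exp_partial A \<longlonglongrightarrow> L"
      using has_sum_imp_sums by (fastforce simp: sums_def exp_partial_def[abs_def])
    then have "L = exp A" using exp_partial_tendsto LIMSEQ_unique by blast
    with L show ?thesis by simp
  qed
  have supp: "snd (snd z) \<in> \<Xi>" if "d z \<noteq> 0" for z
    using that fourier_repD(1)[OF c(1), of "fst z" "snd z"] by (simp add: d_def)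
  obtain c' where "fourier_rep \<Xi> c' (exp A)" by (rule fourier_rep_collect[OF fin supp hs])
  then show ?thesis by blast
qed

lemma fourier_rep_prod_list_exp:
  assumes "add_subgroup \<Xi>" "\<And>B. B \<in> set Bs \<Longrightarrow> \<exists>c. fourier_rep \<Xi> c B"
  shows "\<exists>c. fourier_rep \<Xi> c (prod_list (map exp Bs))"
  using assms(2)
proof (induction Bs)
  case Nil
  show ?case using fourier_rep_one[OF assms(1)] by auto
next
  case (Cons B Bs)
  then obtain a b where "fourier_rep \<Xi> a (exp B)" "fourier_rep \<Xi> b (prod_list (map exp Bs))"
    using fourier_rep_exp[OF assms(1)] by (metis list.set_intros)
  from fourier_rep_mult[OF assms(1) this] show ?case by auto
qed

lemma fourier_rep_uminus: "fourier_rep \<Xi> c A \<Longrightarrow> fourier_rep \<Xi> (\<lambda>p. - c p) (- A)"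
proof -
  assume A: "fourier_rep \<Xi> c A"
  have "cscale_op (- z) X = - cscale_op z X" for z and X :: "int ell2_op"
    by (rule op_eqI) (simp add: entry_cscale_op entry_minus)
  with A show ?thesis by (auto simp: fourier_rep_def mass_def has_sum_uminus)
qed

section \<open>Fourier coefficients and the twist\<close>

lemma has_sum_fourier_rep_entry:
  assumes "fourier_rep \<Xi> c A"
  shows "((\<lambda>\<xi>. c (n, \<xi>) * echar \<xi> i) has_sum entry A i (i - n)) UNIV"
proof -
  have "((\<lambda>p. entry (cscale_op (c p) (mono_op p)) i (i - n)) has_sum entry A i (i - n)) UNIV"
    by (rule has_sum_bounded_linear[OF bounded_linear_entry fourier_repD(3)[OF assms]])
  then have "((\<lambda>p. c p * echar (snd p) i) has_sum entry A i (i - n)) (Pair n ` UNIV)"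
    by (rule has_sum_cong_neutral[THEN iffD1, rotated -1]) (auto simp: entry_cscale_op entry_mono_op)
  then show ?thesis by (subst (asm) has_sum_reindex) (auto simp: inj_on_def o_def)
qed

lemma ap_coeff_fourier_rep:
  assumes "fourier_rep \<Xi> c A" shows "ap_coeff \<Xi> (diagonal n A) \<xi> = c (n, \<xi>)"
proof -
  have supp: "c (n, \<xi>) = 0" if "\<xi> \<notin> \<Xi>" for \<xi> using assms that by (auto simp: fourier_rep_def)
  have "esum (\<lambda>\<xi>. ennreal (cmod (c (n, \<xi>)))) \<le> mass c"
    unfolding mass_def using esum_inj_le[of "Pair n" "\<lambda>p. ennreal (cmod (c p))"] by (simp add: inj_on_def)
  also have "\<dots> < \<infinity>" using assms by (simp add: fourier_rep_def)
  finally have "(\<lambda>\<xi>. cmod (c (n, \<xi>))) summable_on UNIV" by (rule summable_on_if_esum_finite) simp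
  then have s: "(\<lambda>\<xi>. cmod (c (n, \<xi>))) summable_on \<Xi>" by (rule summable_on_subset_banach) simp
  have "((\<lambda>\<xi>. c (n, \<xi>) * echar \<xi> k) has_sum diagonal n A k) \<Xi>" for k
    unfolding diagonal_def using has_sum_fourier_rep_entry[OF assms, of n k]
    by (rule has_sum_cong_neutral[THEN iffD1, rotated -1]) (auto simp: supp)
  then show ?thesis using ap_coeff_eqI[of \<Xi> "\<lambda>\<xi>. c (n, \<xi>)" "diagonal n A"] supp s by simp
qed

text \<open>Because e_xi(i) e_xi(m) = e_xi(i + m), the character \<open>tau m\<close> acts as
  translation by \<open>m\<close> along the diagonals.\<close>

lemma entry_twist_tau:
  assumes A: "fourier_rep \<Xi> c A"
  shows "entry (twist \<Xi> (tau m) A) i j = entry A (i + m) (j + m)"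
proof -
  let ?F = "\<lambda>p. cscale_op (c p * tau m (snd p)) (mono_op p)"
  have supp: "c (n, \<xi>) = 0" if "\<xi> \<notin> \<Xi>" for n \<xi> using A that by (auto simp: fourier_rep_def)
  have "esum (\<lambda>p. ennreal (cmod (c p * tau m (snd p)))) = mass c"
    by (simp add: mass_def norm_mult tau_def norm_echar)
  then have s: "?F summable_on UNIV \<times> UNIV"
    using A summable_on_mono_op[of "\<lambda>p. c p * tau m (snd p)" "\<lambda>p. p"] by (simp add: fourier_rep_def)
  have z: "cscale_op 0 X = 0" for X :: "int ell2_op" by (rule op_eqI) (simp add: entry_cscale_op entry_zero)
  have "twist \<Xi> (tau m) A = (\<Sum>\<^sub>\<infinity>n. \<Sum>\<^sub>\<infinity>\<xi>\<in>\<Xi>. ?F (n, \<xi>))"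
    unfolding twist_def ap_coeff_fourier_rep[OF A] mono_op_def by simp
  also have "\<dots> = (\<Sum>\<^sub>\<infinity>n. \<Sum>\<^sub>\<infinity>\<xi>. ?F (n, \<xi>))"
    by (intro infsum_cong infsum_cong_neutral) (auto simp: supp z)
  also have "\<dots> = infsum ?F (UNIV \<times> UNIV)" by (rule infsum_Sigma_banach[OF s])
  finally have t: "(?F has_sum twist \<Xi> (tau m) A) UNIV" using has_sum_infsum[OF s] by simp
  have "((\<lambda>p. entry (?F p) i j) has_sum entry (twist \<Xi> (tau m) A) i j) UNIV"
    by (rule has_sum_bounded_linear[OF bounded_linear_entry t])
  moreover have "((\<lambda>p. entry (cscale_op (c p) (mono_op p)) (i + m) (j + m)) has_sum entry A (i + m) (j + m)) UNIV"
    by (rule has_sum_bounded_linear[OF bounded_linear_entry fourier_repD(3)[OF A]])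
  moreover have "entry (?F p) i j = entry (cscale_op (c p) (mono_op p)) (i + m) (j + m)" for p
    by (auto simp: entry_cscale_op entry_mono_op tau_def echar_add_int)
  ultimately show ?thesis using has_sum_unique by fastforce
qed

section \<open>From the weighted algebra to expansions and Toeplitz majorants\<close>

lemma wiener_alg_coeffs:
  assumes A: "A \<in> wiener_alg \<alpha>\<^sub>1 \<alpha>\<^sub>2 \<Xi> \<beta>" and \<beta>: "\<And>\<xi>. \<xi> \<in> \<Xi> \<Longrightarrow> 1 \<le> \<beta> \<xi>"
  defines "c \<equiv> \<lambda>n. ap_coeff \<Xi> (diagonal n A)"
  shows "\<xi> \<notin> \<Xi> \<Longrightarrow> c n \<xi> = 0"
    and "(\<lambda>\<xi>. \<beta> \<xi> * cmod (c n \<xi>)) summable_on \<Xi>"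
    and "((\<lambda>\<xi>. c n \<xi> * echar \<xi> k) has_sum diagonal n A k) \<Xi>"
proof -
  from A have "diagonal n A \<in> APW \<Xi> \<beta>" by (simp add: wiener_alg_def)
  then obtain d where d: "(\<lambda>\<xi>. \<beta> \<xi> * cmod (d \<xi>)) summable_on \<Xi>"
    "\<And>k. ((\<lambda>\<xi>. d \<xi> * echar \<xi> k) has_sum diagonal n A k) \<Xi>"
    by (auto simp: APW_def)
  define e where "e \<xi> = (if \<xi> \<in> \<Xi> then d \<xi> else 0)" for \<xi>
  have e1: "(\<lambda>\<xi>. \<beta> \<xi> * cmod (e \<xi>)) summable_on \<Xi>"
    using d(1) by (rule summable_on_cong[THEN iffD1, rotated]) (simp add: e_def)
  have e2: "((\<lambda>\<xi>. e \<xi> * echar \<xi> k) has_sum diagonal n A k) \<Xi>" for k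
    using d(2) by (rule has_sum_cong[THEN iffD1, rotated]) (simp add: e_def)
  have le: "cmod (e \<xi>) \<le> \<beta> \<xi> * cmod (e \<xi>)" if "\<xi> \<in> \<Xi>" for \<xi>
    using mult_right_mono[OF \<beta>[OF that], of "cmod (e \<xi>)"] by simp
  have "(\<lambda>\<xi>. cmod (e \<xi>)) summable_on \<Xi>"
    by (rule summable_on_comparison_test[OF e1]) (use le in auto)
  then have ce: "c n = e"
    unfolding c_def using e2 by (intro ap_coeff_eqI) (auto simp: e_def)
  show "\<xi> \<notin> \<Xi> \<Longrightarrow> c n \<xi> = 0" "(\<lambda>\<xi>. \<beta> \<xi> * cmod (c n \<xi>)) summable_on \<Xi>"
    "((\<lambda>\<xi>. c n \<xi> * echar \<xi> k) has_sum diagonal n A k) \<Xi>"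
    unfolding ce using e1 e2 by (auto simp: e_def)
qed

lemma power_weight_ge_1: "\<alpha>\<^sub>1 \<ge> 0 \<Longrightarrow> \<alpha>\<^sub>2 \<ge> 0 \<Longrightarrow> 1 \<le> power_weight \<alpha>\<^sub>1 \<alpha>\<^sub>2 k"
  by (auto simp: power_weight_def ge_one_powr_ge_zero)

text \<open>Each diagonal is replaced by the constant sum of the moduli of its coefficients, which
  bounds it at every position.\<close>

definition coeff_kernel :: "(int \<times> real_mod_int \<Rightarrow> complex) \<Rightarrow> kernel" where
  "coeff_kernel c i j = esum (\<lambda>\<xi>. ennreal (cmod (c (i - j, \<xi>))))"

lemma toeplitz_coeff_kernel: "toeplitz (coeff_kernel c)"
  by (simp add: toeplitz_def coeff_kernel_def)

lemma dominated_coeff_kernel: "fourier_rep \<Xi> c A \<Longrightarrow> dominated A (coeff_kernel c)"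
proof (unfold dominated_def, intro allI)
  fix i j assume "fourier_rep \<Xi> c A"
  from has_sum_norm_le_esum[OF has_sum_fourier_rep_entry[OF this, of "i - j" i]]
  show "ennreal (cmod (entry A i j)) \<le> coeff_kernel c i j"
    by (simp add: coeff_kernel_def norm_mult norm_echar)
qed

text \<open>Since \<open>\<beta>\<close> is at least 1, the coefficient sum of a diagonal is at most
  its \<open>APW_norm\<close>; since the power weight is at least 1, the total mass is finite. The
  resulting sum is identified with \<open>A\<close> through its entries.\<close>

lemma wiener_alg_fourier_rep:
  assumes A: "A \<in> wiener_alg \<alpha>\<^sub>1 \<alpha>\<^sub>2 \<Xi> \<beta>" and \<beta>: "\<And>\<xi>. \<xi> \<in> \<Xi> \<Longrightarrow> 1 \<le> \<beta> \<xi>" and \<alpha>: "\<alpha>\<^sub>1 \<ge> 0" "\<alpha>\<^sub>2 \<ge> 0"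
  obtains c where "fourier_rep \<Xi> c A" "weighted_sum (power_weight \<alpha>\<^sub>1 \<alpha>\<^sub>2) (coeff_kernel c) < \<infinity>"
proof
  let ?w = "power_weight \<alpha>\<^sub>1 \<alpha>\<^sub>2"
  define c where "c p = ap_coeff \<Xi> (diagonal (fst p) A) (snd p)" for p
  note W = wiener_alg_coeffs[OF A \<beta>]
  have supp: "c (n, \<xi>) = 0" if "\<xi> \<notin> \<Xi>" for n \<xi> using W(1)[OF _ that] by (simp add: c_def)
  have row: "esum (\<lambda>\<xi>. ennreal (cmod (c (n, \<xi>)))) \<le> ennreal (APW_norm \<Xi> \<beta> (diagonal n A))" for n
  proof -
    let ?g = "\<lambda>\<xi>. if \<xi> \<in> \<Xi> then \<beta> \<xi> * cmod (c (n, \<xi>)) else 0"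
    have g0: "0 \<le> ?g \<xi>" for \<xi> using \<beta>[of \<xi>] by auto
    have "(\<lambda>\<xi>. \<beta> \<xi> * cmod (c (n, \<xi>))) summable_on \<Xi>" using W(2)[of n] by (simp add: c_def)
    then have gs: "?g summable_on UNIV"
      by (rule summable_on_cong_neutral[THEN iffD1, rotated -1]) auto
    have "esum (\<lambda>\<xi>. ennreal (cmod (c (n, \<xi>)))) \<le> esum (\<lambda>\<xi>. ennreal (?g \<xi>))"
    proof (rule esum_mono)
      fix \<xi> show "ennreal (cmod (c (n, \<xi>))) \<le> ennreal (?g \<xi>)"
        using supp[of \<xi> n] mult_right_mono[OF \<beta>[of \<xi>], of "cmod (c (n, \<xi>))"] by (cases "\<xi> \<in> \<Xi>") (auto intro: ennreal_leI)
    qed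
    also have "\<dots> = ennreal (infsum ?g UNIV)" by (rule esum_ennreal_finite[OF gs g0])
    also have "infsum ?g UNIV = APW_norm \<Xi> \<beta> (diagonal n A)"
      unfolding APW_norm_def by (rule infsum_cong_neutral) (auto simp: c_def)
    finally show ?thesis .
  qed
  have N0: "0 \<le> APW_norm \<Xi> \<beta> (diagonal n A)" for n
    unfolding APW_norm_def using \<beta> by (intro infsum_nonneg) (meson mult_nonneg_nonneg norm_ge_zero order_trans zero_le_one)
  have w1: "1 \<le> ?w k" for k using power_weight_ge_1 \<alpha> by blast
  have w0: "0 \<le> ?w k" for k using w1[of k] by linarith
  have "weighted_sum ?w (coeff_kernel c) = esum (\<lambda>n. ennreal (?w n) * esum (\<lambda>\<xi>. ennreal (cmod (c (n, \<xi>)))))"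
    by (simp add: weighted_sum_def coeff_kernel_def)
  also have "\<dots> \<le> esum (\<lambda>n. ennreal (?w n * APW_norm \<Xi> \<beta> (diagonal n A)))"
    using row N0 w0 by (intro esum_mono) (simp add: ennreal_mult mult_left_mono)
  also have "\<dots> = ennreal (\<Sum>\<^sub>\<infinity>n. ?w n * APW_norm \<Xi> \<beta> (diagonal n A))"
    using A N0 w0 by (intro esum_ennreal_finite) (auto simp: wiener_alg_def)
  finally show fin: "weighted_sum ?w (coeff_kernel c) < \<infinity>" by (simp add: le_less_trans)
  have "mass c = esum (\<lambda>n. esum (\<lambda>\<xi>. ennreal (cmod (c (n, \<xi>)))))"
    by (simp add: mass_def esum_prod)
  also have "\<dots> \<le> weighted_sum ?w (coeff_kernel c)"
    unfolding weighted_sum_def coeff_kernel_def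
  proof (rule esum_mono)
    fix n
    have "ennreal 1 \<le> ennreal (?w n)" using w1 by (rule ennreal_leI)
    then show "esum (\<lambda>\<xi>. ennreal (cmod (c (n, \<xi>)))) \<le> ennreal (?w n) * esum (\<lambda>\<xi>. ennreal (cmod (c (n - 0, \<xi>))))"
      using mult_right_mono[of "ennreal 1" "ennreal (?w n)" "esum (\<lambda>\<xi>. ennreal (cmod (c (n, \<xi>))))"] by simp
  qed
  finally have m: "mass c < \<infinity>" using fin by simp
  then obtain L where L: "((\<lambda>p. cscale_op (c p) (mono_op p)) has_sum L) UNIV"
    using summable_on_mono_op[of c "\<lambda>p. p"] by (auto simp: mass_def summable_on_def)
  have rep: "fourier_rep \<Xi> c L" using supp m L by (auto simp: fourier_rep_def)
  have "L = A"
  proof (rule op_eqI)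
    fix i j
    have "((\<lambda>\<xi>. c (i - j, \<xi>) * echar \<xi> i) has_sum entry A i j) UNIV"
    proof -
      have "diagonal (i - j) A i = entry A i j" by (simp add: diagonal_def)
      then have "((\<lambda>\<xi>. c (i - j, \<xi>) * echar \<xi> i) has_sum entry A i j) \<Xi>"
        using W(3)[of "i - j" i] by (simp add: c_def)
      then show ?thesis by (rule has_sum_cong_neutral[THEN iffD1, rotated -1]) (auto simp: supp)
    qed
    then show "entry L i j = entry A i j"
      using has_sum_fourier_rep_entry[OF rep, of "i - j" i] has_sum_unique by fastforce
  qed
  then show "fourier_rep \<Xi> c A" using rep by simp
qed

text \<open>For equal signs, 1 + |x + y| is at most (1 + |x|)(1 + |y|). For opposite signs,
  \<open>m + n\<close> is no larger in modulus than the summand on whose side it lies, and the other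
  weight is at least 1.\<close>

lemma power_weight_submult:
  assumes "\<alpha>\<^sub>1 \<ge> 0" "\<alpha>\<^sub>2 \<ge> 0"
  shows "power_weight \<alpha>\<^sub>1 \<alpha>\<^sub>2 (m + n) \<le> power_weight \<alpha>\<^sub>1 \<alpha>\<^sub>2 m * power_weight \<alpha>\<^sub>1 \<alpha>\<^sub>2 n"
proof -
  have both: "(1 + \<bar>x + y\<bar>) powr a \<le> (1 + \<bar>x\<bar>) powr a * (1 + \<bar>y\<bar>) powr a" if "a \<ge> 0" for x y a :: real
  proof -
    have "1 + \<bar>x + y\<bar> \<le> (1 + \<bar>x\<bar>) * (1 + \<bar>y\<bar>)"
    proof -
      have "(1 + \<bar>x\<bar>) * (1 + \<bar>y\<bar>) = 1 + \<bar>x\<bar> + \<bar>y\<bar> + \<bar>x\<bar> * \<bar>y\<bar>" by (simp add: algebra_simps)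
      moreover have "0 \<le> \<bar>x\<bar> * \<bar>y\<bar>" by simp
      ultimately show ?thesis using abs_triangle_ineq[of x y] by linarith
    qed
    then show ?thesis using powr_mono2[OF that] by (simp flip: powr_mult)
  qed
  have one: "x \<le> x * y" if "0 \<le> x" "1 \<le> y" for x y :: real using mult_left_mono[OF that(2,1)] by simp
  have w: "power_weight \<alpha>\<^sub>1 \<alpha>\<^sub>2 k = (1 + \<bar>of_int k\<bar>) powr (if k \<ge> 0 then \<alpha>\<^sub>1 else \<alpha>\<^sub>2)" for k
    by (simp add: power_weight_def)
  have wmono: "power_weight \<alpha>\<^sub>1 \<alpha>\<^sub>2 k \<le> power_weight \<alpha>\<^sub>1 \<alpha>\<^sub>2 l" if "(k \<ge> 0) = (l \<ge> 0)" "\<bar>k\<bar> \<le> \<bar>l\<bar>" for k l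
    unfolding w using that assms by (auto intro!: powr_mono2)
  note w1 = power_weight_ge_1[OF assms]
  have w0: "0 \<le> power_weight \<alpha>\<^sub>1 \<alpha>\<^sub>2 k" for k using w1[of k] by linarith
  show ?thesis
  proof (cases "(m \<ge> 0) = (n \<ge> 0)")
    case True
    then have "(m + n \<ge> 0) = (m \<ge> 0)" by auto
    with True show ?thesis unfolding w using both[of _ "of_int m" "of_int n"] assms by simp
  next
    case False
    show ?thesis
    proof (cases "(m + n \<ge> 0) = (m \<ge> 0)")
      case True
      then have "power_weight \<alpha>\<^sub>1 \<alpha>\<^sub>2 (m + n) \<le> power_weight \<alpha>\<^sub>1 \<alpha>\<^sub>2 m" using False by (intro wmono) auto
      then show ?thesis using one[OF w0 w1] order_trans by blast
    next
      case 2: False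
      then have "power_weight \<alpha>\<^sub>1 \<alpha>\<^sub>2 (m + n) \<le> power_weight \<alpha>\<^sub>1 \<alpha>\<^sub>2 n" using False by (intro wmono) auto
      then show ?thesis using one[OF w0 w1] order_trans by (metis mult.commute)
    qed
  qed
qed

lemma min_le_power_weight:
  assumes "\<alpha>\<^sub>1 \<ge> 0" "\<alpha>\<^sub>2 \<ge> 0" "\<alpha>\<^sub>1 + \<alpha>\<^sub>2 = 1" "0 \<le> p" "0 \<le> q"
  shows "of_int (min p q) \<le> power_weight \<alpha>\<^sub>1 \<alpha>\<^sub>2 p * power_weight \<alpha>\<^sub>1 \<alpha>\<^sub>2 (- q)"
proof -
  define m where "m = min p q"
  have m: "0 \<le> m" "m \<le> p" "m \<le> q" using assms by (auto simp: m_def)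
  \<comment> \<open>The only use of \<open>\<alpha>\<^sub>1 + \<alpha>\<^sub>2 = 1\<close>: the
    linear factor \<open>1 + m\<close> is distributed over the two weights.\<close>
  have "of_int m \<le> (1 + of_int m :: real) powr (\<alpha>\<^sub>1 + \<alpha>\<^sub>2)" using assms m by simp
  also have "\<dots> = (1 + of_int m) powr \<alpha>\<^sub>1 * (1 + of_int m) powr \<alpha>\<^sub>2" by (rule powr_add)
  also have "\<dots> \<le> (1 + of_int p) powr \<alpha>\<^sub>1 * (1 + of_int q) powr \<alpha>\<^sub>2"
    using m assms by (intro mult_mono powr_mono2) auto
  \<comment> \<open>For \<open>q = 0\<close> the definition of \<open>power_weight\<close> takes its
    nonnegative branch at \<open>- q\<close>, but both branches give 1 there.\<close>
  also have "\<dots> = power_weight \<alpha>\<^sub>1 \<alpha>\<^sub>2 p * power_weight \<alpha>\<^sub>1 \<alpha>\<^sub>2 (- q)"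
    using assms by (cases "q = 0") (auto simp: power_weight_def)
  finally show ?thesis by (simp add: m_def)
qed

section \<open>Compression to a half-line\<close>

lemma bounded_linear_op:
  assumes "\<And>A B. f (A + B) = f A + f B" "\<And>r A. f (r *\<^sub>R A) = r *\<^sub>R f A" "\<And>A. norm (f A) \<le> norm A"
  shows "bounded_linear f"
  by (rule bounded_linear_intro[where K = 1]) (use assms in auto)

lemma extend_zero_basis_vec: "extend_zero (basis_vec j) = basis_vec (int j)"
  by transfer (auto simp: fun_eq_iff)

lemma entry_compression: "entry (compression A) i j = entry A (int i) (int j)"
  by (simp add: entry_def compression.rep_eq restrict_nonneg.rep_eq extend_zero_basis_vec)

lemma norm_compression_le: "norm (compression A) \<le> norm A"
proof (rule norm_op_leI)
  fix x
  have r: "norm (restrict_nonneg y) \<le> norm y" for y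
    by (rule norm_ell2_leI) (use restrict_bound[of y] in \<open>simp add: restrict_nonneg.rep_eq\<close>)
  have e: "norm (extend_zero x) \<le> norm x"
    by (rule norm_ell2_leI) (use extend_bound[of x] in \<open>simp add: extend_zero.rep_eq\<close>)
  have "norm (op_apply (compression A) x) \<le> norm (op_apply A (extend_zero x))"
    using r by (simp add: compression.rep_eq)
  also have "\<dots> \<le> norm A * norm (extend_zero x)" by (rule norm_op_apply)
  also have "\<dots> \<le> norm A * norm x" by (rule mult_left_mono[OF e]) simp
  finally show "norm (op_apply (compression A) x) \<le> norm A * norm x" .
qed simp

lemma norm_shift_op_le: "norm (shift_op n) \<le> 1"
  by (rule norm_op_leI, simp, rule norm_ell2_leI) (use shift_bound in \<open>simp add: coord_shift_op\<close>)

text \<open>The compression to \<open>{n..}\<close> relabelled by the naturals, so that it can be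
  compared with \<open>compression\<close>.\<close>

definition restr :: "int \<Rightarrow> int ell2_op \<Rightarrow> nat ell2_op" where
  "restr n X = compression (shift_op (- n) * X * shift_op n)"

lemma entry_restr: "entry (restr n X) i j = entry X (n + int i) (n + int j)"
proof -
  have "op_apply (shift_op n) (basis_vec k) = basis_vec (n + k)" for k
    by (simp flip: coord_inject add: fun_eq_iff coord_shift_op basis_vec.rep_eq)
  then show ?thesis
    unfolding restr_def entry_compression by (simp add: entry_def times_ell2_op.rep_eq coord_shift_op add.commute)
qed

lemma bounded_linear_restr: "bounded_linear (restr n)"
proof (rule bounded_linear_op)
  show "restr n (A + B) = restr n A + restr n B" for A B
    by (rule op_eqI) (simp add: entry_restr entry_add)
  show "restr n (r *\<^sub>R A) = r *\<^sub>R restr n A" for r A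
    by (rule op_eqI) (simp add: entry_restr entry_scaleR)
  show "norm (restr n A) \<le> norm A" for A
  proof -
    have "norm (restr n A) \<le> norm (shift_op (- n) * A * shift_op n)"
      unfolding restr_def by (rule norm_compression_le)
    also have "\<dots> \<le> norm (shift_op (- n) * A) * norm (shift_op n)" by (rule norm_mult_ineq)
    also have "\<dots> \<le> norm (shift_op (- n) * A) * 1" by (rule mult_left_mono[OF norm_shift_op_le]) simp
    also have "\<dots> \<le> norm (shift_op (- n)) * norm A" using norm_mult_ineq[of "shift_op (- n)" A] by simp
    also have "\<dots> \<le> 1 * norm A" by (rule mult_right_mono[OF norm_shift_op_le]) simp
    finally show ?thesis by simp
  qed
qed

lemma restr_one: "restr n 1 = 1"
  by (rule op_eqI) (simp add: entry_restr entry_one)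

lemma restr_uminus: "restr n (- X) = - restr n X"
  by (rule op_eqI) (simp add: entry_restr entry_minus)

lemma restr_proj_mult: "restr n (X * proj_op {n..} * Y) = restr n X * restr n Y"
proof (rule op_eqI)
  fix i j
  let ?f = "\<lambda>k. entry X (n + int i) k * entry Y k (n + int j)"
  have "((\<lambda>k. entry (X * proj_op {n..}) (n + int i) k * entry Y k (n + int j))
      has_sum entry (X * proj_op {n..} * Y) (n + int i) (n + int j)) UNIV"
    by (rule has_sum_entry_mult)
  then have "(?f has_sum entry (X * proj_op {n..} * Y) (n + int i) (n + int j)) {n..}"
    by (rule has_sum_cong_neutral[THEN iffD1, rotated -1]) (auto simp: entry_mult_proj_op)
  moreover have "bij_betw (\<lambda>k. n + int k) UNIV {n..}"
    by (rule bij_betwI[of _ _ _ "\<lambda>k. nat (k - n)"]) auto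
  ultimately have "((\<lambda>k. ?f (n + int k)) has_sum entry (X * proj_op {n..} * Y) (n + int i) (n + int j)) UNIV"
    by (subst has_sum_reindex_bij_betw)
  then have "((\<lambda>k. entry (restr n X) i k * entry (restr n Y) k j)
      has_sum entry (X * proj_op {n..} * Y) (n + int i) (n + int j)) UNIV"
    by (simp only: entry_restr)
  from has_sum_unique[OF this has_sum_entry_mult]
  show "entry (restr n (X * proj_op {n..} * Y)) i j = entry (restr n X * restr n Y) i j"
    by (simp only: entry_restr)
qed

lemma restr_cong:
  assumes "\<And>i j. i \<ge> n \<Longrightarrow> j \<ge> n \<Longrightarrow> entry X i j = entry Y i j"
  shows "restr n X = restr n Y"
  by (rule op_eqI) (simp add: entry_restr assms)

lemma restr_mult_commute:
  assumes "proj_op {n..} * Y = Y * proj_op {n..}"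
  shows "restr n (X * Y) = restr n X * restr n Y"
proof -
  have "restr n (X * Y) = restr n (X * Y * proj_op {n..})"
    by (rule restr_cong) (simp add: entry_mult_proj_op)
  also have "X * Y * proj_op {n..} = X * proj_op {n..} * Y"
    by (simp add: mult.assoc assms)
  finally show ?thesis by (simp only: restr_proj_mult)
qed

text \<open>Compressed powers commute with their own projection, so \<open>restr n\<close> is
  multiplicative on them and the exponential series agree term by term.\<close>

lemma restr_exp_compress: "restr n (exp (compress {n..} B)) = exp (restr n B)"
proof (rule exp_eqI[where f = "restr n" and g = "\<lambda>X. X", OF bounded_linear_restr _ refl bounded_linear_ident])
  show "restr n (compress {n..} B ^ k) = restr n B ^ k" for k
  proof (induction k)
    case (Suc k)
    have c: "proj_op {n..} * compress {n..} B = compress {n..} B * proj_op {n..}"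
      by (simp add: compress_def mult.assoc)
    have "restr n (compress {n..} B) = restr n B"
      by (rule restr_cong) (simp add: entry_compress)
    then show ?case
      unfolding power_Suc2 restr_mult_commute[OF c] by (simp only: Suc)
  qed (simp add: restr_one)
qed

lemma restr_exp_prod: "restr n (exp_prod {n..} As) = prod_list (map (\<lambda>B. exp (restr n B)) As)"
proof (induction As)
  case (Cons B As)
  have "restr n (exp_prod {n..} (B # As)) = restr n (exp (compress {n..} B)) * restr n (exp_prod {n..} As)"
    using restr_mult_commute[OF proj_op_exp_prod] by (simp add: exp_prod_def)
  then show ?case using Cons by (simp add: restr_exp_compress)
qed (simp add: exp_prod_def restr_one)

lemma restr_exp_prod_inv:
  "restr n (exp_prod_inv {n..} As) = prod_list (map (\<lambda>B. exp (- restr n B)) (rev As))"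
  unfolding exp_prod_inv_eq restr_exp_prod by (simp add: rev_map o_def restr_uminus)

text \<open>Turns the operators inside the two Theta factors at \<open>tau n\<close> into untwisted
  ones on the half-line from \<open>n\<close>.\<close>

lemma compression_twist_tau:
  assumes "fourier_rep \<Xi> c A" shows "compression (twist \<Xi> (tau n) A) = restr n A"
  by (rule op_eqI) (simp add: entry_compression entry_restr entry_twist_tau[OF assms] add.commute)

section \<open>Fredholm determinants of operators with absolutely summable entries\<close>

lemma cinner_basis_vec: "cinner (basis_vec j) v = coord v j"
proof -
  have "((\<lambda>i. cnj (coord (basis_vec j) i) * coord v i) has_sum coord v j) UNIV"
    by (rule has_sum_finite_neutralI[of "{j}"]) (auto simp: basis_vec.rep_eq)
  then show ?thesis unfolding cinner_def by (rule infsumI)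
qed

lemma norm_basis_vec_le: "norm (basis_vec j) \<le> 1"
proof (rule norm_ell2_leI)
  fix F :: "'a set" assume F: "finite F"
  have "(\<Sum>i\<in>F. (cmod (coord (basis_vec j) i))\<^sup>2) = (\<Sum>i\<in>F. if i = j then 1 else 0)"
    by (rule sum.cong) (auto simp: basis_vec.rep_eq)
  also have "\<dots> \<le> 1" using F by simp
  finally show "L2_set (\<lambda>i. cmod (coord (basis_vec j) i)) F \<le> 1" by (simp add: L2_set_def)
qed

text \<open>The matrix itself is a nuclear decomposition: one rank one operator per entry, of norm
  at most the modulus of that entry, enumerated by \<open>prod_decode\<close>.\<close>

lemma trace_class_if_entries_summable:
  fixes K :: "nat ell2_op"
  assumes s: "(\<lambda>z. cmod (entry K (fst z) (snd z))) summable_on UNIV"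
  shows "trace_class K"
  unfolding trace_class_def
proof (intro exI conjI allI)
  define z where "z = (prod_decode :: nat \<Rightarrow> nat \<times> nat)"
  have z: "bij z" unfolding z_def by (rule bij_prod_decode)
  define x :: "nat \<Rightarrow> nat ell2" where "x n = cscale (entry K (fst (z n)) (snd (z n))) (basis_vec (fst (z n)))" for n
  define y :: "nat \<Rightarrow> nat ell2" where "y n = basis_vec (snd (z n))" for n
  have "(\<lambda>n. cmod (entry K (fst (z n)) (snd (z n)))) summable_on UNIV"
    using s summable_on_reindex_bij_betw[OF z, of "\<lambda>z. cmod (entry K (fst z) (snd z))"] by simp
  then have sn: "summable (\<lambda>n. cmod (entry K (fst (z n)) (snd (z n))))"
    by (rule summable_on_imp_summable)
  have xy: "norm (x n) * norm (y n) \<le> cmod (entry K (fst (z n)) (snd (z n)))" for n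
    unfolding x_def y_def norm_cscale
    using mult_mono[OF mult_left_mono[OF norm_basis_vec_le[of "fst (z n)"]] norm_basis_vec_le[of "snd (z n)"],
        of "cmod (entry K (fst (z n)) (snd (z n)))"] by simp
  show "summable (\<lambda>n. norm (x n) * norm (y n))"
    by (rule summable_comparison_test[OF _ sn]) (use xy in auto)
  show "(\<lambda>n. cscale (cinner (y n) v) (x n)) sums op_apply K v" for v
  proof -
    let ?t = "\<lambda>p. cscale (entry K (fst p) (snd p) * coord v (snd p)) (basis_vec (fst p))"
    have "?t summable_on UNIV"
    proof (rule abs_summable_summable, rule Infinite_Sum.abs_summable_on_comparison_test')
      show "(\<lambda>p. cmod (entry K (fst p) (snd p)) * norm v) summable_on UNIV"
        using s by (rule summable_on_cmult_left)
      show "norm (?t p) \<le> cmod (entry K (fst p) (snd p)) * norm v" for p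
        unfolding norm_cscale norm_mult
        using mult_mono[OF mult_left_mono[OF cmod_coord_le[of v "snd p"]] norm_basis_vec_le[of "fst p"],
          of "cmod (entry K (fst p) (snd p))"] by simp
    qed
    then obtain L where L: "(?t has_sum L) UNIV" by (auto simp: summable_on_def)
    have "L = op_apply K v"
    proof (subst coord_inject[symmetric], rule ext)
      fix i
      have "((\<lambda>p. coord (?t p) i) has_sum coord L i) UNIV"
        by (rule has_sum_bounded_linear[OF bounded_linear_coord L])
      then have "((\<lambda>p. entry K (fst p) (snd p) * coord v (snd p)) has_sum coord L i) (Pair i ` UNIV)"
        by (rule has_sum_cong_neutral[THEN iffD1, rotated -1]) (auto simp: cscale.rep_eq basis_vec.rep_eq)
      then have "((\<lambda>k. entry K i k * coord v k) has_sum coord L i) UNIV"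
        by (subst (asm) has_sum_reindex) (auto simp: inj_on_def o_def)
      from has_sum_unique[OF this has_sum_coord_op_apply] show "coord L i = coord (op_apply K v) i" .
    qed
    with L have "((\<lambda>n. ?t (z n)) has_sum op_apply K v) UNIV"
      using has_sum_reindex_bij_betw[OF z, of ?t] by simp
    then have "(\<lambda>n. ?t (z n)) sums op_apply K v" by (rule has_sum_imp_sums)
    moreover have "?t (z n) = cscale (cinner (y n) v) (x n)" for n
      by (simp add: x_def y_def cinner_basis_vec cscale_cscale mult.commute)
    ultimately show ?thesis by simp
  qed
qed

definition nat_total :: "(nat \<Rightarrow> nat \<Rightarrow> complex) \<Rightarrow> ennreal" where
  "nat_total K = esum (\<lambda>i. esum (\<lambda>j. ennreal (cmod (K i j))))"

lemma entry_sum_le_nat_total: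
  assumes "nat_total K \<le> ennreal k" "0 \<le> k" shows "entry_sum_le K k"
  unfolding entry_sum_le_def
proof
  fix N
  have "ennreal (\<Sum>i<N. \<Sum>j<N. cmod (K i j)) = (\<Sum>i<N. \<Sum>j<N. ennreal (cmod (K i j)))"
    by (simp add: sum_nonneg)
  also have "\<dots> \<le> (\<Sum>i<N. esum (\<lambda>j. ennreal (cmod (K i j))))" by (intro sum_mono sum_le_esum) simp
  also have "\<dots> \<le> nat_total K" unfolding nat_total_def by (intro sum_le_esum) simp
  also have "\<dots> \<le> ennreal k" by fact
  finally show "(\<Sum>i<N. \<Sum>j<N. cmod (K i j)) \<le> k" using assms(2) by simp
qed

text \<open>Summable entries make \<open>B - 1\<close> trace class, so the guarded definition takes
  its meaningful branch.\<close>

lemma fredholm_det_eq: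
  fixes B :: "nat ell2_op"
  assumes "nat_total (\<lambda>i j. entry B i j - delta i j) < \<infinity>"
  shows "fredholm_det B = fredholm_series (\<lambda>i j. entry B i j - delta i j)"
proof -
  have e: "entry (B - 1) = (\<lambda>i j. entry B i j - delta i j)"
    by (simp add: fun_eq_iff entry_diff entry_one delta_def)
  have "trace_class (B - 1)"
  proof (rule trace_class_if_entries_summable, rule summable_on_if_esum_finite)
    show "esum (\<lambda>z. ennreal (cmod (entry (B - 1) (fst z) (snd z)))) < \<infinity>"
      using assms unfolding e nat_total_def by (simp add: esum_prod)
  qed simp
  then have "fredholm_det B = (\<Sum>\<^sub>\<infinity>S\<in>{S. finite S}. principal_minor (B - 1) S)"
    by (simp add: fredholm_det_def)
  also have "\<dots> = (\<Sum>\<^sub>\<infinity>S\<in>{S. finite S}. leibniz_det S (\<lambda>i j. entry B i j - delta i j))"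
    by (rule infsum_cong) (simp add: principal_minor_eq_leibniz_det e)
  finally show ?thesis by (simp add: fredholm_series_def)
qed

section \<open>Asymptotics of the finite sections\<close>

text \<open>The argument is the perturbation alone: the value is det(1 + Z) on the half-line from
  \<open>n\<close>.\<close>

definition fred :: "int \<Rightarrow> int ell2_op \<Rightarrow> complex" where
  "fred n Z = fredholm_series (\<lambda>i j. entry Z (n + int i) (n + int j))"

lemma nat_total_dominated:
  assumes "dominated Z g" shows "nat_total (\<lambda>i j. entry Z (n + int i) (n + int j)) \<le> ktotal g"
proof -
  have inj: "inj (\<lambda>i. n + int i)" by (simp add: inj_on_def)
  have "nat_total (\<lambda>i j. entry Z (n + int i) (n + int j)) \<le> esum (\<lambda>i. esum (\<lambda>j. g (n + int i) (n + int j)))"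
    unfolding nat_total_def using assms by (intro esum_mono) (simp add: dominated_def)
  also have "\<dots> \<le> esum (\<lambda>i. esum (\<lambda>j. g (n + int i) j))"
    by (intro esum_mono esum_inj_le[OF inj])
  also have "\<dots> \<le> ktotal g"
    unfolding ktotal_def using esum_inj_le[OF inj, of "\<lambda>i. esum (\<lambda>j. g i j)"] by simp
  finally show ?thesis .
qed

lemma entry_sum_le_dominated:
  assumes "dominated Z g" "ktotal g \<le> ennreal k" "0 \<le> k"
  shows "entry_sum_le (\<lambda>i j. entry Z (n + int i) (n + int j)) k"
  by (rule entry_sum_le_nat_total[OF order_trans[OF nat_total_dominated[OF assms(1)] assms(2)] assms(3)])

lemma cmod_fred_le:
  assumes "dominated Z g" "ktotal g \<le> ennreal k" "0 \<le> k"
  shows "cmod (fred n Z) \<le> exp k"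
  unfolding fred_def by (rule cmod_fredholm_series_le[OF entry_sum_le_dominated[OF assms]])

lemma cmod_fred_diff_le:
  assumes Z: "dominated Z g" "ktotal g \<le> ennreal k" "0 \<le> k"
    and YZ: "dominated (Y - Z) h" "ktotal h \<le> ennreal d" "0 \<le> d"
  shows "cmod (fred n Y - fred n Z) \<le> exp k * (exp d - 1)"
  unfolding fred_def
proof (rule cmod_fredholm_series_diff_le[OF _ entry_sum_le_dominated[OF Z]])
  have "dominated Y (\<lambda>i j. g i j + h i j)" using dominated_add[OF Z(1) YZ(1)] by simp
  moreover have "ktotal (\<lambda>i j. g i j + h i j) \<le> ennreal (k + d)"
    using Z YZ by (simp add: ktotal_add add_mono)
  ultimately show "entry_sum_le (\<lambda>i j. entry Y (n + int i) (n + int j)) (k + d)"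
    by (rule entry_sum_le_dominated) (use Z YZ in simp)
  show "entry_sum_le (\<lambda>i j. entry Y (n + int i) (n + int j) - entry Z (n + int i) (n + int j)) d"
    using entry_sum_le_dominated[OF YZ, of n] by (simp add: entry_diff)
qed

text \<open>A window determinant becomes a half-line determinant with a perturbation supported in
  the window.\<close>

lemma det_sect_eq_fred: "det (sect n N X) = fred n (compress (window n N) (X - 1))"
proof -
  let ?Z = "compress (window n N) (X - 1)"
  have "det (sect n N X) = leibniz_det {..<N} (\<lambda>i j. delta i j + entry ?Z (n + int i) (n + int j))"
    unfolding det_sect by (rule leibniz_det_cong) (simp add: entry_compress entry_diff entry_one delta_def)
  also have "\<dots> = fred n ?Z"
    unfolding fred_def by (rule fredholm_series_finite_support[symmetric]) (auto simp: entry_compress)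
  finally show ?thesis .
qed

lemma ennreal_seq_real:
  fixes u :: "nat \<Rightarrow> ennreal"
  assumes "u \<longlonglongrightarrow> 0" "\<And>n. u n < \<infinity>"
  obtains v where "v \<longlonglongrightarrow> (0 :: real)" "\<And>n. u n = ennreal (v n)" "\<And>n. 0 \<le> v n"
proof
  show u: "u n = ennreal (enn2real (u n))" for n using assms(2)[of n] by simp
  show "(\<lambda>n. enn2real (u n)) \<longlonglongrightarrow> 0" using tendsto_enn2real[of u 0 sequentially] assms(1) by simp
qed simp

text \<open>Dominated convergence: a fixed majorant of finite total mass upgrades entrywise
  convergence to convergence of the sum of all entries, which controls the determinant.\<close>

lemma fred_tendsto:
  assumes Zn: "\<And>m. dominated (Z m) g" and Z: "dominated L g" and g: "ktotal g < \<infinity>"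
    and lim: "\<And>i j. (\<lambda>m. entry (Z m) i j) \<longlonglongrightarrow> entry L i j"
  shows "(\<lambda>m. fred n (Z m)) \<longlonglongrightarrow> fred n L"
proof -
  define h where "h m i j = ennreal (cmod (entry (Z m - L) i j))" for m i j
  have h: "dominated (Z m - L) (h m)" for m by (simp add: dominated_def h_def)
  have hg: "h m i j \<le> g i j + g i j" for m i j
  proof -
    have "dominated (Z m + - L) (\<lambda>i j. g i j + g i j)"
      by (rule dominated_add[OF Zn]) (simp add: dominated_uminus Z)
    then show ?thesis by (simp add: dominated_def h_def)
  qed
  have gg: "ktotal (\<lambda>i j. g i j + g i j) < \<infinity>" using g by (simp add: ktotal_add)
  have "(\<lambda>m. ktotal (h m)) \<longlonglongrightarrow> 0"
  proof (rule ktotal_tendsto_0[OF gg])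
    show "h m \<le> (\<lambda>i j. g i j + g i j)" for m using hg by (simp add: le_fun_def)
    fix i j
    have "(\<lambda>m. cmod (entry (Z m - L) i j)) \<longlonglongrightarrow> cmod (entry L i j - entry L i j)"
      unfolding entry_diff by (intro tendsto_intros lim)
    then show "(\<lambda>m. h m i j) \<longlonglongrightarrow> 0" unfolding h_def using tendsto_ennrealI by fastforce
  qed
  moreover have "ktotal (h m) < \<infinity>" for m
    using ktotal_mono[of "h m" "\<lambda>i j. g i j + g i j"] hg gg by (simp add: le_fun_def)
  ultimately obtain v where v: "v \<longlonglongrightarrow> 0" "\<And>m. ktotal (h m) = ennreal (v m)" "\<And>m. 0 \<le> v m"
    by (rule ennreal_seq_real) blast
  obtain k where k: "ktotal g = ennreal k" "0 \<le> k" using g by (cases "ktotal g") auto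
  have "(\<lambda>m. fred n (Z m) - fred n L) \<longlonglongrightarrow> 0"
  proof (rule Lim_null_comparison)
    show "\<forall>\<^sub>F m in sequentially. cmod (fred n (Z m) - fred n L) \<le> exp k * (exp (v m) - 1)"
      by (intro always_eventually allI cmod_fred_diff_le[OF Z _ _ h]) (simp_all add: k v)
    have "(\<lambda>m. exp k * (exp (v m) - 1)) \<longlonglongrightarrow> exp k * (exp 0 - 1)" by (intro tendsto_intros v)
    then show "(\<lambda>m. exp k * (exp (v m) - 1)) \<longlonglongrightarrow> 0" by simp
  qed
  then show ?thesis by (simp add: LIM_zero_iff)
qed

lemma corner_mono: "S \<subseteq> S' \<Longrightarrow> D \<subseteq> D' \<Longrightarrow> corner c S D \<le> corner c S' D'"
  unfolding corner_def by (intro kmul_mono kproj_mono order_refl)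

lemma image_diff_atLeast: "(\<lambda>i. i - n) ` {m..} = {m - n :: int..}"
  by (force simp: image_iff intro: bexI[of _ "_ + n"])

lemma image_diff_lessThan: "(\<lambda>i. i - n) ` {..<m} = {..<m - n :: int}"
  by (force simp: image_iff intro: bexI[of _ "_ + n"])

text \<open>Almost periodicity is left behind here: what remains is a common Toeplitz majorant and
  the properties of the weight that control its corners.\<close>

locale dominated_family =
  fixes As :: "int ell2_op list" and f :: kernel and \<alpha> :: "int \<Rightarrow> real"
  assumes dom: "\<And>B. B \<in> set As \<Longrightarrow> dominated B f"
    and toep: "toeplitz f"
    and \<alpha>_ge_1: "\<And>i. 1 \<le> \<alpha> i"
    and \<alpha>_submult: "\<And>i j. \<alpha> (i + j) \<le> \<alpha> i * \<alpha> j"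
    and \<alpha>_0: "\<alpha> 0 = 1"
    and \<alpha>_min: "\<And>p q. 0 \<le> p \<Longrightarrow> 0 \<le> q \<Longrightarrow> of_int (min p q) \<le> \<alpha> p * \<alpha> (- q)"
    and weighted_sum_f: "weighted_sum \<alpha> f < \<infinity>"
begin

text \<open>One majorant for \<open>E S\<close> and \<open>E' S\<close> simultaneously for all
  \<open>S\<close>; \<open>\<rho>\<close> below is the constant of
  \<open>dominated_prod_list_exp_compress_diff\<close>.\<close>

definition c :: kernel where "c = kpow (kexp f) (length As)"

definition \<rho> :: ennreal where "\<rho> = ennreal (2 * length As)"

abbreviation "E S \<equiv> exp_prod S As"

abbreviation "E' S \<equiv> exp_prod_inv S As"

abbreviation through :: "int set \<Rightarrow> kernel" where
  "through D \<equiv> \<lambda>i j. \<rho> * (c \<cdot> kproj D \<cdot> c) i j"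

lemma \<alpha>_nonneg: "0 \<le> \<alpha> i"
  using \<alpha>_ge_1[of i] by linarith

lemma toeplitz_c: "toeplitz c"
  unfolding c_def by (intro toeplitz_kpow toeplitz_kexp toep)

lemma weighted_sum_c: "weighted_sum \<alpha> c < \<infinity>"
proof -
  have "weighted_sum \<alpha> (kexp f) < \<infinity>"
    by (rule weighted_sum_kexp_finite[OF toep \<alpha>_nonneg \<alpha>_submult \<alpha>_0 weighted_sum_f])
  then have "weighted_sum \<alpha> (kexp f) ^ length As < \<infinity>" by (simp add: power_less_top_ennreal)
  with weighted_sum_kpow_le[OF toeplitz_kexp[OF toep] \<alpha>_nonneg \<alpha>_submult \<alpha>_0, of "length As"]
  show ?thesis unfolding c_def by (rule le_less_trans)
qed

lemma finite_toeplitz: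
  assumes g: "toeplitz g" "weighted_sum \<alpha> g < \<infinity>"
  shows "esum (\<lambda>i. g i 0) < \<infinity>" "g i j < \<infinity>"
proof -
  have "esum (\<lambda>i. g i 0) \<le> weighted_sum \<alpha> g"
    unfolding weighted_sum_def
  proof (rule esum_mono)
    fix i
    have "ennreal 1 \<le> ennreal (\<alpha> i)" by (rule ennreal_leI[OF \<alpha>_ge_1])
    from mult_right_mono[OF this, of "g i 0"] show "g i 0 \<le> ennreal (\<alpha> i) * g i 0" by simp
  qed
  also have "\<dots> < \<infinity>" by fact
  finally show 1: "esum (\<lambda>i. g i 0) < \<infinity>" .
  have "g i j = g (i - j) 0" by (rule toeplitz_eq[OF g(1)]) simp
  also have "\<dots> \<le> esum (\<lambda>i. g i 0)" by (rule le_esum)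
  finally show "g i j < \<infinity>" using 1 by simp
qed

lemma kmul_c_finite: "toeplitz g \<Longrightarrow> weighted_sum \<alpha> g < \<infinity> \<Longrightarrow> weighted_sum \<alpha> (g \<cdot> c) < \<infinity>"
proof -
  assume g: "toeplitz g" "weighted_sum \<alpha> g < \<infinity>"
  have "weighted_sum \<alpha> (g \<cdot> c) \<le> weighted_sum \<alpha> g * weighted_sum \<alpha> c"
    by (rule weighted_sum_kmul_le[OF g(1) toeplitz_c \<alpha>_nonneg \<alpha>_submult])
  also have "\<dots> < \<infinity>" using g(2) weighted_sum_c by (simp add: ennreal_mult_less_top)
  finally show ?thesis .
qed

lemma tail_tendsto_0:
  assumes "(g \<cdot> h) i j < \<infinity>"
  shows "(\<lambda>M. (g \<cdot> kproj {b + int M..} \<cdot> h) i j) \<longlonglongrightarrow> 0"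
proof -
  have eq: "(g \<cdot> kproj {b + int M..} \<cdot> h) i j = esum (\<lambda>k. if k \<in> {b + int M..} then g i k * h k j else 0)" for M
    unfolding kmul_def[of "g \<cdot> _"] by (rule esum_cong) (simp add: kmul_kproj)
  show ?thesis unfolding eq
  proof (rule esum_tendsto_0)
    show "esum (\<lambda>k. g i k * h k j) < \<infinity>" using assms by (simp add: kmul_def)
    fix k
    show "(\<lambda>M. if k \<in> {b + int M..} then g i k * h k j else 0) \<longlonglongrightarrow> 0"
      by (rule tendsto_0_eventually_0[of "nat (k - b)"]) auto
  qed auto
qed

section \<open>Majorants of the exponential products and of the perturbations\<close>

lemma dom_E: "dominated (E S) c"
  unfolding exp_prod_def c_def
  using dominated_prod_list_exp[of "map (compress S) As" f] dom by (auto simp: o_def intro: dominated_compress)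

lemma dom_uminus: "B \<in> set (rev (map uminus As)) \<Longrightarrow> dominated B f"
  using dom by (auto simp: dominated_uminus)

lemma dom_E': "dominated (E' S) c"
  unfolding exp_prod_inv_eq exp_prod_def c_def
  using dominated_prod_list_exp[of "map (compress S) (rev (map uminus As))" f] dom_uminus
  by (auto simp: o_def intro: dominated_compress)

lemma dom_E_diff: "T \<subseteq> S \<Longrightarrow> dominated (E S - E T) (through (S - T))"
  unfolding exp_prod_def c_def \<rho>_def by (rule dominated_prod_list_exp_compress_diff[OF dom])

lemma dom_E'_diff: "T \<subseteq> S \<Longrightarrow> dominated (E' S - E' T) (through (S - T))"
  using dominated_prod_list_exp_compress_diff[of "rev (map uminus As)" f T S, OF dom_uminus]
  unfolding exp_prod_inv_eq exp_prod_def c_def \<rho>_def by simp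

text \<open>For \<open>T = UNIV\<close> and \<open>S = {n..}\<close> this is the perturbation inside
  \<open>Theta1\<close> at \<open>tau n\<close>, as \<open>E UNIV\<close> is \<open>A\<close>;
  \<open>Z2\<close> plays the same part for \<open>Theta2\<close>. Other choices of \<open>S\<close>
  and \<open>T\<close> give the intermediate determinants.\<close>

definition Z1 :: "int set \<Rightarrow> int set \<Rightarrow> int ell2_op" where
  "Z1 T S = compress S (E T * proj_op S * E' S - 1)"

definition Z2 :: "int set \<Rightarrow> int set \<Rightarrow> int ell2_op" where
  "Z2 T S = compress S (E S * proj_op S * E' T - 1)"

definition g1 :: "int set \<Rightarrow> int set \<Rightarrow> kernel" where
  "g1 S D i j = \<rho> * (corner c S D \<cdot> c) i j"

definition g2 :: "int set \<Rightarrow> int set \<Rightarrow> kernel" where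
  "g2 S D i j = \<rho> * (c \<cdot> corner c S D) i j"

lemma compress_1: "compress S (X - 1) = proj_op S * X * proj_op S - proj_op S"
  by (simp add: compress_def algebra_simps)

text \<open>Subtracting \<open>E S * proj_op S * E' S = proj_op S\<close> replaces
  \<open>E T\<close> by \<open>E T - E S\<close>, whose paths visit \<open>T - S\<close> between two
  stays in \<open>S\<close>; this is how the corner arises.\<close>

lemma Z1_eq: "Z1 T S = proj_op S * (E T - E S) * proj_op S * E' S * proj_op S"
proof -
  have "proj_op S * (E S * proj_op S * E' S) * proj_op S = proj_op S"
    unfolding exp_prod_proj_inv by simp
  then show ?thesis unfolding Z1_def compress_1 by (simp add: algebra_simps)
qed

lemma Z2_diff_eq: "Z2 T S - Z2 T' S = proj_op S * E S * proj_op S * (E' T - E' T') * proj_op S"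
  unfolding Z2_def compress_1 by (simp add: algebra_simps)

lemma Z2_self: "Z2 S S = 0"
  unfolding Z2_def compress_1 exp_prod_proj_inv by simp

lemma kernel_step1: "kproj S \<cdot> through D \<cdot> kproj S \<cdot> c \<cdot> kproj S \<le> g1 S D"
  using kmul_kproj_le[of "corner c S D \<cdot> c" S]
  by (auto simp: le_fun_def g1_def kmul_scale_left kmul_scale_right corner_def kmul_assoc intro: mult_left_mono)

lemma kernel_step2: "kproj S \<cdot> c \<cdot> kproj S \<cdot> through D \<cdot> kproj S \<le> g2 S D"
  using kproj_kmul_le[of S "c \<cdot> corner c S D"]
  by (auto simp: le_fun_def g2_def kmul_scale_left kmul_scale_right corner_def kmul_assoc intro: mult_left_mono)

lemma g1_mono: "S \<subseteq> S' \<Longrightarrow> D \<subseteq> D' \<Longrightarrow> g1 S D \<le> g1 S' D'"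
  using kmul_mono[OF corner_mono order_refl, of S S' D D' c c]
  by (auto simp: le_fun_def g1_def intro!: mult_left_mono)

lemma g2_mono: "S \<subseteq> S' \<Longrightarrow> D \<subseteq> D' \<Longrightarrow> g2 S D \<le> g2 S' D'"
  using kmul_mono[OF order_refl corner_mono, of S S' D D' c c]
  by (auto simp: le_fun_def g2_def intro!: mult_left_mono)

lemma dom_Z1: "S \<subseteq> T \<Longrightarrow> dominated (Z1 T S) (g1 S (T - S))"
  unfolding Z1_eq by (rule dominated_mono[OF _ kernel_step1]) (intro dominated_mult dominated_proj_op dom_E_diff dom_E')

lemma dom_Z2_diff: "T' \<subseteq> T \<Longrightarrow> dominated (Z2 T S - Z2 T' S) (g2 S (T - T'))"
  unfolding Z2_diff_eq by (rule dominated_mono[OF _ kernel_step2]) (intro dominated_mult dominated_proj_op dom_E'_diff dom_E)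

lemma dom_Z2: "S \<subseteq> T \<Longrightarrow> dominated (Z2 T S) (g2 S (T - S))"
  using dom_Z2_diff[of S T S] by (simp add: Z2_self)

lemma dom_Z1_right: "dominated (Z1 UNIV {n..}) (g1 {n..} {..<n})"
  by (rule dominated_mono[OF dom_Z1 g1_mono]) auto

lemma dom_Z2_right: "{n..} \<subseteq> T \<Longrightarrow> dominated (Z2 T {n..}) (g2 {n..} {..<n})"
  by (rule dominated_mono[OF dom_Z2 g2_mono]) auto

abbreviation "csum \<equiv> esum (\<lambda>i. c i 0)"

lemma ktotal_g1_le: "ktotal (g1 S D) \<le> \<rho> * (ktotal (corner c S D) * csum)"
  unfolding g1_def[abs_def] ktotal_scale by (intro mult_left_mono ktotal_kmul_le toeplitz_c) simp

lemma ktotal_g2_le: "ktotal (g2 S D) \<le> \<rho> * (csum * ktotal (corner c S D))"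
  unfolding g2_def[abs_def] ktotal_scale by (intro mult_left_mono ktotal_kmul_le' toeplitz_c) simp

lemma csum_finite: "csum < \<infinity>"
  by (rule finite_toeplitz[OF toeplitz_c weighted_sum_c])

text \<open>By translation and reflection, the mass of the corner at every cut and in either
  direction.\<close>

definition \<psi> :: ennreal where "\<psi> = ktotal (corner c {0..} {..<0})"

lemma \<psi>_finite: "\<psi> < \<infinity>"
proof -
  have "\<psi> \<le> weighted_sum \<alpha> c * weighted_sum \<alpha> c"
    unfolding \<psi>_def by (rule ktotal_corner_le[OF toeplitz_c \<alpha>_nonneg \<alpha>_min])
  also have "\<dots> < \<infinity>" using weighted_sum_c by (simp add: ennreal_mult_less_top)
  finally show ?thesis .
qed

lemma ktotal_corner_right: "ktotal (corner c {n..} {..<n}) = \<psi>"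
  using ktotal_corner_shift[OF toeplitz_c, of n "{n..}" "{..<n}"]
  by (simp add: \<psi>_def image_diff_atLeast image_diff_lessThan)

lemma ktotal_corner_left: "ktotal (corner c {..<n} {n..}) = \<psi>"
  using ktotal_corner_shift[OF toeplitz_c, of n "{..<n}" "{n..}"] ktotal_corner_reflect[OF toeplitz_c]
  by (simp add: \<psi>_def image_diff_atLeast image_diff_lessThan)

text \<open>One real bound for all perturbations; \<open>\<psi> + \<psi>\<close> because a window
  has two ends.\<close>

definition \<kappa> :: real where "\<kappa> = enn2real (\<rho> * ((\<psi> + \<psi>) * csum))"

lemma \<kappa>: "\<rho> * ((\<psi> + \<psi>) * csum) = ennreal \<kappa>" "0 \<le> \<kappa>"
  using \<psi>_finite csum_finite by (simp_all add: \<kappa>_def \<rho>_def ennreal_mult_less_top)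

lemma \<psi>_le: "\<rho> * (\<psi> * csum) \<le> ennreal \<kappa>"
  unfolding \<kappa>(1)[symmetric] by (intro mult_left_mono mult_right_mono) simp_all

lemma ktotal_g1_right: "ktotal (g1 {n..} {..<n}) \<le> ennreal \<kappa>"
  using ktotal_g1_le[of "{n..}" "{..<n}"] \<psi>_le by (simp add: ktotal_corner_right)

lemma ktotal_g2_right: "ktotal (g2 {n..} {..<n}) \<le> ennreal \<kappa>"
  using ktotal_g2_le[of "{n..}" "{..<n}"] \<psi>_le by (simp add: ktotal_corner_right mult.commute[of csum])

text \<open>The complement of a window consists of two half-lines. For each of them the window is
  enlarged to the opposite half-line, which leaves one half-line corner per end.\<close>

lemma ktotal_g1_window: "ktotal (g1 (window n N) (UNIV - window n N)) \<le> ennreal \<kappa>"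
proof -
  let ?J = "window n N" and ?m = "n + int N"
  have "corner c ?J (UNIV - ?J) i j \<le> corner c {n..} {..<n} i j + corner c {..<?m} {?m..} i j" for i j
    unfolding corner_eq esum_add[symmetric] by (rule esum_mono) auto
  then have "ktotal (corner c ?J (UNIV - ?J)) \<le> ktotal (\<lambda>i j. corner c {n..} {..<n} i j + corner c {..<?m} {?m..} i j)"
    by (intro ktotal_mono) (simp add: le_fun_def)
  also have "\<dots> = \<psi> + \<psi>" by (simp only: ktotal_add ktotal_corner_right ktotal_corner_left)
  finally have "\<rho> * (ktotal (corner c ?J (UNIV - ?J)) * csum) \<le> ennreal \<kappa>"
    unfolding \<kappa>(1)[symmetric] by (intro mult_left_mono mult_right_mono) simp_all
  with ktotal_g1_le show ?thesis by (rule order_trans)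
qed

section \<open>Tail estimates uniform in the position\<close>

lemma det_sect_left:
  "det (sect n N (E UNIV * proj_op {n..} * E' {n..})) = fred n (compress (window n N) (Z1 UNIV {n..}))"
  unfolding det_sect_eq_fred fred_def
  by (rule arg_cong[of _ _ fredholm_series]) (auto simp: fun_eq_iff Z1_def entry_compress)

text \<open>The majorant at the cut \<open>n\<close> is a translate of the one at 0, so a single
  null sequence controls what lies beyond distance \<open>N\<close>. The last bound, on columns
  alone, is prepared for \<open>finite_section_factor_error\<close>.\<close>

lemma fred_left_tail:
  obtains v where "v \<longlonglongrightarrow> (0 :: real)" "\<And>N. 0 \<le> v N"
    "\<And>n N. cmod (fred n (compress (window n N) (Z1 UNIV {n..})) - fred n (Z1 UNIV {n..})) \<le> exp \<kappa> * (exp (v N) - 1)"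
    "\<And>n N. ktotal (g1 {n..} {..<n} \<cdot> kproj {n + int N..}) \<le> ennreal (v N)"
proof -
  define u where "u N i j = (if i \<ge> int N \<or> j \<ge> int N then g1 {0..} {..<0} i j else 0)" for N i j
  have fin: "ktotal (g1 {0..} {..<0}) < \<infinity>" using ktotal_g1_right[of 0] by (simp add: le_less_trans)
  have le: "u N \<le> g1 {0..} {..<0}" for N by (auto simp: u_def le_fun_def)
  have "(\<lambda>N. ktotal (u N)) \<longlonglongrightarrow> 0"
  proof (rule ktotal_tendsto_0[OF fin le])
    fix i j
    show "(\<lambda>N. u N i j) \<longlonglongrightarrow> 0"
      by (rule tendsto_0_eventually_0[of "nat (max i j)"]) (auto simp: u_def)
  qed
  moreover have "ktotal (u N) < \<infinity>" for N using ktotal_mono[OF le] fin by (rule le_less_trans)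
  ultimately obtain v where v: "v \<longlonglongrightarrow> 0" "\<And>N. ktotal (u N) = ennreal (v N)" "\<And>N. 0 \<le> v N"
    by (rule ennreal_seq_real) blast
  define h where "h n N i j = (if i \<ge> n + int N \<or> j \<ge> n + int N then g1 {n..} {..<n} i j else 0)" for n N i j
  have g1_shift: "g1 {n..} {..<n} (i + n) (j + n) = g1 {0..} {..<0} i j" for n i j
  proof -
    have c: "(\<lambda>i j. c (i + n) (j + n)) = c" using toeplitz_c by (simp add: toeplitz_def fun_eq_iff)
    have "(\<lambda>i j. (corner c {n..} {..<n} \<cdot> c) (i + n) (j + n)) = corner c {0..} {..<0} \<cdot> c"
      unfolding kmul_shift corner_shift[OF toeplitz_c] c image_diff_atLeast image_diff_lessThan by simp
    from fun_cong[OF fun_cong[OF this], of i j] show ?thesis by (simp add: g1_def)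
  qed
  have h: "ktotal (h n N) = ennreal (v N)" for n N
  proof -
    have "(\<lambda>i j. h n N (i + n) (j + n)) = u N"
      by (auto simp: h_def u_def g1_shift fun_eq_iff)
    then show ?thesis using ktotal_shift[of "h n N" n] v(2) by simp
  qed
  show thesis
  proof
    fix n N
    note Z = dom_Z1_right[of n]
    have "dominated (compress (window n N) (Z1 UNIV {n..}) - Z1 UNIV {n..}) (h n N)"
      unfolding dominated_def
    proof (intro allI)
      fix i j
      have "entry (Z1 UNIV {n..}) i j = 0" if "i < n \<or> j < n" using that by (auto simp: Z1_def entry_compress)
      moreover have "ennreal (cmod (entry (Z1 UNIV {n..}) i j)) \<le> g1 {n..} {..<n} i j"
        using Z by (simp add: dominated_def)
      ultimately show "ennreal (cmod (entry (compress (window n N) (Z1 UNIV {n..}) - Z1 UNIV {n..}) i j)) \<le> h n N i j"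
        by (cases "i < n \<or> j < n") (auto simp: entry_diff entry_compress h_def)
    qed
    then show "cmod (fred n (compress (window n N) (Z1 UNIV {n..})) - fred n (Z1 UNIV {n..})) \<le> exp \<kappa> * (exp (v N) - 1)"
      using cmod_fred_diff_le[OF Z ktotal_g1_right \<kappa>(2)] h v(3) by (metis order_refl)
    have "g1 {n..} {..<n} \<cdot> kproj {n + int N..} \<le> h n N"
      by (auto simp: le_fun_def kmul_kproj h_def)
    from ktotal_mono[OF this] show "ktotal (g1 {n..} {..<n} \<cdot> kproj {n + int N..}) \<le> ennreal (v N)"
      by (simp add: h)
  qed (use v in auto)
qed

text \<open>Replacing \<open>{n..}\<close> by the whole line in \<open>E'\<close> only adds paths
  through \<open>{..<n}\<close>, which are at distance \<open>N\<close> from the half-line on which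
  the determinant is taken.\<close>

lemma fred_right_tail:
  obtains v where "v \<longlonglongrightarrow> (0 :: real)"
    "\<And>n N. cmod (fred (n + int N) (Z2 {n..} {n + int N..}) - fred (n + int N) (Z2 UNIV {n + int N..})) \<le> exp \<kappa> * (exp (v N) - 1)"
proof -
  \<comment> \<open>\<open>{..<- int N}\<close> is the half-line \<open>{..<n}\<close> seen from the
    cut \<open>n + int N\<close>.\<close>
  define u where "u N = g2 {0..} {..<- int N}" for N
  have fin: "ktotal (g2 {0..} {..<0}) < \<infinity>" using ktotal_g2_right[of 0] by (simp add: le_less_trans)
  have le: "u N \<le> g2 {0..} {..<0}" for N unfolding u_def by (rule g2_mono) auto
  have cfin: "ktotal (corner c {0..} {..<0}) < \<infinity>" using \<psi>_finite by (simp add: \<psi>_def)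
  have corner0: "(\<lambda>N. ktotal (corner c {0..} {..<- int N})) \<longlonglongrightarrow> 0"
  proof (rule ktotal_tendsto_0[OF cfin])
    show "corner c {0..} {..<- int N} \<le> corner c {0..} {..<0}" for N by (rule corner_mono) auto
    fix i j
    show "(\<lambda>N. corner c {0..} {..<- int N} i j) \<longlonglongrightarrow> 0"
      unfolding corner_eq
    proof (rule esum_tendsto_0)
      have "corner c {0..} {..<0} i j \<le> esum (\<lambda>j. corner c {0..} {..<0} i j)" by (rule le_esum)
      also have "\<dots> \<le> ktotal (corner c {0..} {..<0})" unfolding ktotal_def by (rule le_esum)
      finally show "esum (\<lambda>l. if i \<in> {0..} \<and> j \<in> {0..} \<and> l \<in> {..<0} then c i l * c l j else 0) < \<infinity>"
        using cfin unfolding corner_eq[symmetric] by (rule le_less_trans)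
      fix l :: int
      show "(\<lambda>N. if i \<in> {0..} \<and> j \<in> {0..} \<and> l \<in> {..<- int N} then c i l * c l j else 0) \<longlonglongrightarrow> 0"
        by (rule tendsto_0_eventually_0[of "nat (- l)"]) auto
    qed auto
  qed
  have "(\<lambda>N. \<rho> * (csum * ktotal (corner c {0..} {..<- int N}))) \<longlonglongrightarrow> \<rho> * (csum * 0)"
    by (intro ennreal_tendsto_cmult corner0) (use csum_finite in \<open>simp_all add: \<rho>_def\<close>)
  then have lim: "(\<lambda>N. \<rho> * (csum * ktotal (corner c {0..} {..<- int N}))) \<longlonglongrightarrow> 0" by simp
  have "(\<lambda>N. ktotal (u N)) \<longlonglongrightarrow> 0"
    by (rule tendsto_sandwich[OF _ _ tendsto_const lim]) (simp_all add: u_def ktotal_g2_le)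
  moreover have "ktotal (u N) < \<infinity>" for N using ktotal_mono[OF le] fin by (rule le_less_trans)
  ultimately obtain v where v: "v \<longlonglongrightarrow> 0" "\<And>N. ktotal (u N) = ennreal (v N)" "\<And>N. 0 \<le> v N"
    by (rule ennreal_seq_real) blast
  show thesis
  proof
    fix n N
    let ?m = "n + int N"
    have g2_shift: "ktotal (g2 {?m..} {..<n}) = ktotal (u N)"
    proof -
      have c: "(\<lambda>i j. c (i + ?m) (j + ?m)) = c" using toeplitz_c by (simp add: toeplitz_def fun_eq_iff)
      have "(\<lambda>i j. (c \<cdot> corner c {?m..} {..<n}) (i + ?m) (j + ?m)) = c \<cdot> corner c {0..} {..<- int N}"
        unfolding kmul_shift corner_shift[OF toeplitz_c] c image_diff_atLeast image_diff_lessThan by simp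
      then have "(\<lambda>i j. g2 {?m..} {..<n} (i + ?m) (j + ?m)) = u N"
        by (simp add: g2_def[abs_def] u_def fun_eq_iff)
      then show ?thesis using ktotal_shift[of "g2 {?m..} {..<n}" ?m] by simp
    qed
    note Z = dom_Z2_right[of ?m UNIV, OF subset_UNIV]
    have "dominated (Z2 {n..} {?m..} - Z2 UNIV {?m..}) (g2 {?m..} {..<n})"
      using dom_Z2_diff[of "{n..}" UNIV "{?m..}"]
      by (subst minus_diff_eq[symmetric]) (simp add: dominated_uminus Compl_eq_Diff_UNIV[symmetric] del: minus_diff_eq)
    then show "cmod (fred ?m (Z2 {n..} {?m..}) - fred ?m (Z2 UNIV {?m..})) \<le> exp \<kappa> * (exp (v N) - 1)"
      using cmod_fred_diff_le[OF Z ktotal_g2_right \<kappa>(2)] g2_shift v(2,3) by (metis order_refl)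
  qed (rule v)
qed

section \<open>The second factor as a half-line determinant\<close>

lemma entry_tendsto_dominated:
  assumes "\<And>M. dominated (X M - L) (h M)" "(\<lambda>M. h M i j) \<longlonglongrightarrow> 0"
  shows "(\<lambda>M :: nat. entry (X M) i j) \<longlonglongrightarrow> entry L i j"
proof -
  have "(\<lambda>M. ennreal (cmod (entry (X M - L) i j))) \<longlonglongrightarrow> 0"
    by (rule tendsto_sandwich[OF _ _ tendsto_const assms(2)]) (use assms(1) in \<open>auto simp: dominated_def\<close>)
  then have "(\<lambda>M. cmod (entry (X M - L) i j)) \<longlonglongrightarrow> 0"
    using tendsto_enn2real[of "\<lambda>M. ennreal (cmod (entry (X M - L) i j))" 0] by simp
  then show ?thesis by (simp add: entry_diff tendsto_norm_zero_iff LIM_zero_iff)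
qed

lemma weighted_sum_cc: "weighted_sum \<alpha> (c \<cdot> c) < \<infinity>"
  by (rule kmul_c_finite[OF toeplitz_c weighted_sum_c])

lemma weighted_sum_ccc: "weighted_sum \<alpha> (c \<cdot> c \<cdot> c) < \<infinity>"
  by (rule kmul_c_finite[OF toeplitz_kmul[OF toeplitz_c toeplitz_c] weighted_sum_cc])

lemma finite_cc: "(c \<cdot> c) i j < \<infinity>" and finite_ccc: "(c \<cdot> c \<cdot> c) i j < \<infinity>"
  using finite_toeplitz(2)[OF _ weighted_sum_cc] finite_toeplitz(2)[OF _ weighted_sum_ccc]
  by (simp_all add: toeplitz_kmul toeplitz_c)

text \<open>Jacobi's identity is applied to the finite windows \<open>W M\<close> that exhaust
  \<open>{n..}\<close>. On one side stands a matrix of fixed size with convergent entries; on the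
  other the size grows and \<open>fred_tendsto\<close> is needed.\<close>

lemma fred_duality_limit:
  "det (sect n N (E {n..} * proj_op (window n N) * E' (window n N))) = fred (n + int N) (Z2 {n..} {n + int N..})"
proof -
  define m where "m = n + int N"
  define W where "W M = window n (N + M)" for M
  define J' where "J' M = window m M" for M
  define J where "J = window n N"
  let ?D = "\<lambda>M. kproj {m + int M..}"
  let ?T = "\<lambda>M i j. \<rho> * (c \<cdot> ?D M \<cdot> (c \<cdot> c)) i j" and ?T' = "\<lambda>M i j. \<rho> * (c \<cdot> c \<cdot> ?D M \<cdot> c) i j"
  have sets: "W M \<subseteq> {n..}" "{n..} - W M = {m + int M..}" "J' M \<subseteq> W M" "J' M \<subseteq> {m..}" "{m..} - J' M = {m + int M..}"
    "W M - J' M \<subseteq> {..<m}" "J' M \<inter> {m + int M..} = {}" "J' M \<union> {m + int M..} = {m..}" for M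
    by (auto simp: W_def J'_def m_def)
  have tail1: "(\<lambda>M. (c \<cdot> ?D M \<cdot> c) i j) \<longlonglongrightarrow> 0" for i j
    by (rule tail_tendsto_0[OF finite_cc])
  have tail2: "(\<lambda>M. (c \<cdot> ?D M \<cdot> (c \<cdot> c)) i j) \<longlonglongrightarrow> 0" for i j
    by (rule tail_tendsto_0) (use finite_ccc in \<open>simp add: kmul_assoc\<close>)
  have tail3: "(\<lambda>M. (c \<cdot> c \<cdot> ?D M \<cdot> c) i j) \<longlonglongrightarrow> 0" for i j
    by (rule tail_tendsto_0[OF finite_ccc])
  have scale: "(\<lambda>M. \<rho> * h M) \<longlonglongrightarrow> 0" if "h \<longlonglongrightarrow> 0" for h :: "nat \<Rightarrow> ennreal"
    using ennreal_tendsto_cmult[OF _ that, of \<rho>] by (simp add: \<rho>_def)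
  have less_c: "f \<cdot> kproj S \<cdot> c \<le> f \<cdot> c" for f S
    by (intro kmul_mono kmul_kproj_le order_refl)
  \<comment> \<open>The common value of both sides of the duality on \<open>W M\<close>; its limit
    is computed twice.\<close>
  define dd where "dd M = det (sect n N (E (W M) * proj_op J * E' J))" for M
  have dd: "dd M = fred m (Z2 (W M) (J' M))" for M
    unfolding dd_def m_def
    by (subst det_sect_duality[OF W_def J_def]) (simp_all add: det_sect_eq_fred Z2_def J'_def m_def)
  have "dd \<longlonglongrightarrow> det (sect n N (E {n..} * proj_op J * E' J))"
  proof -
    have "(\<lambda>M. entry (E (W M) * proj_op J * E' J) i j) \<longlonglongrightarrow> entry (E {n..} * proj_op J * E' J) i j" for i j
    proof (rule entry_tendsto_dominated)
      fix M
      have "dominated (E {n..} - E (W M)) (through {m + int M..})"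
        using dom_E_diff[OF sets(1)] by (simp only: sets)
      then have "dominated (- (E {n..} - E (W M)) * proj_op J * E' J)
          ((through {m + int M..}) \<cdot> kproj J \<cdot> c)"
        by (intro dominated_mult dominated_proj_op dom_E') (simp only: dominated_uminus)
      then have "dominated (- (E {n..} - E (W M)) * proj_op J * E' J)
          ((through {m + int M..}) \<cdot> c)"
        by (rule dominated_mono) (rule less_c)
      then show "dominated (E (W M) * proj_op J * E' J - E {n..} * proj_op J * E' J)
          (?T M)"
        by (simp add: algebra_simps kmul_scale_left kmul_assoc)
    qed (rule scale[OF tail2])
    then show ?thesis unfolding dd_def det_sect leibniz_det_def by (intro tendsto_intros)
  qed
  moreover have "dd \<longlonglongrightarrow> fred m (Z2 {n..} {m..})"
    unfolding dd
  proof (rule fred_tendsto)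
    show "dominated (Z2 (W M) (J' M)) (g2 {m..} {..<m})" for M
      \<comment> \<open>Since \<open>W M - J' M\<close> lies in \<open>{..<m}\<close>, the majorant
        does not depend on \<open>M\<close>.\<close>
      using dom_Z2[OF sets(3)] by (rule dominated_mono) (intro g2_mono sets)
    show "dominated (Z2 {n..} {m..}) (g2 {m..} {..<m})"
      by (rule dom_Z2_right) (simp add: m_def)
    show "ktotal (g2 {m..} {..<m}) < \<infinity>" using ktotal_g2_right[of m] by (simp add: le_less_trans)
    fix i j
    let ?X = "\<lambda>M. E (J' M) * proj_op (J' M) * E' (W M)" and ?L = "E {m..} * proj_op {m..} * E' {n..}"
    have X: "(\<lambda>M. entry (?X M) i j) \<longlonglongrightarrow> entry ?L i j"
    proof (rule entry_tendsto_dominated)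
      fix M
      let ?p = "proj_op (J' M)" and ?q = "proj_op {m + int M..}"
      have pq: "proj_op {m..} = ?p + ?q" using proj_op_Un[OF sets(7)] by (simp only: sets)
      \<comment> \<open>Three deviations: \<open>E\<close> built on \<open>J' M\<close> instead of
        \<open>{m..}\<close>, the projection cut off at \<open>m + int M\<close>, and
        \<open>E'\<close> built on \<open>W M\<close> instead of \<open>{n..}\<close>. Each passes
        through \<open>{m + int M..}\<close>.\<close>
      have eq: "?X M - ?L = - ((E {m..} - E (J' M)) * ?p * E' (W M) + E {m..} * ?q * E' (W M)
          + E {m..} * proj_op {m..} * (E' {n..} - E' (W M)))"
        unfolding pq by (simp add: algebra_simps)
      have a: "dominated (E {m..} - E (J' M)) (through {m + int M..})"
        using dom_E_diff[OF sets(4)] by (simp only: sets)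
      have b: "dominated (E' {n..} - E' (W M)) (through {m + int M..})"
        using dom_E'_diff[OF sets(1)] by (simp only: sets)
      have A: "dominated ((E {m..} - E (J' M)) * ?p * E' (W M)) (?T M)"
      proof (rule dominated_mono)
        show "dominated ((E {m..} - E (J' M)) * ?p * E' (W M)) ((through {m + int M..}) \<cdot> kproj (J' M) \<cdot> c)"
          by (intro dominated_mult dominated_proj_op dom_E' a)
        show "(through {m + int M..}) \<cdot> kproj (J' M) \<cdot> c \<le> (?T M)"
          by (rule order_trans[OF less_c]) (simp add: kmul_scale_left kmul_assoc)
      qed
      have B: "dominated (E {m..} * ?q * E' (W M)) (c \<cdot> ?D M \<cdot> c)"
        by (intro dominated_mult dominated_proj_op dom_E' dom_E)
      have C: "dominated (E {m..} * proj_op {m..} * (E' {n..} - E' (W M))) (?T' M)"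
      proof (rule dominated_mono)
        show "dominated (E {m..} * proj_op {m..} * (E' {n..} - E' (W M))) (c \<cdot> kproj {m..} \<cdot> (through {m + int M..}))"
          by (intro dominated_mult dominated_proj_op dom_E b)
        show "c \<cdot> kproj {m..} \<cdot> (through {m + int M..}) \<le> (?T' M)"
          by (rule order_trans[OF kmul_mono[OF kmul_kproj_le order_refl]]) (simp add: kmul_scale_right kmul_assoc)
      qed
      show "dominated (?X M - ?L) (\<lambda>i j. ?T M i j + (c \<cdot> ?D M \<cdot> c) i j + ?T' M i j)"
        unfolding eq dominated_uminus by (intro dominated_add A B C)
    next
      show "(\<lambda>M. ?T M i j + (c \<cdot> ?D M \<cdot> c) i j + ?T' M i j) \<longlonglongrightarrow> 0"
        using tendsto_add[OF tendsto_add[OF scale[OF tail2] tail1] scale[OF tail3], of i j i j i j] by simp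
    qed
    show "(\<lambda>M. entry (Z2 (W M) (J' M)) i j) \<longlonglongrightarrow> entry (Z2 {n..} {m..}) i j"
    proof (cases "m \<le> i \<and> m \<le> j")
      case True
      \<comment> \<open>Once \<open>M\<close> is large, both \<open>i\<close> and \<open>j\<close>
        lie in \<open>J' M\<close>, where the compression leaves the entry unchanged.\<close>
      have "\<forall>\<^sub>F M in sequentially. nat (max (i - m) (j - m)) < M" by (rule eventually_gt_at_top)
      then have ev: "\<forall>\<^sub>F M in sequentially. entry (?X M) i j - entry 1 i j = entry (Z2 (W M) (J' M)) i j"
      proof eventually_elim
        case (elim M)
        then have "i \<in> J' M" "j \<in> J' M" using True by (auto simp: J'_def)
        then show ?case by (simp add: Z2_def entry_compress entry_diff)
      qed
      have "(\<lambda>M. entry (?X M) i j - entry 1 i j) \<longlonglongrightarrow> entry ?L i j - entry 1 i j"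
        by (intro tendsto_intros X)
      from Lim_transform_eventually[OF this ev] show ?thesis
        using True by (simp add: Z2_def entry_compress entry_diff)
    next
      case False
      then show ?thesis by (auto simp: Z2_def entry_compress J'_def)
    qed
  qed
  ultimately show ?thesis using LIMSEQ_unique by (auto simp: J_def m_def)
qed

section \<open>Factorisation of the window determinant\<close>

lemma det_sect_factor:
  fixes n :: int and N :: nat
  defines "J \<equiv> window n N"
  shows "det (sect n N (E UNIV * proj_op {n..} * E' {n..})) * det (sect n N (E {n..} * proj_op J * E' J))
      = fred n (compress J (E UNIV * proj_op {n..} * E' {n..} * proj_op J * (E {n..} * proj_op J * E' J) - 1))"
  unfolding J_def det_sect_eq_fred[symmetric] sect_mult by (rule det_mult[symmetric, of _ N]) (auto intro: mult_carrier_mat[where n = N])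

text \<open>With the projection onto \<open>{n..}\<close> between the factors, the inner
  exponentials cancel and the product is exactly \<open>E UNIV * proj_op J * E' J\<close>.
  Multiplying sections inserts \<open>proj_op J\<close> instead; the defect runs through
  \<open>{n + int N..}\<close>.\<close>

lemma finite_section_factor_error:
  fixes n :: int and N :: nat
  defines "J \<equiv> window n N"
  defines "Y \<equiv> compress J (E UNIV * proj_op {n..} * E' {n..} * proj_op J * (E {n..} * proj_op J * E' J) - 1)"
  shows "dominated (Y - Z1 UNIV J) (g1 {n..} {..<n} \<cdot> kproj {n + int N..} \<cdot> (c \<cdot> c))"
proof -
  let ?p = "proj_op J" and ?q = "proj_op {n + int N..}" and ?h = "proj_op {n..}"
  have hpq: "?h = ?p + ?q"
  proof -
    have "J \<inter> {n + int N..} = {}" "J \<union> {n + int N..} = {n..}" by (auto simp: J_def)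
    then show ?thesis using proj_op_Un by metis
  qed
  have hp: "?h * ?p = ?p" "?p * ?h = ?p" "?h * ?q = ?q" "?p * ?q = 0"
  proof -
    have s: "{n..} \<inter> J = J" "J \<inter> {n..} = J" "{n..} \<inter> {n + int N..} = {n + int N..}" "J \<inter> {n + int N..} = {}"
      by (auto simp: J_def)
    have "proj_op {} = (0 :: int ell2_op)" by (rule op_eqI) (simp add: entry_proj_op entry_zero)
    then show "?h * ?p = ?p" "?p * ?h = ?p" "?h * ?q = ?q" "?p * ?q = 0"
      by (simp_all add: proj_op_mult_proj_op s)
  qed
  have "E UNIV * ?h * E' {n..} * ?h * (E {n..} * ?p * E' J) = E UNIV * ?h * (E' {n..} * ?h * E {n..}) * ?p * E' J"
    by (simp only: mult.assoc)
  also have "\<dots> = E UNIV * (?h * (?h * ?p)) * E' J" unfolding exp_prod_inv_proj by (simp only: mult.assoc)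
  also have "\<dots> = E UNIV * ?p * E' J" by (simp only: hp)
  finally have full: "E UNIV * ?h * E' {n..} * ?h * (E {n..} * ?p * E' J) = E UNIV * ?p * E' J" .
  have "E UNIV * ?p * E' J = E UNIV * ?h * E' {n..} * (?p + ?q) * (E {n..} * ?p * E' J)"
    using full by (simp only: flip: hpq)
  then have UV: "E UNIV * ?h * E' {n..} * ?p * (E {n..} * ?p * E' J) - E UNIV * ?p * E' J
      = - (E UNIV * ?h * E' {n..} * ?q * (E {n..} * ?p * E' J))"
    by (simp add: algebra_simps)
  have "Y - Z1 UNIV J = ?p * (E UNIV * ?h * E' {n..} * ?p * (E {n..} * ?p * E' J) - E UNIV * ?p * E' J) * ?p"
    unfolding Y_def Z1_def compress_def by (simp add: algebra_simps)
  also have "\<dots> = - (?p * (E UNIV * ?h * E' {n..} * ?q * (E {n..} * ?p * E' J)) * ?p)"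
    unfolding UV by simp
  \<comment> \<open>Because \<open>?p * ?q = 0\<close>, the identity drops out and the first factor
    becomes its perturbation \<open>Z1\<close>, whose columns far from \<open>n\<close> have small
    mass.\<close>
  also have "?p * (E UNIV * ?h * E' {n..} * ?q * (E {n..} * ?p * E' J)) * ?p
      = ?p * Z1 UNIV {n..} * ?q * (E {n..} * ?p * E' J) * ?p"
  proof -
    have "?p * Z1 UNIV {n..} * ?q = (?p * ?h) * (E UNIV * ?h * E' {n..}) * (?h * ?q) - (?p * ?h) * ?q"
      unfolding Z1_def compress_1 by (simp only: algebra_simps)
    also have "\<dots> = ?p * (E UNIV * ?h * E' {n..}) * ?q" unfolding hp by simp
    finally show ?thesis by (simp only: mult.assoc)
  qed
  finally have eq: "Y - Z1 UNIV J = - (?p * Z1 UNIV {n..} * ?q * (E {n..} * ?p * E' J) * ?p)" .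
  note Z = dom_Z1_right[of n]
  let ?g = "g1 {n..} {..<n}" and ?Q = "kproj {n + int N..}"
  have "dominated (Y - Z1 UNIV J) (kproj J \<cdot> ?g \<cdot> ?Q \<cdot> (c \<cdot> kproj J \<cdot> c) \<cdot> kproj J)"
    unfolding eq dominated_uminus by (intro dominated_mult dominated_proj_op Z dom_E dom_E')
  then show ?thesis
  proof (rule dominated_mono)
    have "kproj J \<cdot> ?g \<cdot> ?Q \<cdot> (c \<cdot> kproj J \<cdot> c) \<cdot> kproj J \<le> kproj J \<cdot> ?g \<cdot> ?Q \<cdot> (c \<cdot> kproj J \<cdot> c)"
      by (rule kmul_kproj_le)
    also have "\<dots> \<le> ?g \<cdot> ?Q \<cdot> (c \<cdot> c)"
      by (intro kmul_mono kproj_kmul_le kmul_kproj_le order_refl)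
    finally show "kproj J \<cdot> ?g \<cdot> ?Q \<cdot> (c \<cdot> kproj J \<cdot> c) \<cdot> kproj J \<le> ?g \<cdot> ?Q \<cdot> (c \<cdot> c)" .
  qed
qed

lemma finite_section_asymptotics:
  obtains b where "b \<longlonglongrightarrow> (0 :: real)"
    "\<And>n N. cmod (det (sect n N (E UNIV * proj_op (window n N) * E' (window n N)))
        - fred n (Z1 UNIV {n..}) * fred (n + int N) (Z2 UNIV {n + int N..})) \<le> b N"
proof -
  obtain v where v: "v \<longlonglongrightarrow> (0 :: real)" "\<And>N. 0 \<le> v N"
    "\<And>n N. cmod (fred n (compress (window n N) (Z1 UNIV {n..})) - fred n (Z1 UNIV {n..})) \<le> exp \<kappa> * (exp (v N) - 1)"
    "\<And>n N. ktotal (g1 {n..} {..<n} \<cdot> kproj {n + int N..}) \<le> ennreal (v N)"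
    by (rule fred_left_tail) blast
  obtain w where w: "w \<longlonglongrightarrow> (0 :: real)"
    "\<And>n N. cmod (fred (n + int N) (Z2 {n..} {n + int N..}) - fred (n + int N) (Z2 UNIV {n + int N..})) \<le> exp \<kappa> * (exp (w N) - 1)"
    by (rule fred_right_tail) blast
  obtain s where s: "esum (\<lambda>i. (c \<cdot> c) i 0) = ennreal s" "0 \<le> s"
    using finite_toeplitz(1)[OF toeplitz_kmul[OF toeplitz_c toeplitz_c] weighted_sum_cc]
    by (cases "esum (\<lambda>i. (c \<cdot> c) i 0)") auto
  \<comment> \<open>The three terms come from the factorisation error (\<open>s\<close> is the
    column sum of \<open>c \<cdot> c\<close>), from the left tail times the bound of the right
    determinant, and from the bound of the left determinant times the right tail. None depends on
    \<open>n\<close>.\<close>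
  define b where "b N = exp \<kappa> * (exp (v N * s) - 1) + exp \<kappa> * (exp (v N) - 1) * exp \<kappa> + exp \<kappa> * (exp \<kappa> * (exp (w N) - 1))" for N
  show thesis
  proof
    have "b \<longlonglongrightarrow> exp \<kappa> * (exp (0 * s) - 1) + exp \<kappa> * (exp 0 - 1) * exp \<kappa> + exp \<kappa> * (exp \<kappa> * (exp 0 - 1))"
      unfolding b_def by (intro tendsto_intros v w)
    then show "b \<longlonglongrightarrow> 0" by simp
    fix n N
    let ?J = "window n N" and ?m = "n + int N"
    let ?d = "det (sect n N (E UNIV * proj_op ?J * E' ?J))"
    let ?x = "fred n (compress ?J (Z1 UNIV {n..}))" and ?x' = "fred n (Z1 UNIV {n..})"
    let ?y = "fred ?m (Z2 {n..} {?m..})" and ?y' = "fred ?m (Z2 UNIV {?m..})"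
    let ?Y = "compress ?J (E UNIV * proj_op {n..} * E' {n..} * proj_op ?J * (E {n..} * proj_op ?J * E' ?J) - 1)"
    have xy: "?x * ?y = fred n ?Y"
      using det_sect_factor[of n N] by (simp only: det_sect_left fred_duality_limit)
    have d: "?d = fred n (Z1 UNIV ?J)" by (simp add: det_sect_eq_fred Z1_def)
    have "cmod (fred n ?Y - fred n (Z1 UNIV ?J)) \<le> exp \<kappa> * (exp (v N * s) - 1)"
    proof (rule cmod_fred_diff_le[OF dom_Z1 ktotal_g1_window \<kappa>(2) finite_section_factor_error])
      have "ktotal (g1 {n..} {..<n} \<cdot> kproj {?m..} \<cdot> (c \<cdot> c))
          \<le> ktotal (g1 {n..} {..<n} \<cdot> kproj {?m..}) * esum (\<lambda>i. (c \<cdot> c) i 0)"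
        by (intro ktotal_kmul_le toeplitz_kmul toeplitz_c)
      also have "\<dots> \<le> ennreal (v N) * ennreal s" unfolding s(1) by (intro mult_right_mono v) simp
      also have "\<dots> = ennreal (v N * s)" using v(2) s(2) by (simp add: ennreal_mult)
      finally show "ktotal (g1 {n..} {..<n} \<cdot> kproj {?m..} \<cdot> (c \<cdot> c)) \<le> ennreal (v N * s)" .
    qed (use v(2) s(2) in simp_all)
    then have 1: "cmod (?d - ?x * ?y) \<le> exp \<kappa> * (exp (v N * s) - 1)"
      unfolding d xy by (simp add: norm_minus_commute)
    have y: "cmod ?y \<le> exp \<kappa>" by (rule cmod_fred_le[OF dom_Z2_right ktotal_g2_right \<kappa>(2)]) simp
    have x': "cmod ?x' \<le> exp \<kappa>" by (rule cmod_fred_le[OF dom_Z1_right ktotal_g1_right \<kappa>(2)])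
    have "?d - ?x' * ?y' = (?d - ?x * ?y) + (?x - ?x') * ?y + ?x' * (?y - ?y')" by (simp add: algebra_simps)
    then have "cmod (?d - ?x' * ?y') \<le> cmod (?d - ?x * ?y) + cmod ((?x - ?x') * ?y) + cmod (?x' * (?y - ?y'))"
      by (metis norm_triangle_le add_mono norm_triangle_ineq order_refl)
    also have "\<dots> \<le> b N"
      unfolding b_def norm_mult using v(3)[of n N] w(2)[of n N]
      by (intro add_mono 1 mult_mono x' y) (auto intro: order_trans[OF norm_ge_zero])
    finally show "cmod (?d - ?x' * ?y') \<le> b N" .
  qed
qed

end

section \<open>The exponential factors\<close>

text \<open>Below pi/3 the mean value theorem applies with cosine at least 1/2; above it, sine is at
  least sqrt 3 / 2, which already exceeds pi/4.\<close>

lemma sin_ge_half: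
  fixes y :: real assumes "0 \<le> y" "y \<le> pi / 2" shows "y / 2 \<le> sin y"
proof (cases "y \<le> pi / 3")
  case True
  show ?thesis
  proof (cases "y = 0")
    case False
    then obtain z where z: "0 < z" "z < y" "sin y - sin 0 = (y - 0) * cos z"
      using MVT2[of 0 y sin cos] assms DERIV_sin by auto
    have "cos (pi / 3) \<le> cos z" using z True by (intro cos_monotone_0_pi_le) auto
    then have "y * (1 / 2) \<le> y * cos z" using assms by (intro mult_left_mono) (simp_all add: cos_60)
    then show ?thesis using z by simp
  qed simp
next
  case False
  have "sin (pi / 3) \<le> sin y" using False assms by (intro sin_monotone_2pi_le) auto
  moreover have "sin (pi / 3) = sqrt 3 / 2" by (rule sin_60)
  \<comment> \<open>17/10 and 34/10 give sqrt 3 / 2 >= 0.85 > pi/4 >= y/2.\<close>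
  moreover have "sqrt 3 \<ge> 17 / 10" by (rule real_le_rsqrt) (simp add: power2_eq_square)
  moreover have "pi < 34 / 10" using pi_approx by simp
  ultimately show ?thesis using assms by linarith
qed

text \<open>With \<open>t\<close> the signed distance to the nearest integer, the right side is 2
  |sin(pi t)|; as |t| is at most 1/2, \<open>sin_ge_half\<close> applies to pi |t|.\<close>

lemma circle_norm_le: "circle_norm \<xi> \<le> cmod (1 - echar \<xi> 1)"
proof transfer
  fix x :: real
  define t where "t = x - of_int (round x)"
  have t: "\<bar>t\<bar> \<le> 1 / 2" unfolding t_def using of_int_round_abs_le[of x] by (simp add: abs_minus_commute)
  have "bdd_below (range (\<lambda>n::int. \<bar>x - of_int n\<bar>))" by (rule bdd_belowI[of _ 0]) auto
  then have "(INF n::int. \<bar>x - of_int n\<bar>) \<le> \<bar>t\<bar>" unfolding t_def by (rule cINF_lower) simp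
  also have "\<bar>t\<bar> \<le> 2 * ((pi * \<bar>t\<bar>) / 2)" using pi_ge_two mult_right_mono[of 1 pi "\<bar>t\<bar>"] by simp
  also have "\<dots> \<le> 2 * sin (pi * \<bar>t\<bar>)"
    using t by (intro mult_left_mono sin_ge_half) (auto simp: mult_left_le intro: order_trans[OF mult_left_mono])
  also have "\<dots> \<le> 2 * \<bar>sin (pi * t)\<bar>"
    by (cases "t \<ge> 0") (auto simp: abs_if)
  also have "\<dots> = cmod (exp (\<i> * of_real (2 * pi * t)) - 1)"
    unfolding dist_exp_i_1 by simp
  also have "exp (\<i> * of_real (2 * pi * t)) = exp (2 * of_real pi * \<i> * of_int 1 * of_real x)"
  proof -
    have "\<i> * of_real (2 * pi * t) = 2 * of_real pi * \<i> * of_int 1 * of_real x - \<i> * (of_int (round x) * (of_real pi * 2))"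
      by (simp add: t_def algebra_simps)
    then show ?thesis using exp_integer_2pi[of "of_int (round x)"] by (simp add: exp_diff)
  qed
  finally show "(INF n::int. \<bar>x - of_int n\<bar>) \<le> cmod (1 - exp (2 * of_real pi * \<i> * of_int 1 * of_real x))"
    by (simp add: norm_minus_commute)
qed

lemma compatible_bound:
  assumes "compatible \<Xi> \<beta>"
  obtains \<delta> where "\<delta> > 0" "\<And>\<xi>. \<xi> \<in> \<Xi> - {0} \<Longrightarrow> \<delta> \<le> \<beta> \<xi> * circle_norm \<xi>"
proof -
  from assms have "0 < (INF \<xi>\<in>\<Xi> - {0}. ereal (\<beta> \<xi> * circle_norm \<xi>))" by (simp add: compatible_def)
  \<comment> \<open>Choosing \<open>e\<close> strictly below the infimum keeps it finite even when
    the infimum is infinite.\<close>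
  then obtain e where e: "0 < e" "e < (INF \<xi>\<in>\<Xi> - {0}. ereal (\<beta> \<xi> * circle_norm \<xi>))"
    using dense by blast
  then obtain \<delta> where \<delta>: "e = ereal \<delta>" by (cases e) auto
  have "\<delta> \<le> \<beta> \<xi> * circle_norm \<xi>" if "\<xi> \<in> \<Xi> - {0}" for \<xi>
  proof -
    have "ereal \<delta> < ereal (\<beta> \<xi> * circle_norm \<xi>)"
      using less_le_trans[OF e(2) INF_lower[OF that]] \<delta> by simp
    then show ?thesis by simp
  qed
  with e \<delta> that[of \<delta>] show thesis by simp
qed

text \<open>Away from the mean value, an almost periodic sequence is a coboundary \<open>B k - B (k + 1)\<close>: this is
  where the compatibility of the weight enters, and the sums over windows telescope.\<close>

definition coboundary :: "real_mod_int set \<Rightarrow> (int \<Rightarrow> complex) \<Rightarrow> int \<Rightarrow> complex" where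
  "coboundary \<Xi> a k = (\<Sum>\<^sub>\<infinity>\<xi>\<in>\<Xi> - {0}. ap_coeff \<Xi> a \<xi> * (tau k \<xi> / (1 - echar \<xi> 1)))"

text \<open>Compatibility bounds the small divisor: 1/|1 - e_xi(1)| is at most
  \<open>\<beta> \<xi> / \<delta>\<close>, which the weighted summability absorbs. The bound is
  uniform in \<open>k\<close> because characters are unimodular.\<close>

lemma coboundary_summable:
  assumes comp: "compatible \<Xi> \<beta>" and \<beta>: "\<And>\<xi>. \<xi> \<in> \<Xi> \<Longrightarrow> 1 \<le> \<beta> \<xi>"
    and s: "(\<lambda>\<xi>. \<beta> \<xi> * cmod (ap_coeff \<Xi> a \<xi>)) summable_on \<Xi>"
  obtains S where "\<And>k. (\<lambda>\<xi>. ap_coeff \<Xi> a \<xi> * (tau k \<xi> / (1 - echar \<xi> 1))) summable_on \<Xi> - {0}"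
    "\<And>k. cmod (coboundary \<Xi> a k) \<le> S"
proof -
  obtain \<delta> where \<delta>: "\<delta> > 0" "\<And>\<xi>. \<xi> \<in> \<Xi> - {0} \<Longrightarrow> \<delta> \<le> \<beta> \<xi> * circle_norm \<xi>"
    using compatible_bound[OF comp] by blast
  let ?g = "\<lambda>\<xi>. \<beta> \<xi> * cmod (ap_coeff \<Xi> a \<xi>) * (1 / \<delta>)"
  have g: "?g summable_on \<Xi> - {0}"
    by (rule summable_on_cmult_left) (rule summable_on_subset_banach[OF s], auto)
  have le: "cmod (ap_coeff \<Xi> a \<xi> * (tau k \<xi> / (1 - echar \<xi> 1))) \<le> ?g \<xi>" if "\<xi> \<in> \<Xi> - {0}" for k \<xi>
  proof -
    have b: "0 < \<beta> \<xi>" using \<beta>[of \<xi>] that by auto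
    have "\<delta> \<le> \<beta> \<xi> * cmod (1 - echar \<xi> 1)"
      using \<delta>(2)[OF that] mult_left_mono[OF circle_norm_le[of \<xi>], of "\<beta> \<xi>"] b by linarith
    then have "1 / cmod (1 - echar \<xi> 1) \<le> \<beta> \<xi> * (1 / \<delta>)"
      using \<delta>(1) b by (cases "cmod (1 - echar \<xi> 1) = 0") (auto simp: field_simps)
    from mult_left_mono[OF this, of "cmod (ap_coeff \<Xi> a \<xi>)"] show ?thesis
      by (simp add: norm_mult norm_divide tau_def norm_echar mult_ac)
  qed
  have sn: "(\<lambda>\<xi>. cmod (ap_coeff \<Xi> a \<xi> * (tau k \<xi> / (1 - echar \<xi> 1)))) summable_on \<Xi> - {0}" for k
    by (rule Infinite_Sum.abs_summable_on_comparison_test'[OF g le])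
  show thesis
  proof
    show "(\<lambda>\<xi>. ap_coeff \<Xi> a \<xi> * (tau k \<xi> / (1 - echar \<xi> 1))) summable_on \<Xi> - {0}" for k
      by (rule abs_summable_summable[OF sn])
    show "cmod (coboundary \<Xi> a k) \<le> infsum ?g (\<Xi> - {0})" for k
      unfolding coboundary_def
      by (rule order_trans[OF norm_infsum_bound[OF sn] infsum_mono[OF sn g le]])
  qed
qed

text \<open>Stepping from \<open>k\<close> to \<open>k + 1\<close> multiplies each term by e_xi(1),
  so the difference cancels the denominator; the frequency 0 contributes the constant.\<close>

lemma coboundary_eq:
  assumes s: "\<And>k. (\<lambda>\<xi>. ap_coeff \<Xi> a \<xi> * (tau k \<xi> / (1 - echar \<xi> 1))) summable_on \<Xi> - {0}"
    and a: "((\<lambda>\<xi>. ap_coeff \<Xi> a \<xi> * echar \<xi> k) has_sum a k) \<Xi>" and 0: "0 \<in> \<Xi>"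
  shows "a k = ap_coeff \<Xi> a 0 + (coboundary \<Xi> a k - coboundary \<Xi> a (k + 1))"
proof -
  have "((\<lambda>\<xi>. ap_coeff \<Xi> a \<xi> * (tau k \<xi> / (1 - echar \<xi> 1)) - ap_coeff \<Xi> a \<xi> * (tau (k + 1) \<xi> / (1 - echar \<xi> 1)))
      has_sum (coboundary \<Xi> a k - coboundary \<Xi> a (k + 1))) (\<Xi> - {0})"
    unfolding coboundary_def
    using has_sum_add[OF has_sum_infsum[OF s[of k]] has_sum_uminusI[OF has_sum_infsum[OF s[of "k + 1"]]]] by simp
  then have "((\<lambda>\<xi>. ap_coeff \<Xi> a \<xi> * echar \<xi> k) has_sum (coboundary \<Xi> a k - coboundary \<Xi> a (k + 1))) (\<Xi> - {0})"
  proof (rule has_sum_cong[THEN iffD1, rotated])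
    fix \<xi> assume "\<xi> \<in> \<Xi> - {0}"
    then have "1 - echar \<xi> 1 \<noteq> 0" using echar_1_eq_1_iff[of \<xi>] by auto
    moreover have "x * (t / d) - x * (t * u / d) = x * t * ((1 - u) / d)" for x t u d :: complex
      by (simp add: diff_divide_distrib right_diff_distrib)
    ultimately show "ap_coeff \<Xi> a \<xi> * (tau k \<xi> / (1 - echar \<xi> 1)) - ap_coeff \<Xi> a \<xi> * (tau (k + 1) \<xi> / (1 - echar \<xi> 1))
        = ap_coeff \<Xi> a \<xi> * echar \<xi> k"
      by (simp add: tau_def echar_add_int)
  qed
  moreover have "((\<lambda>\<xi>. ap_coeff \<Xi> a \<xi> * echar \<xi> k) has_sum ap_coeff \<Xi> a 0) {0}"
    by (rule has_sum_finiteI) (simp_all add: echar_0)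
  ultimately have "((\<lambda>\<xi>. ap_coeff \<Xi> a \<xi> * echar \<xi> k) has_sum (ap_coeff \<Xi> a 0 + (coboundary \<Xi> a k - coboundary \<Xi> a (k + 1)))) ({0} \<union> (\<Xi> - {0}))"
    by (intro has_sum_Un_disjoint) auto
  moreover have "{0} \<union> (\<Xi> - {0}) = \<Xi>" using 0 by auto
  ultimately show ?thesis using has_sum_unique[OF a] by simp
qed

lemma sum_telescope_window:
  fixes a B :: "int \<Rightarrow> complex"
  assumes "\<And>k. a k = z + (B k - B (k + 1))"
  shows "(\<Sum>i<N. a (n + int i)) = of_nat N * z + (B n - B (n + int N))"
  by (induction N) (simp_all add: assms algebra_simps)

text \<open>The telescoped sum differs from \<open>n * z\<close> by a bounded amount, which the
  average kills.\<close>

lemma ap_mean_coboundary: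
  fixes a B :: "int \<Rightarrow> complex"
  assumes a: "\<And>k. a k = z + (B k - B (k + 1))" and B: "\<And>k. cmod (B k) \<le> S"
  shows "ap_mean a = z"
proof -
  have "(\<lambda>n. (B 0 - B (int n)) / of_nat n) \<longlonglongrightarrow> 0"
  proof (rule Lim_null_comparison)
    show "(\<lambda>n. 2 * S * (1 / of_nat n)) \<longlonglongrightarrow> (0 :: real)"
      by (intro tendsto_mult_right_zero lim_1_over_n)
    have "cmod (B 0 - B (int n)) \<le> 2 * S" for n
      using norm_triangle_ineq4[of "B 0" "B (int n)"] B[of 0] B[of "int n"] by linarith
    then show "\<forall>\<^sub>F n in sequentially. cmod ((B 0 - B (int n)) / of_nat n) \<le> 2 * S * (1 / of_nat n)"
      by (intro always_eventually allI) (simp add: norm_divide divide_right_mono)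
  qed
  from tendsto_add[OF tendsto_const[of z] this]
  have "(\<lambda>n. z + (B 0 - B (int n)) / of_nat n) \<longlonglongrightarrow> z" by simp
  moreover have "\<forall>\<^sub>F n in sequentially. z + (B 0 - B (int n)) / of_nat n = (\<Sum>k<n. a (int k)) / of_nat n"
    using eventually_gt_at_top[of 0]
  proof eventually_elim
    case (elim n)
    have "(\<Sum>k<n. a (int k)) = of_nat n * z + (B 0 - B (int n))"
      using sum_telescope_window[of a z B, OF a, where N = n and n = 0] by simp
    with elim show ?case by (simp add: add_divide_distrib)
  qed
  ultimately have "(\<lambda>n. (\<Sum>k<n. a (int k)) / of_nat n) \<longlonglongrightarrow> z" by (rule Lim_transform_eventually)
  then show ?thesis unfolding ap_mean_def by (rule limI)
qed

lemma ap_coeff_sum_list: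
  assumes 0: "\<And>\<xi>. \<xi> \<in> \<Xi> \<Longrightarrow> 1 \<le> \<beta> \<xi>" and As: "set As \<subseteq> wiener_alg \<alpha>\<^sub>1 \<alpha>\<^sub>2 \<Xi> \<beta>"
  defines "a \<equiv> diagonal 0 (sum_list As)"
  shows "(\<lambda>\<xi>. \<beta> \<xi> * cmod (ap_coeff \<Xi> a \<xi>)) summable_on \<Xi>"
    and "((\<lambda>\<xi>. ap_coeff \<Xi> a \<xi> * echar \<xi> k) has_sum a k) \<Xi>"
proof -
  have "\<exists>d. (\<forall>\<xi>. \<xi> \<notin> \<Xi> \<longrightarrow> d \<xi> = 0) \<and> (\<lambda>\<xi>. \<beta> \<xi> * cmod (d \<xi>)) summable_on \<Xi> \<and>
      (\<forall>k. ((\<lambda>\<xi>. d \<xi> * echar \<xi> k) has_sum diagonal 0 (sum_list As) k) \<Xi>)"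
    using As
  proof (induction As)
    case Nil
    show ?case by (rule exI[of _ "\<lambda>_. 0"]) (simp add: diagonal_def entry_zero)
  next
    case (Cons B As)
    then obtain d where d: "\<And>\<xi>. \<xi> \<notin> \<Xi> \<Longrightarrow> d \<xi> = 0" "(\<lambda>\<xi>. \<beta> \<xi> * cmod (d \<xi>)) summable_on \<Xi>"
      "\<And>k. ((\<lambda>\<xi>. d \<xi> * echar \<xi> k) has_sum diagonal 0 (sum_list As) k) \<Xi>" by auto
    define e where "e = ap_coeff \<Xi> (diagonal 0 B)"
    have B: "B \<in> wiener_alg \<alpha>\<^sub>1 \<alpha>\<^sub>2 \<Xi> \<beta>" using Cons.prems by simp
    note e = wiener_alg_coeffs[OF B 0, where n = 0, folded e_def]
    show ?case
    proof (intro exI[of _ "\<lambda>\<xi>. e \<xi> + d \<xi>"] conjI allI impI)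
      show "e \<xi> + d \<xi> = 0" if "\<xi> \<notin> \<Xi>" for \<xi> using d(1) e(1) that by simp
      have le: "norm (\<beta> \<xi> * cmod (e \<xi> + d \<xi>)) \<le> \<beta> \<xi> * cmod (e \<xi>) + \<beta> \<xi> * cmod (d \<xi>)" if "\<xi> \<in> \<Xi>" for \<xi>
        using 0[OF that] norm_triangle_ineq[of "e \<xi>" "d \<xi>"]
        by (simp add: abs_mult flip: distrib_left)
      have "(\<lambda>\<xi>. norm (\<beta> \<xi> * cmod (e \<xi> + d \<xi>))) summable_on \<Xi>"
        by (rule Infinite_Sum.abs_summable_on_comparison_test'[OF summable_on_add[OF e(2) d(2)] le]) auto
      then show "(\<lambda>\<xi>. \<beta> \<xi> * cmod (e \<xi> + d \<xi>)) summable_on \<Xi>" by (rule abs_summable_summable)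
      fix k
      have "diagonal 0 (sum_list (B # As)) k = diagonal 0 B k + diagonal 0 (sum_list As) k"
        by (simp add: diagonal_def entry_add)
      then show "((\<lambda>\<xi>. (e \<xi> + d \<xi>) * echar \<xi> k) has_sum diagonal 0 (sum_list (B # As)) k) \<Xi>"
        using has_sum_add[OF e(3) d(3), of k k] by (simp add: distrib_right)
    qed
  qed
  then obtain d where d: "\<And>\<xi>. \<xi> \<notin> \<Xi> \<Longrightarrow> d \<xi> = 0" "(\<lambda>\<xi>. \<beta> \<xi> * cmod (d \<xi>)) summable_on \<Xi>"
      "\<And>k. ((\<lambda>\<xi>. d \<xi> * echar \<xi> k) has_sum a k) \<Xi>" unfolding a_def by auto
  have "cmod (d \<xi>) \<le> \<beta> \<xi> * cmod (d \<xi>)" if "\<xi> \<in> \<Xi>" for \<xi>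
    using mult_right_mono[OF 0[OF that], of "cmod (d \<xi>)"] by simp
  then have "(\<lambda>\<xi>. cmod (d \<xi>)) summable_on \<Xi>"
    by (intro summable_on_comparison_test[OF d(2)]) auto
  then have "ap_coeff \<Xi> a = d" using d by (intro ap_coeff_eqI) auto
  then show "(\<lambda>\<xi>. \<beta> \<xi> * cmod (ap_coeff \<Xi> a \<xi>)) summable_on \<Xi>"
    "((\<lambda>\<xi>. ap_coeff \<Xi> a \<xi> * echar \<xi> k) has_sum a k) \<Xi>" using d by auto
qed

section \<open>Assembly of the limit formula\<close>

lemma finite_section_eq_sect: "finite_section n (n + int N) A = sect n N A"
  by (rule eq_matI) (auto simp: finite_section_def Let_def sect_def entry_mult_proj_op entry_proj_op_mult)

lemma compress_UNIV [simp]: "compress UNIV A = A"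
  by (simp add: compress_def proj_op_UNIV)

text \<open>The common majorant is the sum of the coefficient kernels of the individual
  operators.\<close>

lemma dominated_family_wiener_alg:
  assumes \<beta>: "\<And>\<xi>. \<xi> \<in> \<Xi> \<Longrightarrow> 1 \<le> \<beta> \<xi>" and \<alpha>: "\<alpha>\<^sub>1 \<ge> 0" "\<alpha>\<^sub>2 \<ge> 0" "\<alpha>\<^sub>1 + \<alpha>\<^sub>2 = 1"
    and As: "set As \<subseteq> wiener_alg \<alpha>\<^sub>1 \<alpha>\<^sub>2 \<Xi> \<beta>"
  obtains f where "dominated_family As f (power_weight \<alpha>\<^sub>1 \<alpha>\<^sub>2)"
proof -
  let ?w = "power_weight \<alpha>\<^sub>1 \<alpha>\<^sub>2"
  have "\<exists>f. toeplitz f \<and> weighted_sum ?w f < \<infinity> \<and> (\<forall>B\<in>set As. dominated B f)"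
    using As
  proof (induction As)
    case Nil
    show ?case by (rule exI[of _ "\<lambda>_ _. 0"]) (simp add: toeplitz_def weighted_sum_def)
  next
    case (Cons B As)
    then obtain f where f: "toeplitz f" "weighted_sum ?w f < \<infinity>" "\<forall>B\<in>set As. dominated B f" by auto
    have B: "B \<in> wiener_alg \<alpha>\<^sub>1 \<alpha>\<^sub>2 \<Xi> \<beta>" using Cons.prems by simp
    obtain c where c: "fourier_rep \<Xi> c B" "weighted_sum ?w (coeff_kernel c) < \<infinity>"
      using wiener_alg_fourier_rep[OF B \<beta> \<alpha>(1,2)] by blast
    let ?f = "\<lambda>i j. coeff_kernel c i j + f i j"
    have "toeplitz ?f" using toeplitz_coeff_kernel f(1) by (simp add: toeplitz_def)
    moreover have "weighted_sum ?w ?f < \<infinity>"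
      using f(2) c(2) by (simp add: weighted_sum_def distrib_left esum_add)
    moreover have "dominated B' ?f" if "B' \<in> set (B # As)" for B'
      using that dominated_coeff_kernel[OF c(1)] f(3)
      by (auto intro: dominated_mono simp: le_fun_def add_increasing2 add_increasing)
    ultimately show ?case by blast
  qed
  then obtain f where f: "toeplitz f" "weighted_sum ?w f < \<infinity>" "\<forall>B\<in>set As. dominated B f" by blast
  show thesis
    by (rule that[of f], unfold_locales)
      (use f \<alpha> power_weight_ge_1 power_weight_submult min_le_power_weight in \<open>auto simp: power_weight_def\<close>)
qed

text \<open>Every twisted compression is a \<open>restr n\<close>; the product collapses to one
  \<open>restr n\<close> with the half-line projection inside, and the bound for \<open>Z1\<close>
  supplies the trace class condition.\<close>

lemma (in dominated_family) fredholm_det_Theta1: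
  assumes "add_subgroup \<Xi>" and rep: "\<forall>B\<in>set As. \<exists>c. fourier_rep \<Xi> c B"
  shows "fredholm_det (compression (twist \<Xi> (tau n) (prod_list (map exp As))) *
      prod_list (map (\<lambda>B. exp (- compression (twist \<Xi> (tau n) B))) (rev As))) = fred n (Z1 UNIV {n..})"
proof -
  have tw: "compression (twist \<Xi> (tau n) B) = restr n B" if "B \<in> set As" for B
    using rep that compression_twist_tau by blast
  have m: "map (\<lambda>B. exp (- compression (twist \<Xi> (tau n) B))) (rev As) = map (\<lambda>B. exp (- restr n B)) (rev As)"
    by (rule map_cong) (auto simp: tw)
  obtain a where "fourier_rep \<Xi> a (prod_list (map exp As))"
    using fourier_rep_prod_list_exp[OF assms(1)] rep by blast
  then have twA: "compression (twist \<Xi> (tau n) (prod_list (map exp As))) = restr n (E UNIV)"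
    by (simp add: compression_twist_tau exp_prod_def)
  let ?B = "restr n (E UNIV * proj_op {n..} * E' {n..})"
  have e: "entry ?B i j - delta i j = entry (Z1 UNIV {n..}) (n + int i) (n + int j)" for i j
    by (simp add: entry_restr Z1_def entry_compress entry_diff entry_one delta_def)
  note Z = dom_Z1_right[of n]
  have "nat_total (\<lambda>i j. entry ?B i j - delta i j) \<le> ennreal \<kappa>"
    unfolding e by (rule order_trans[OF nat_total_dominated[OF Z] ktotal_g1_right])
  then have "nat_total (\<lambda>i j. entry ?B i j - delta i j) < \<infinity>" by (simp add: le_less_trans)
  then show ?thesis
    unfolding m twA restr_exp_prod_inv[symmetric] restr_proj_mult[symmetric]
    by (subst fredholm_det_eq) (simp_all add: e fred_def)
qed

lemma (in dominated_family) fredholm_det_Theta2: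
  assumes "add_subgroup \<Xi>" and rep: "\<forall>B\<in>set As. \<exists>c. fourier_rep \<Xi> c B"
  shows "fredholm_det (prod_list (map (\<lambda>B. exp (compression (twist \<Xi> (tau n) B))) As) *
      compression (twist \<Xi> (tau n) (op_inv (prod_list (map exp As))))) = fred n (Z2 UNIV {n..})"
proof -
  have tw: "compression (twist \<Xi> (tau n) B) = restr n B" if "B \<in> set As" for B
    using rep that compression_twist_tau by blast
  have m: "map (\<lambda>B. exp (compression (twist \<Xi> (tau n) B))) As = map (\<lambda>B. exp (restr n B)) As"
    by (rule map_cong) (auto simp: tw)
  have A: "prod_list (map exp As) = E UNIV" by (simp add: exp_prod_def)
  \<comment> \<open>Two-sided inverses are unique, so the definite description picks the reversed
    product; its expansion comes from the negated operators.\<close>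
  have inv: "op_inv (E UNIV) = E' UNIV"
    unfolding op_inv_def
  proof (rule the_equality)
    fix B assume B: "E UNIV * B = 1 \<and> B * E UNIV = 1"
    have "B = B * (E UNIV * E' UNIV)" by (simp add: exp_prod_mult_inv)
    also have "\<dots> = E' UNIV" using B by (simp flip: mult.assoc)
    finally show "B = E' UNIV" .
  qed (simp add: exp_prod_mult_inv exp_prod_inv_mult)
  have "\<exists>c. fourier_rep \<Xi> c B" if "B \<in> set (rev (map uminus As))" for B
    using that rep fourier_rep_uminus by fastforce
  then obtain a where "fourier_rep \<Xi> a (prod_list (map exp (rev (map uminus As))))"
    using fourier_rep_prod_list_exp[OF assms(1)] by blast
  then have twA: "compression (twist \<Xi> (tau n) (E' UNIV)) = restr n (E' UNIV)"
    by (simp add: compression_twist_tau exp_prod_inv_eq exp_prod_def)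
  let ?B = "restr n (E {n..} * proj_op {n..} * E' UNIV)"
  have e: "entry ?B i j - delta i j = entry (Z2 UNIV {n..}) (n + int i) (n + int j)" for i j
    by (simp add: entry_restr Z2_def entry_compress entry_diff entry_one delta_def)
  note Z = dom_Z2_right[of n UNIV, OF subset_UNIV]
  have "nat_total (\<lambda>i j. entry ?B i j - delta i j) \<le> ennreal \<kappa>"
    unfolding e by (rule order_trans[OF nat_total_dominated[OF Z] ktotal_g2_right])
  then have "nat_total (\<lambda>i j. entry ?B i j - delta i j) < \<infinity>" by (simp add: le_less_trans)
  then show ?thesis
    unfolding m A inv twA restr_exp_prod[symmetric] restr_proj_mult[symmetric]
    by (subst fredholm_det_eq) (simp_all add: e fred_def)
qed

theorem theorem6p4:
  fixes \<Xi> :: "real_mod_int set" and \<beta> :: "real_mod_int \<Rightarrow> real"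
    and \<alpha>\<^sub>1 \<alpha>\<^sub>2 :: real and As :: "int ell2_op list" and A :: "int ell2_op"
    and a :: "int \<Rightarrow> complex" and G :: complex
  assumes "add_subgroup \<Xi>" and "countable \<Xi>"
    and "admissible \<Xi> \<beta>" and "compatible \<Xi> \<beta>"
    and "\<alpha>\<^sub>1 \<ge> 0" and "\<alpha>\<^sub>2 \<ge> 0" and "\<alpha>\<^sub>1 + \<alpha>\<^sub>2 = 1"
    and "set As \<subseteq> wiener_alg \<alpha>\<^sub>1 \<alpha>\<^sub>2 \<Xi> \<beta>"
    and "A = prod_list (map exp As)"
    and "a = diagonal 0 (sum_list As)"
    and "G = exp (ap_mean a)"
  shows "\<forall>\<epsilon>>0. \<exists>k::nat. \<forall>n\<^sub>1 n\<^sub>2 :: int. n\<^sub>2 - n\<^sub>1 > int k \<longrightarrow>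
           cmod (det (finite_section n\<^sub>1 n\<^sub>2 A) / G ^ nat (n\<^sub>2 - n\<^sub>1)
                 - Theta1 \<Xi> As (tau n\<^sub>1) * Theta2 \<Xi> As (tau n\<^sub>2)) < \<epsilon>"
proof -
  have zero: "0 \<in> \<Xi>" using assms(1) by (simp add: add_subgroup_def)
  have \<beta>: "1 \<le> \<beta> \<xi>" if "\<xi> \<in> \<Xi>" for \<xi>
  proof -
    have "1 \<le> \<beta> (\<xi> + 0)" using assms(3) that zero unfolding admissible_def by blast
    then show ?thesis by simp
  qed
  obtain f where "dominated_family As f (power_weight \<alpha>\<^sub>1 \<alpha>\<^sub>2)"
    using dominated_family_wiener_alg[OF \<beta> assms(5-8)] by blast
  then interpret dominated_family As f "power_weight \<alpha>\<^sub>1 \<alpha>\<^sub>2" .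
  obtain b where b: "b \<longlonglongrightarrow> 0"
    "\<And>n N. cmod (det (sect n N (E UNIV * proj_op (window n N) * E' (window n N)))
        - fred n (Z1 UNIV {n..}) * fred (n + int N) (Z2 UNIV {n + int N..})) \<le> b N"
    using finite_section_asymptotics by blast
  note coeff = ap_coeff_sum_list[OF \<beta> assms(8), folded assms(10)]
  let ?B = "coboundary \<Xi> a"
  obtain S where S: "\<And>k. (\<lambda>\<xi>. ap_coeff \<Xi> a \<xi> * (tau k \<xi> / (1 - echar \<xi> 1))) summable_on \<Xi> - {0}"
    "\<And>k. cmod (?B k) \<le> S"
    using coboundary_summable[OF assms(4) \<beta> coeff(1)] by blast
  have ak: "a k = ap_coeff \<Xi> a 0 + (?B k - ?B (k + 1))" for k
    by (rule coboundary_eq[OF S(1) coeff(2) zero])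
  have mean: "ap_mean a = ap_coeff \<Xi> a 0" by (rule ap_mean_coboundary[of a _ ?B, OF ak S(2)])
  have rep: "\<forall>B\<in>set As. \<exists>c. fourier_rep \<Xi> c B"
    using wiener_alg_fourier_rep[OF _ \<beta> assms(5,6)] assms(8) by (meson subsetD)
  \<comment> \<open>The exponent in \<open>Theta1\<close> at \<open>tau n\<close> is the coboundary
    at \<open>n\<close>; in \<open>Theta2\<close> it is the negative.\<close>
  have T1: "Theta1 \<Xi> As (tau n) = exp (?B n) * fred n (Z1 UNIV {n..})" for n
    unfolding Theta1_def Let_def fredholm_det_Theta1[OF assms(1) rep] coboundary_def assms(10) ..
  have T2: "Theta2 \<Xi> As (tau n) = exp (- ?B n) * fred n (Z2 UNIV {n..})" for n
  proof -
    have "(\<Sum>\<^sub>\<infinity>\<xi>\<in>\<Xi> - {0}. ap_coeff \<Xi> a \<xi> * (- tau n \<xi> / (1 - echar \<xi> 1))) = - ?B n"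
      unfolding coboundary_def infsum_uminus[symmetric] by (rule infsum_cong) simp
    then show ?thesis
      unfolding Theta2_def Let_def fredholm_det_Theta2[OF assms(1) rep] assms(10) by simp
  qed
  have main: "cmod (det (finite_section n (n + int N) A) / G ^ N
      - Theta1 \<Xi> As (tau n) * Theta2 \<Xi> As (tau (n + int N))) \<le> exp (2 * S) * b N" for n N
  proof -
    let ?m = "n + int N"
    let ?d = "det (sect n N (E UNIV * proj_op (window n N) * E' (window n N)))"
    let ?p = "fred n (Z1 UNIV {n..}) * fred ?m (Z2 UNIV {?m..})"
    have A: "A = E UNIV" by (simp add: assms(9) exp_prod_def)
    \<comment> \<open>Multiplying by \<open>E'\<close> divides the determinant by the exponential of
      the sum of \<open>a\<close> over the window. The mean contributes \<open>G ^ N\<close>; the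
      boundary values of the coboundary are the exponential factors of the two Theta
      functions.\<close>
    have "?d = det (sect n N A) * exp (- (\<Sum>i<N. a (n + int i)))"
      unfolding sect_mult A by (subst det_mult[of _ N]) (simp_all add: det_sect_exp_prod_inv assms(10) diagonal_def)
    also have "\<dots> = det (sect n N A) * exp (- (of_nat N * ap_mean a + (?B n - ?B ?m)))"
      unfolding sum_telescope_window[of a _ ?B, OF ak] mean ..
    also have "\<dots> = det (sect n N A) / G ^ N * exp (- (?B n - ?B ?m))"
    proof -
      have "exp (- (of_nat N * ap_mean a + (?B n - ?B ?m))) = exp (- (?B n - ?B ?m)) / G ^ N"
        unfolding assms(11) exp_of_nat_mult[symmetric] exp_diff[symmetric] by (simp add: algebra_simps)
      then show ?thesis by simp
    qed
    finally have d: "?d = det (sect n N A) / G ^ N * exp (- (?B n - ?B ?m))" .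
    have "z = exp D * d" if "d = z * exp (- D)" for z D d :: complex using that by (simp add: exp_minus)
    from this[OF d] have "det (finite_section n ?m A) / G ^ N = exp (?B n - ?B ?m) * ?d"
      unfolding finite_section_eq_sect .
    moreover have "Theta1 \<Xi> As (tau n) * Theta2 \<Xi> As (tau ?m) = exp (?B n - ?B ?m) * ?p"
      unfolding T1 T2 by (simp add: exp_diff exp_minus field_simps)
    ultimately have "cmod (det (finite_section n ?m A) / G ^ N - Theta1 \<Xi> As (tau n) * Theta2 \<Xi> As (tau ?m))
        = cmod (exp (?B n - ?B ?m)) * cmod (?d - ?p)"
      by (simp only: right_diff_distrib[symmetric] norm_mult)
    also have "\<dots> \<le> exp (2 * S) * b N"
    proof (rule mult_mono)
      \<comment> \<open>The common exponential factor stays bounded because the coboundary is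
        bounded uniformly in the position.\<close>
      have "Re (?B n - ?B ?m) \<le> cmod (?B n) + cmod (?B ?m)"
        using complex_Re_le_cmod[of "?B n - ?B ?m"] norm_triangle_ineq4[of "?B n" "?B ?m"] by linarith
      also have "\<dots> \<le> 2 * S" using S(2)[of n] S(2)[of ?m] by linarith
      finally show "cmod (exp (?B n - ?B ?m)) \<le> exp (2 * S)" by simp
    qed (use b(2) in auto)
    finally show ?thesis .
  qed
  have lim: "(\<lambda>N. exp (2 * S) * b N) \<longlonglongrightarrow> 0" by (rule tendsto_mult_right_zero[OF b(1)])
  show ?thesis
  proof (intro allI impI)
    fix \<epsilon> :: real assume "\<epsilon> > 0"
    from order_tendstoD(2)[OF lim this] obtain k where k: "\<And>N. N \<ge> k \<Longrightarrow> exp (2 * S) * b N < \<epsilon>"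
      by (auto simp: eventually_sequentially)
    show "\<exists>k::nat. \<forall>n\<^sub>1 n\<^sub>2 :: int. n\<^sub>2 - n\<^sub>1 > int k \<longrightarrow>
           cmod (det (finite_section n\<^sub>1 n\<^sub>2 A) / G ^ nat (n\<^sub>2 - n\<^sub>1)
                 - Theta1 \<Xi> As (tau n\<^sub>1) * Theta2 \<Xi> As (tau n\<^sub>2)) < \<epsilon>"
    proof (intro exI[of _ k] allI impI)
      fix n\<^sub>1 n\<^sub>2 :: int assume n: "n\<^sub>2 - n\<^sub>1 > int k"
      define N where "N = nat (n\<^sub>2 - n\<^sub>1)"
      have N: "n\<^sub>2 = n\<^sub>1 + int N" "k \<le> N" using n by (auto simp: N_def)
      show "cmod (det (finite_section n\<^sub>1 n\<^sub>2 A) / G ^ nat (n\<^sub>2 - n\<^sub>1)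
                 - Theta1 \<Xi> As (tau n\<^sub>1) * Theta2 \<Xi> As (tau n\<^sub>2)) < \<epsilon>"
        using main[of n\<^sub>1 N] k[OF N(2)] N(1) by simp
    qed
  qed
qed

end
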